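(* Let $d$ be a positive integer and let $\delta>\max(1,\,d/2)$ be a real number. Define $$W_\delta(r)={}_1F_2\left(\delta;\,\frac{3\delta}{2},\,\frac{3\delta+1}{2};\,-\frac{r^2}{4}\right)\qquad(r\ge0),$$ let $$\Phi_{d,\delta}(t)=\frac{1}{B(2\delta-d,\,\delta)}\int_t^1(s^2-t^2)^{\delta-\frac{d+1}{2}}(1-s)^{\delta-1}\,ds\quad\text{for }0\le t\le1,\qquad \Phi_{d,\delta}(t)=0\ \text{ for } t>1,$$ and let $$\omega_{d,\delta}=\frac{2^{1-d}\,\Gamma(3\delta)\,\Gamma\left(\delta-\frac d2\right)}{\Gamma(\delta)\,\Gamma(3\delta-d)\,\Gamma\left(\frac d2\right)}.$$ Then the following hold. (i) $W_\delta$ is positive definite on $\mathbb{R}^d$, and for $r\ge 0$, $$W_\delta(r)=\frac{1}{B(\delta,\,2\delta)}\int_0^\infty\Omega_{\delta-\frac12}(rt)\,(1-t)_+^{\delta-1}\,t^{2\delta-1}\,dt=\omega_{d,\delta}\int_0^\infty\Omega_{\frac{d-2}{2}}(rt)\,\Phi_{d,\delta}(t)\,t^{d-1}\,dt.$$ (ii) $0<W_\delta(r)\le1$ for each $r\ge0$, and as $r\to\infty$, $$W_\delta(r)=\frac{\Gamma(3\delta)}{\Gamma(\delta)}\,r^{-2\delta}\left[1+\frac{\cos(r-\delta\pi)}{2^{\delta-1}}\right]+O\left(r^{-2\delta-1}\right).$$ Moreover, $W_\delta(r)\approx(1+r)^{-2\delta}$ for $r\ge0$. (iii) $W_\delta\in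 C([0,\infty))\cap L^1\left([0,\infty),\,r^{d-1}dr\right)$ and $$\Phi_{d,\delta}(t)=\frac{1}{2^{d-2}\,[\Gamma(d/2)]^2\,\omega_{d,\delta}}\int_0^\infty\Omega_{\frac{d-2}{2}}(rt)\,W_\delta(r)\,r^{d-1}\,dr\qquad(t\ge0).$$ As a consequence, $\Phi_{d,\delta}$ is positive definite on $\mathbb{R}^d$.
   Context: Notation. For $\lambda>-1$, $\Omega_\lambda:\mathbb{R}\to\mathbb{R}$ is $$\Omega_\lambda(t)=\Gamma(\lambda+1)\sum_{k=0}^\infty \frac{(-1)^k}{k!\,\Gamma(\lambda+k+1)}\left(\frac t2\right)^{2k}=\Gamma(\lambda+1)(t/2)^{-\lambda}J_\lambda(t),$$ where $J_\lambda$ is the Bessel function of the first kind. The generalized hypergeometric function is ${}_pF_q(a_1,\dots,a_p;b_1,\dots,b_q;r)=\sum_{k\ge0}\frac{(a_1)_k\cdots(a_p)_k}{k!\,(b_1)_k\cdots(b_q)_k}r^k$, with $(a)_0=1$ and $(a)_k=a(a+1)\cdots(a+k-1)$ for $k\ge1$. $B(a,b)=\int_0^1 t^{a-1}(1-t)^{b-1}dt$ is the Euler beta function, and $x_+=\max(x,0)$. For real functions $f,g$ on a set $X$, $f(x)\approx g(x)$ for $x\in X$ means there are positive constants $c_1,c_2$ with $c_1g(x)\le f(x)\le c_2 g(x)$ for all $x\in X$. A function $\Phi$ on $\mathbb{R}^d$ is positive definite if $\sum_{j,k=1}^N\Phi(\mathbf{x}_j-\mathbf{x}_k)z_j\overline{z_k}\ge0$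 for every $N$, all (pairwise distinct) $\mathbf{x}_1,\dots,\mathbf{x}_N\in\mathbb{R}^d$ and all $z_1,\dots,z_N\in\mathbb{C}$, with equality only when $z_1=\cdots=z_N=0$. A function $\phi$ on $[0,\infty)$ is positive definite on $\mathbb{R}^d$ if its radial extension $\mathbf{x}\mapsto\phi(|\mathbf{x}|)$, $\mathbf{x}\in\mathbb{R}^d$, is positive definite, where $|\cdot|$ is the Euclidean norm. *)

theory Defs
  imports "HOL-Analysis.Analysis" "HOL-Library.Landau_Symbols"
begin

text \<open>
  \<open>Omega l t = \<Gamma>(l+1) (t/2)\<^sup>-\<^sup>l J\<^sub>l(t)\<close>, where \<open>J\<^sub>l\<close> is the Bessel function of the first kind.
  Meant for \<open>l > -1\<close>, where the series converges for every real \<open>t\<close>.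
\<close>
definition Omega :: "real \<Rightarrow> real \<Rightarrow> real" where
  "Omega l t = Gamma (l + 1) *
     (\<Sum>k. (-1) ^ k / (fact k * Gamma (l + real k + 1)) * (t / 2) ^ (2 * k))"

text \<open>The generalized hypergeometric function \<open>\<^sub>pF\<^sub>q(as; bs; r)\<close>, \<open>p = length as\<close>, \<open>q = length bs\<close>.\<close>
definition hypergeometric :: "real list \<Rightarrow> real list \<Rightarrow> real \<Rightarrow> real" where
  "hypergeometric as bs r = eval_fps (fps_hypergeo as bs 1) r"

lemma hypergeometric_altdef:
  "hypergeometric as bs r =
     (\<Sum>k. (\<Prod>a\<leftarrow>as. pochhammer a k) / (fact k * (\<Prod>b\<leftarrow>bs. pochhammer b k)) * r ^ k)"
proof -
  have *: "foldr (\<lambda>a r. r * pochhammer a k) xs c = c * (\<Prod>a\<leftarrow>xs. pochhammer a k)"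
    for xs :: "real list" and c :: real and k
    by (induction xs) (simp_all add: mult_ac)
  show ?thesis
    unfolding hypergeometric_def eval_fps_def fps_hypergeo_nth_alt * by simp
qed

definition comparable_on :: "'a set \<Rightarrow> ('a \<Rightarrow> real) \<Rightarrow> ('a \<Rightarrow> real) \<Rightarrow> bool" where
  "comparable_on X f g \<longleftrightarrow>
     (\<exists>c1>0. \<exists>c2>0. \<forall>x\<in>X. c1 * g x \<le> f x \<and> f x \<le> c2 * g x)"

text \<open>
  Positive definiteness in the strict sense: the quadratic forms are real, nonnegative, and vanish
  only for zero coefficients.
\<close>
definition positive_definite :: "('a::ab_group_add \<Rightarrow> complex) \<Rightarrow> bool" where
  "positive_definite \<Phi> \<longleftrightarrow>
     (\<forall>(N::nat) (x :: nat \<Rightarrow> 'a) (z :: nat \<Rightarrow> complex). inj_on x {..<N} \<longrightarrow>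
        (let S = (\<Sum>j<N. \<Sum>k<N. \<Phi> (x j - x k) * z j * cnj (z k))
         in S \<in> \<real>\<^sub>\<ge>\<^sub>0 \<and> (S = 0 \<longrightarrow> (\<forall>j<N. z j = 0))))"

text \<open>
  Positive definiteness on \<open>\<real>\<^sup>d\<close>, \<open>d = CARD('n)\<close>, of a function on \<open>[0,\<infinity>)\<close>; the values
  of \<open>\<phi>\<close> on the negative half-line are irrelevant.
\<close>
definition radial_positive_definite :: "'n::finite itself \<Rightarrow> (real \<Rightarrow> real) \<Rightarrow> bool" where
  "radial_positive_definite TYPE('n) \<phi> \<longleftrightarrow>
     positive_definite (\<lambda>x :: real ^ 'n. complex_of_real (\<phi> (norm x)))"

definition W :: "real \<Rightarrow> real \<Rightarrow> real" where
  "W \<delta> r = hypergeometric [\<delta>] [3 * \<delta> / 2, (3 * \<delta> + 1) / 2] (- (r\<^sup>2 / 4))"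

text \<open>
  The library's \<open>Beta\<close> is defined by Gamma functions; it equals Euler's integral for positive
  arguments by \<open>has_integral_Beta_real\<close>. The value of \<open>Phi\<close> on the negative half-line is arbitrary.
\<close>
definition Phi :: "nat \<Rightarrow> real \<Rightarrow> real \<Rightarrow> real" where
  "Phi d \<delta> t =
     (if 0 \<le> t \<and> t \<le> 1
      then 1 / Beta (2 * \<delta> - real d) \<delta> *
             (LINT s:{t..1}|lborel.
                (s\<^sup>2 - t\<^sup>2) powr (\<delta> - (real d + 1) / 2) * (1 - s) powr (\<delta> - 1))
      else 0)"

definition omega :: "nat \<Rightarrow> real \<Rightarrow> real" where
  "omega d \<delta> =
     2 powr (1 - real d) * Gamma (3 * \<delta>) * Gamma (\<delta> - real d / 2) /
     (Gamma \<delta> * Gamma (3 * \<delta> - real d) * Gamma (real d / 2))"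

end

theory Submission
  imports Defs "HOL-Complex_Analysis.Complex_Analysis" "HOL-Real_Asymp.Real_Asymp"
begin

text \<open>
  Both integral representations of \<open>W\<close> follow by termwise integration, since the even moments of the
  weights are Beta functions. The function \<open>h(t) = t\<^sup>2\<^sup>\<delta> W(t)\<close> satisfies a third-order linear
  equation that is the symmetric square of a second-order equation up to a potential term of constant
  sign; the resulting energy increases from \<open>0\<close> and would be nonpositive at a zero of \<open>h\<close>, hence \<open>W > 0\<close>.

  The same equation is an integrable perturbation of \<open>h''' + h' = 0\<close>, which gives
  \<open>h(t) = A + P cos t + Q sin t + O(1/t)\<close>. The constants are read off the Laplace transform
  \<open>\<Gamma>(3\<delta>) (s(s\<^sup>2 + 1))\<^sup>-\<^sup>\<delta>\<close> of \<open>t\<^sup>3\<^sup>\<delta>\<^sup>-\<^sup>1 W(t)\<close> at its singularities \<open>0\<close> and \<open>\<i>\<close>.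

  Neither polar coordinates nor Fourier inversion are needed. The identity between the Fourier transform of
  a radial function and its Hankel transform, and the inversion formula for \<open>Phi\<close>, are computed for Gaussians, and
  carry over to continuous functions because combinations of \<open>exp (-n t\<^sup>2)\<close> are dense by the Weierstrass theorem.
  Strict positive definiteness then reduces to linear independence of exponentials on an open set.
\<close>

section \<open>Even power series\<close>

text \<open>The denominator parameters \<open>3 * \<delta> / 2\<close> and
  \<open>(3 * \<delta> + 1) / 2\<close> merge by duplication into the single symbol
  \<open>pochhammer (3 * \<delta>) (2 * k)\<close>. This is why the Beta moments and the Laplace
  moments both cancel against the coefficients of \<open>W\<close>. The kernels being averaged
  oscillate, so the integral formulas do not show the sign of \<open>W\<close>, and an expansion at
  infinity would give it only for large arguments. The energy treats all arguments at once; its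
  derivative carries the factor \<open>\<delta> * (\<delta> - 1) * (2 * \<delta> - 1)\<close>,
  positive for \<delta> > 1. The constant and the oscillating terms of \<open>h\<close> have the
  same order. Since the form of \<open>h\<close>, with an error rate, is known before transforms
  enter, plain limits of the transform at its singularities suffice: the terms blow up at different
  points, and the error is smaller by one power. The condition \<delta> > d/2 acts on both sides of
  the transform: it controls the integrand of \<open>Phi\<close> down to \<open>t = 0\<close>, and
  it makes \<open>W\<close> integrable against \<open>r^(d-1)\<close>.\<close>

definition even_series :: "(nat \<Rightarrow> real) \<Rightarrow> real \<Rightarrow> real" where
  "even_series b t = (\<Sum>k. b k * t ^ (2 * k))"

text \<open>The variable \<open>x\<close> stands for the square of the argument of
  \<open>even_series\<close>. Convergence at every real \<open>x\<close> makes the series in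
  \<open>x\<close> entire, so it can be differentiated termwise, and \<open>even_series\<close> is
  its composition with squaring.\<close>

definition entire_coeffs :: "(nat \<Rightarrow> real) \<Rightarrow> bool" where
  "entire_coeffs b \<longleftrightarrow> (\<forall>x. summable (\<lambda>k. b k * x ^ k))"

lemma entire_coeffs_summable_abs:
  assumes "entire_coeffs b"
  shows "summable (\<lambda>k. \<bar>b k\<bar> * \<bar>x\<bar> ^ k)"
proof -
  have "summable (\<lambda>k. norm (b k * \<bar>x\<bar> ^ k))"
    by (rule powser_insidea[where x = "\<bar>x\<bar> + 1"]) (use assms in \<open>auto simp: entire_coeffs_def\<close>)
  then show ?thesis by (simp add: abs_mult power_abs)
qed

lemma even_series_sums:
  assumes "entire_coeffs b"
  shows "(\<lambda>k. b k * t ^ (2 * k)) sums even_series b t"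
  using assms unfolding even_series_def entire_coeffs_def
  by (simp add: summable_sums power_mult)

lemma even_series_0 [simp]: "even_series b 0 = b 0"
proof -
  have "(\<lambda>k. b k * 0 ^ (2 * k)) sums (\<Sum>k\<in>{0}. b k * 0 ^ (2 * k))"
    by (rule sums_finite) auto
  then show ?thesis by (simp add: even_series_def sums_unique[symmetric])
qed

lemma entire_coeffs_cmult: "entire_coeffs b \<Longrightarrow> entire_coeffs (\<lambda>k. c * b k)"
  unfolding entire_coeffs_def by (simp add: mult.assoc summable_mult)

lemma entire_coeffs_diffs: "entire_coeffs b \<Longrightarrow> entire_coeffs (diffs b)"
  unfolding entire_coeffs_def using termdiff_converges_all[of b] by blast

lemma entire_coeffs_shift_iff: "entire_coeffs (\<lambda>k. b (Suc k)) \<longleftrightarrow> entire_coeffs b"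
proof -
  have "summable (\<lambda>k. b (Suc k) * x ^ k) \<longleftrightarrow> summable (\<lambda>k. b k * x ^ k)" for x
    using summable_powser_split_head[of b x] by simp
  then show ?thesis by (simp add: entire_coeffs_def)
qed

lemma entire_coeffs_times_index: "entire_coeffs b \<Longrightarrow> entire_coeffs (\<lambda>k. real k * b k)"
  using entire_coeffs_diffs[of b] entire_coeffs_shift_iff[of "\<lambda>k. real k * b k"]
  by (simp add: diffs_def)

lemma entire_coeffs_add:
  "entire_coeffs b \<Longrightarrow> entire_coeffs c \<Longrightarrow> entire_coeffs (\<lambda>k. b k + c k)"
  unfolding entire_coeffs_def by (auto simp: ring_distribs intro: summable_add)

lemma entire_coeffs_times_affine:
  "entire_coeffs b \<Longrightarrow> entire_coeffs (\<lambda>k. (p * real k + q) * b k)"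
  using entire_coeffs_add[OF entire_coeffs_cmult[OF entire_coeffs_times_index, of b p]
      entire_coeffs_cmult[of b q]]
  by (simp add: ring_distribs mult_ac)

lemma even_series_add:
  "entire_coeffs b \<Longrightarrow> entire_coeffs c \<Longrightarrow>
    even_series (\<lambda>k. b k + c k) t = even_series b t + even_series c t"
  using sums_add[OF even_series_sums[of b t] even_series_sums[of c t]]
    even_series_sums[OF entire_coeffs_add, of b c t]
  by (simp add: ring_distribs sums_unique2)

lemma even_series_cmult:
  "entire_coeffs b \<Longrightarrow> even_series (\<lambda>k. c * b k) t = c * even_series b t"
  using sums_mult[OF even_series_sums[of b t], of c]
    even_series_sums[OF entire_coeffs_cmult, of b c t]
  by (simp add: mult.assoc sums_unique2)

lemma even_series_shift:
  assumes "entire_coeffs b" "b 0 = 0"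
  shows "even_series b t = t\<^sup>2 * even_series (\<lambda>k. b (Suc k)) t"
proof -
  have "(\<lambda>k. t\<^sup>2 * (b (Suc k) * t ^ (2 * k))) sums (t\<^sup>2 * even_series (\<lambda>k. b (Suc k)) t)"
    using assms(1) by (intro sums_mult even_series_sums) (simp add: entire_coeffs_shift_iff)
  then have "(\<lambda>k. b (Suc k) * t ^ (2 * Suc k)) sums (t\<^sup>2 * even_series (\<lambda>k. b (Suc k)) t)"
    by (simp add: power2_eq_square algebra_simps)
  then have "(\<lambda>k. b k * t ^ (2 * k)) sums (t\<^sup>2 * even_series (\<lambda>k. b (Suc k)) t)"
    using sums_Suc_iff[of "\<lambda>k. b k * t ^ (2 * k)"] assms(2) by simp
  then show ?thesis
    by (simp add: even_series_def sums_unique[symmetric])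
qed

lemma DERIV_even_series:
  assumes "entire_coeffs b"
  shows "(even_series b has_real_derivative 2 * t * even_series (diffs b) t) (at t)"
proof -
  have "((\<lambda>x. \<Sum>k. b k * x ^ k) has_real_derivative (\<Sum>k. diffs b k * (t\<^sup>2) ^ k)) (at (t\<^sup>2))"
    by (rule termdiffs_strong_converges_everywhere) (use assms in \<open>simp add: entire_coeffs_def\<close>)
  then have "((\<lambda>s. \<Sum>k. b k * (s\<^sup>2) ^ k) has_real_derivative
      (\<Sum>k. diffs b k * (t\<^sup>2) ^ k) * (2 * t)) (at t)"
    by (rule DERIV_chain2) (auto intro!: derivative_eq_intros)
  then show ?thesis
    unfolding even_series_def[abs_def] power_mult by (simp only: mult_ac)
qed

text \<open>The Euler operator \<open>t d/dt\<close> acts on coefficients as multiplication by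
  \<open>2 * k\<close>. Differential equations for even series thereby become polynomial identities
  in \<open>k\<close> together with one index shift, \<open>even_series_shift\<close>.\<close>

lemma even_series_euler:
  assumes "entire_coeffs b"
  shows "t * (2 * t * even_series (diffs b) t) = even_series (\<lambda>k. 2 * real k * b k) t"
proof -
  have "even_series (\<lambda>k. 2 * (real k * b k)) t = 2 * (t\<^sup>2 * even_series (\<lambda>k. real (Suc k) * b (Suc k)) t)"
    using even_series_cmult[OF entire_coeffs_times_index[OF assms], of 2 t]
      even_series_shift[OF entire_coeffs_times_index[OF assms], of t] by simp
  then show ?thesis by (simp add: power2_eq_square diffs_def mult_ac)
qed

lemma DERIV_even_series_euler:
  assumes "entire_coeffs b" "t \<noteq> 0"
  shows "(even_series b has_real_derivative even_series (\<lambda>k. 2 * real k * b k) t / t) (at t)"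
proof -
  have "2 * t * even_series (diffs b) t = even_series (\<lambda>k. 2 * real k * b k) t / t"
    using even_series_euler[OF assms(1), of t] assms(2) by (simp add: field_simps)
  with DERIV_even_series[OF assms(1), of t] show ?thesis by simp
qed

lemma continuous_on_even_series: "entire_coeffs b \<Longrightarrow> continuous_on A (even_series b)"
  by (intro continuous_at_imp_continuous_on ballI DERIV_isCont[OF DERIV_even_series])

text \<open>Sum and integral are exchanged by absolute convergence: since \<open>g\<close> is
  nonnegative and the powers are even, the absolute value of the \<open>k\<close>-th term integrates
  to exactly \<open>\<bar>b k\<bar> * m k\<close>.\<close>

lemma even_series_integral:
  fixes g :: "real \<Rightarrow> real"
  assumes "entire_coeffs b" "\<And>t. 0 \<le> g t"
    and m: "\<And>k. has_bochner_integral lborel (\<lambda>t. t ^ (2 * k) * g t) (m k)"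
    and s: "summable (\<lambda>k. \<bar>b k\<bar> * m k)"
  shows "has_bochner_integral lborel (\<lambda>t. even_series b t * g t) (\<Sum>k. b k * m k)"
    and "summable (\<lambda>k. b k * m k)"
proof -
  let ?f = "\<lambda>k t. b k * (t ^ (2 * k) * g t)"
  have hb: "has_bochner_integral lborel (?f k) (b k * m k)" for k
    by (intro has_bochner_integral_mult_right m)
  have hn: "has_bochner_integral lborel (\<lambda>t. norm (?f k t)) (\<bar>b k\<bar> * m k)" for k
  proof -
    have "has_bochner_integral lborel (\<lambda>t. \<bar>b k\<bar> * (t ^ (2 * k) * g t)) (\<bar>b k\<bar> * m k)"
      by (intro has_bochner_integral_mult_right m)
    moreover have "(\<lambda>t. norm (?f k t)) = (\<lambda>t. \<bar>b k\<bar> * (t ^ (2 * k) * g t))"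
      using assms(2) by (simp add: abs_mult fun_eq_iff)
    ultimately show ?thesis by simp
  qed
  have sm: "summable (\<lambda>k. norm (?f k t))" for t
  proof -
    have "summable (\<lambda>k. \<bar>b k\<bar> * \<bar>t\<^sup>2\<bar> ^ k * g t)"
      by (intro summable_mult2 entire_coeffs_summable_abs assms)
    moreover have "norm (?f k t) = \<bar>b k\<bar> * \<bar>t\<^sup>2\<bar> ^ k * g t" for k
      using assms(2)[of t] by (simp add: abs_mult power_mult)
    ultimately show ?thesis by simp
  qed
  have i: "integrable lborel (?f k)" for k using hb by (simp add: has_bochner_integral_iff)
  have si: "summable (\<lambda>k. \<integral>t. norm (?f k t) \<partial>lborel)"
    using s hn by (simp add: has_bochner_integral_iff)
  have eq: "(\<Sum>k. ?f k t) = even_series b t * g t" for t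
    using sums_mult2[OF even_series_sums[OF assms(1), of t], of "g t"]
    by (simp add: sums_unique[symmetric] mult.assoc)
  have "integrable lborel (\<lambda>t. \<Sum>k. ?f k t)"
    by (rule integrable_suminf[OF i _ si]) (intro always_eventually allI sm)
  moreover have "(\<lambda>k. integral\<^sup>L lborel (?f k)) sums (\<integral>t. (\<Sum>k. ?f k t) \<partial>lborel)"
    by (rule sums_integral[OF i _ si]) (intro always_eventually allI sm)
  moreover have "integral\<^sup>L lborel (?f k) = b k * m k" for k
    using hb[of k] by (rule has_bochner_integral_integral_eq)
  ultimately show "has_bochner_integral lborel (\<lambda>t. even_series b t * g t) (\<Sum>k. b k * m k)"
      "summable (\<lambda>k. b k * m k)"
    unfolding eq has_bochner_integral_iff sums_iff by (simp_all only: simp_thms)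
qed

section \<open>The functions \<open>Omega\<close> and \<open>W\<close> as power series\<close>

text \<open>The quotient \<open>Gamma (l + 1) / Gamma (l + k + 1)\<close> has become
  \<open>1 / pochhammer (l + 1) k\<close>, and the halved argument contributes
  \<open>4 ^ k\<close>.\<close>

definition omega_coeff :: "real \<Rightarrow> nat \<Rightarrow> real" where
  "omega_coeff l k = (-1) ^ k / (fact k * pochhammer (l + 1) k * 4 ^ k)"


lemma entire_coeffs_ratio:
  assumes "\<And>k. b (Suc k) = \<rho> k * b k" "\<rho> \<longlonglongrightarrow> 0"
  shows "entire_coeffs b"
  unfolding entire_coeffs_def
proof
  fix x :: real
  have "(\<lambda>k. \<rho> k * x) \<longlonglongrightarrow> 0 * x" by (intro tendsto_intros assms)
  then have "eventually (\<lambda>k. \<bar>\<rho> k * x\<bar> < 1/2) sequentially"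
    by (auto simp: tendsto_iff dist_norm elim: allE[of _ "1/2"])
  then obtain N where N: "\<And>k. k \<ge> N \<Longrightarrow> \<bar>\<rho> k * x\<bar> < 1/2"
    by (auto simp: eventually_sequentially)
  show "summable (\<lambda>k. b k * x ^ k)"
  proof (rule summable_ratio_test[of "1/2" N])
    fix k assume "N \<le> k"
    then have *: "\<bar>\<rho> k * x\<bar> * \<bar>b k * x ^ k\<bar> \<le> 1/2 * \<bar>b k * x ^ k\<bar>"
      using N[of k] by (intro mult_right_mono) auto
    have "b (Suc k) * x ^ Suc k = (\<rho> k * x) * (b k * x ^ k)" by (simp add: assms(1))
    then have "\<bar>b (Suc k) * x ^ Suc k\<bar> = \<bar>\<rho> k * x\<bar> * \<bar>b k * x ^ k\<bar>" by (simp only: abs_mult)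
    with * show "norm (b (Suc k) * x ^ Suc k) \<le> 1/2 * norm (b k * x ^ k)"
      unfolding real_norm_def by linarith
  qed simp
qed

lemma omega_coeff_Suc:
  assumes "l > -1"
  shows "omega_coeff l (Suc k) = - 1 / (4 * (real k + 1) * (l + 1 + real k)) * omega_coeff l k"
  using assms pochhammer_pos[of "l + 1" k] by (simp add: omega_coeff_def pochhammer_Suc divide_simps)

lemma entire_omega_coeff:
  assumes "l > -1"
  shows "entire_coeffs (omega_coeff l)"
proof (rule entire_coeffs_ratio, rule omega_coeff_Suc[OF assms])
  show "(\<lambda>k. - 1 / (4 * (real k + 1) * (l + 1 + real k))) \<longlonglongrightarrow> 0"
    by real_asymp
qed

lemma Omega_eq_even_series:
  assumes "l > -1"
  shows "Omega l = even_series (omega_coeff l)"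
proof
  fix t :: real
  have z: "l + 1 \<notin> \<int>\<^sub>\<le>\<^sub>0" using assms by (auto elim!: nonpos_Ints_cases)
  have G: "Gamma (l + 1) > 0" using assms by (intro Gamma_real_pos) auto
  have p: "Gamma (l + real k + 1) = pochhammer (l + 1) k * Gamma (l + 1)" for k
    using pochhammer_Gamma[OF z, of k] G by (simp add: field_simps)
  have t2: "(t / 2) ^ (2 * k) = t ^ (2 * k) / 4 ^ k" for k
    by (simp add: power_divide power_mult)
  have *: "(-1) ^ k / (fact k * Gamma (l + real k + 1)) * (t / 2) ^ (2 * k)
        = 1 / Gamma (l + 1) * (omega_coeff l k * t ^ (2 * k))" for k
    using G by (simp add: p t2 omega_coeff_def)
  have "(\<lambda>k. 1 / Gamma (l + 1) * (omega_coeff l k * t ^ (2 * k))) sums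
      (1 / Gamma (l + 1) * even_series (omega_coeff l) t)"
    by (intro sums_mult even_series_sums entire_omega_coeff assms)
  with G show "Omega l t = even_series (omega_coeff l) t"
    unfolding Omega_def * by (simp only: sums_unique[symmetric]) simp
qed

lemma continuous_on_Omega: "l > -1 \<Longrightarrow> continuous_on A (Omega l)"
  by (simp add: Omega_eq_even_series continuous_on_even_series entire_omega_coeff)

lemma isCont_Omega: "l > -1 \<Longrightarrow> isCont (Omega l) t"
  using continuous_on_Omega[of l UNIV] by (simp add: continuous_on_eq_continuous_at)

lemma borel_measurable_Omega: "l > -1 \<Longrightarrow> Omega l \<in> borel_measurable borel"
  by (intro borel_measurable_continuous_onI continuous_on_Omega)

lemma Omega_0 [simp]: "l > -1 \<Longrightarrow> Omega l 0 = 1"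
  by (simp add: Omega_eq_even_series omega_coeff_def)

lemma Omega_minus: "l > -1 \<Longrightarrow> Omega l (- t) = Omega l t"
  by (simp add: Omega_eq_even_series even_series_def)

text \<open>The energy \<open>y\<^sup>2 + y'\<^sup>2\<close> of the Bessel-type equation \<open>y'' + (2l+1)/t y' + y = 0\<close> decreases.\<close>
lemma abs_Omega_le_1:
  assumes "l \<ge> -1/2"
  shows "\<bar>Omega l t\<bar> \<le> 1"
proof -
  have l: "l > -1" using assms by simp
  define b where "b = omega_coeff l"
  have b: "entire_coeffs b" unfolding b_def by (rule entire_omega_coeff[OF l])
  define y1 where "y1 = even_series (\<lambda>k. 2 * real k * b k)"
  have b1: "entire_coeffs (\<lambda>k. 2 * real k * b k)"
    using entire_coeffs_times_affine[OF b, of 2 0] by simp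
  have b2: "entire_coeffs (\<lambda>k. 2 * real k * (2 * real k * b k))"
    using entire_coeffs_times_affine[OF b1, of 2 0] by simp
  \<comment> \<open>Bessel's equation in Euler form: with \<open>\<theta> = t d/dt\<close> it reads
    \<open>\<theta> (\<theta> + 2 l) y = - t\<^sup>2 y\<close>, which on coefficients is the
    recursion \<open>omega_coeff_Suc\<close>.\<close>
  have ode: "even_series (\<lambda>k. 2 * real k * (2 * real k * b k)) t = - t\<^sup>2 * even_series b t - 2 * l * y1 t" for t
  proof -
    let ?c = "\<lambda>k. 2 * real k * (2 * real k * b k) + 2 * l * (2 * real k * b k)"
    have "even_series ?c t = t\<^sup>2 * even_series (\<lambda>k. ?c (Suc k)) t"
      by (intro even_series_shift entire_coeffs_add b2 entire_coeffs_cmult b1) simp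
    also have "(\<lambda>k. ?c (Suc k)) = (\<lambda>k. - 1 * b k)"
    proof
      fix k
      have "4 * (real k + 1) * (l + 1 + real k) * b (Suc k) = - b k"
        using l unfolding b_def omega_coeff_Suc[OF l] by simp
      then show "?c (Suc k) = - 1 * b k" by (simp add: algebra_simps)
    qed
    also have "even_series \<dots> t = - 1 * even_series b t" by (rule even_series_cmult[OF b])
    finally have e: "even_series ?c t = - t\<^sup>2 * even_series b t" by simp
    have "even_series ?c t = even_series (\<lambda>k. 2 * real k * (2 * real k * b k)) t + 2 * l * y1 t"
      unfolding y1_def
      by (subst even_series_add[OF b2 entire_coeffs_cmult[OF b1]], subst even_series_cmult[OF b1]) simp
    with e show ?thesis by simp
  qed
  \<comment> \<open>The derivative of the series. Written through \<open>diffs\<close> it is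
    continuous at 0, where the energy starts; away from 0 it equals \<open>y1 t / t\<close>, the
    form to which the equation applies.\<close>
  define D where "D t = 2 * t * even_series (diffs b) t" for t
  define E where "E t = (even_series b t)\<^sup>2 + (D t)\<^sup>2" for t
  have Dy: "D t = y1 t / t" if "t > 0" for t
    using even_series_euler[OF b, of t] that by (simp add: D_def y1_def field_simps)
  have bound: "E t \<le> 1" if "t \<ge> 0" for t
  proof -
    have "E t \<le> E 0"
    proof (rule DERIV_nonpos_imp_decreasing_open[OF that])
      fix x :: real assume x: "0 < x" "x < t"
      have d1: "(even_series b has_real_derivative y1 x / x) (at x)"
        using DERIV_even_series_euler[OF b, of x] x by (simp add: y1_def)
      have d2: "(y1 has_real_derivative (- x\<^sup>2 * even_series b x - 2 * l * y1 x) / x) (at x)"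
        using DERIV_even_series_euler[OF b1, of x] x ode[of x] by (simp add: y1_def)
      have d3: "((\<lambda>t. y1 t / t) has_real_derivative
          ((- x\<^sup>2 * even_series b x - 2 * l * y1 x) / x * x - y1 x) / (x * x)) (at x)"
        using DERIV_divide[OF d2 DERIV_ident] x by simp
      have "((\<lambda>t. (even_series b t)\<^sup>2 + (y1 t / t)\<^sup>2) has_real_derivative
          (2 * even_series b x * (y1 x / x) + 2 * (y1 x / x) *
            (((- x\<^sup>2 * even_series b x - 2 * l * y1 x) / x * x - y1 x) / (x * x)))) (at x)"
        using DERIV_add[OF DERIV_power[OF d1, of 2] DERIV_power[OF d3, of 2]] by (simp add: mult_ac)
      moreover have "2 * y * (z / x) + 2 * (z / x) * (((- x\<^sup>2 * y - 2 * l * z) / x * x - z) / (x * x))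
          = - 2 * (2 * l + 1) * z\<^sup>2 / x ^ 3" for y z
      proof -
        have "(- x\<^sup>2 * y - 2 * l * z) / x * x - z = - x * x * y - (2 * l + 1) * z"
          using x by simp (simp add: power2_eq_square algebra_simps)
        moreover have "2 * y * (z / x) = 2 * z * x * x * y / x ^ 3"
          using x by (simp add: power3_eq_cube)
        moreover have "2 * (z / x) * (v / (x * x)) = 2 * z * v / x ^ 3" for v
          by (simp add: power3_eq_cube)
        moreover have "2 * z * x * x * y + 2 * z * (- x * x * y - (2 * l + 1) * z) = - 2 * (2 * l + 1) * z\<^sup>2"
          by (simp add: power2_eq_square algebra_simps)
        ultimately show ?thesis by (simp only: add_divide_distrib[symmetric])
      qed
      ultimately have "((\<lambda>t. (even_series b t)\<^sup>2 + (y1 t / t)\<^sup>2) has_real_derivative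
          - 2 * (2 * l + 1) * (y1 x)\<^sup>2 / x ^ 3) (at x)" by (simp only:)
      then have "(E has_real_derivative - 2 * (2 * l + 1) * (y1 x)\<^sup>2 / x ^ 3) (at x)"
        by (rule has_field_derivative_transform_within_open[where S = "{0<..}"])
           (use x in \<open>auto simp: E_def Dy\<close>)
      moreover have "- 2 * (2 * l + 1) * (y1 x)\<^sup>2 / x ^ 3 \<le> 0"
        using x assms by (intro divide_nonpos_pos mult_nonpos_nonneg) auto
      ultimately show "\<exists>y. (E has_real_derivative y) (at x) \<and> y \<le> 0" by blast
    next
      show "continuous_on {0..t} E"
        unfolding E_def D_def
        by (intro continuous_intros continuous_on_even_series b entire_coeffs_diffs)
    qed
    also have "E 0 = 1" by (simp add: E_def D_def b_def omega_coeff_def)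
    finally show ?thesis .
  qed
  have "(Omega l \<bar>t\<bar>)\<^sup>2 \<le> 1"
    using bound[of "\<bar>t\<bar>"] zero_le_power2[of "D \<bar>t\<bar>"]
    unfolding Omega_eq_even_series[OF l] E_def b_def by linarith
  then have "\<bar>Omega l \<bar>t\<bar>\<bar> \<le> 1" by (simp add: abs_square_le_1)
  then show ?thesis using Omega_minus[OF l, of t] by (cases "t \<ge> 0") auto
qed

text \<open>By \<open>pochhammer_double\<close>, the two lower parameters of the hypergeometric
  series combine to \<open>pochhammer (3 * \<delta>) (2 * k) / 4 ^ k\<close>, and this power of 4
  cancels the one from the argument \<open>- r\<^sup>2 / 4\<close>.\<close>

definition W_coeff :: "real \<Rightarrow> nat \<Rightarrow> real" where
  "W_coeff \<delta> k = (-1) ^ k * pochhammer \<delta> k / (fact k * pochhammer (3 * \<delta>) (2 * k))"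

lemma W_coeff_Suc:
  "W_coeff \<delta> (Suc k) =
    - ((\<delta> + real k) / ((real k + 1) * (3 * \<delta> + 2 * real k) * (3 * \<delta> + 2 * real k + 1))) * W_coeff \<delta> k"
proof -
  have "pochhammer (3 * \<delta>) (2 * Suc k) =
      pochhammer (3 * \<delta>) (2 * k) * (3 * \<delta> + 2 * real k) * (3 * \<delta> + 2 * real k + 1)"
    by (simp add: pochhammer_Suc add_ac)
  then show ?thesis
    unfolding W_coeff_def fact_Suc pochhammer_Suc power_Suc by (simp add: mult_ac add_ac)
qed

lemma entire_W_coeff:
  assumes "\<delta> > 0"
  shows "entire_coeffs (W_coeff \<delta>)"
proof (rule entire_coeffs_ratio, rule W_coeff_Suc)
  show "(\<lambda>k. - ((\<delta> + real k) / ((real k + 1) * (3 * \<delta> + 2 * real k) * (3 * \<delta> + 2 * real k + 1))))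
      \<longlonglongrightarrow> 0"
    by real_asymp
qed

lemma W_eq_even_series:
  assumes "\<delta> > 0"
  shows "W \<delta> = even_series (W_coeff \<delta>)"
proof
  fix r :: real
  have "pochhammer (3 * \<delta>) (2 * k) = 4 ^ k * pochhammer (3 * \<delta> / 2) k * pochhammer ((3 * \<delta> + 1) / 2) k" for k
    using pochhammer_double[of "3 * \<delta> / 2" k] by (simp add: add_divide_distrib power_mult)
  moreover have "(- (r\<^sup>2 / 4)) ^ k = (-1) ^ k * r ^ (2 * k) / 4 ^ k" for k
    by (subst power_minus[of "r\<^sup>2 / 4"]) (simp add: power_divide power_mult)
  ultimately show "W \<delta> r = even_series (W_coeff \<delta>) r"
    unfolding W_def hypergeometric_altdef even_series_def
    by (intro suminf_cong) (simp add: W_coeff_def mult_ac)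
qed

lemma W_0 [simp]: "\<delta> > 0 \<Longrightarrow> W \<delta> 0 = 1"
  by (simp add: W_eq_even_series W_coeff_def)

lemma continuous_on_W: "\<delta> > 0 \<Longrightarrow> continuous_on A (W \<delta>)"
  by (simp add: W_eq_even_series continuous_on_even_series entire_W_coeff)

section \<open>Gamma and Beta integrals\<close>

text \<open>The substitution \<open>x = t\<^sup>2\<close> holds between
  \<open>[0, n\<^sup>2]\<close> and \<open>[0, n]\<close>; monotone convergence in \<open>n\<close>
  carries it to the half-line.\<close>

lemma nn_integral_square_substitution:
  fixes f :: "real \<Rightarrow> real"
  assumes [measurable]: "f \<in> borel_measurable borel"
  shows "(\<integral>\<^sup>+x. ennreal (indicator {0..} x * f x) \<partial>lborel) =
    (\<integral>\<^sup>+t. ennreal (indicator {0..} t * (f (t\<^sup>2) * (2 * t))) \<partial>lborel)"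
proof -
  let ?L = "\<lambda>n x. ennreal (f x * indicator {0\<^sup>2..(real n)\<^sup>2} x)"
  let ?R = "\<lambda>n t. ennreal (f (t\<^sup>2) * (2 * t) * indicator {0..real n} t)"
  have eq: "(\<integral>\<^sup>+x. ?L n x \<partial>lborel) = (\<integral>\<^sup>+t. ?R n t \<partial>lborel)" for n
    by (rule nn_integral_substitution)
       (auto intro!: derivative_eq_intros continuous_intros simp: set_borel_measurable_def)
  have L: "(\<lambda>n. \<integral>\<^sup>+x. ?L n x \<partial>lborel) \<longlonglongrightarrow> (\<integral>\<^sup>+x. ennreal (indicator {0..} x * f x) \<partial>lborel)"
  proof (rule nn_integral_LIMSEQ)
    show "incseq ?L"
    proof (intro incseq_SucI le_funI)
      fix n x
      have "(real n)\<^sup>2 \<le> (real (Suc n))\<^sup>2" by (intro power_mono) auto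
      then have "x \<in> {0\<^sup>2..(real (Suc n))\<^sup>2}" if "x \<in> {0\<^sup>2..(real n)\<^sup>2}"
        using that by (meson atLeastAtMost_iff order_trans)
      then show "?L n x \<le> ?L (Suc n) x"
        by (cases "x \<in> {0\<^sup>2..(real n)\<^sup>2}") (simp_all del: of_nat_Suc zero_eq_power2 power_zero_numeral)
    qed
    fix x :: real
    obtain N :: nat where N: "sqrt \<bar>x\<bar> \<le> real N" using real_arch_simple by blast
    have "?L n x = ennreal (indicator {0..} x * f x)" if "n \<ge> N" for n
    proof -
      have "(sqrt \<bar>x\<bar>)\<^sup>2 \<le> (real n)\<^sup>2" using that N by (intro power_mono) auto
      then have "\<bar>x\<bar> \<le> (real n)\<^sup>2" by simp
      then show ?thesis by (auto simp: indicator_def)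
    qed
    then show "(\<lambda>n. ?L n x) \<longlonglongrightarrow> ennreal (indicator {0..} x * f x)"
      by (intro tendsto_eventually) (auto simp: eventually_sequentially)
  qed simp
  have R: "(\<lambda>n. \<integral>\<^sup>+t. ?R n t \<partial>lborel) \<longlonglongrightarrow>
      (\<integral>\<^sup>+t. ennreal (indicator {0..} t * (f (t\<^sup>2) * (2 * t))) \<partial>lborel)"
  proof (rule nn_integral_LIMSEQ)
    show "incseq ?R"
      by (intro incseq_SucI le_funI) (auto simp: indicator_def)
    fix x :: real
    obtain N :: nat where N: "x \<le> real N" using real_arch_simple by blast
    have "?R n x = ennreal (indicator {0..} x * (f (x\<^sup>2) * (2 * x)))" if "n \<ge> N" for n
      using N that by (auto simp: indicator_def)
    then show "(\<lambda>n. ?R n x) \<longlonglongrightarrow> ennreal (indicator {0..} x * (f (x\<^sup>2) * (2 * x)))"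
      by (intro tendsto_eventually) (auto simp: eventually_sequentially)
  qed simp
  show ?thesis
    using LIMSEQ_unique[OF L] R eq by simp
qed

lemma has_bochner_integral_square_substitution:
  fixes f :: "real \<Rightarrow> real"
  assumes "f \<in> borel_measurable borel" "\<And>x. x \<ge> 0 \<Longrightarrow> f x \<ge> 0"
    and i: "has_bochner_integral lborel (\<lambda>x. indicator {0..} x * f x) v"
  shows "has_bochner_integral lborel (\<lambda>t. indicator {0..} t * (f (t\<^sup>2) * (2 * t))) v"
proof (rule has_bochner_integral_nn_integral)
  have nn: "indicator {0..} x * f x \<ge> 0" for x using assms(2)[of x] by (auto simp: indicator_def)
  show "0 \<le> v"
    unfolding has_bochner_integral_integral_eq[OF i, symmetric]
    by (intro Bochner_Integration.integral_nonneg nn)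
  show "(\<integral>\<^sup>+t. ennreal (indicator {0..} t * (f (t\<^sup>2) * (2 * t))) \<partial>lborel) = ennreal v"
    using nn_integral_square_substitution[OF assms(1)] i nn
    by (simp add: has_bochner_integral_iff nn_integral_eq_integral)
  show "(\<lambda>t. indicator {0..} t * (f (t\<^sup>2) * (2 * t))) \<in> borel_measurable lborel"
    using assms(1) by measurable
  show "AE t in lborel. 0 \<le> indicator {0..} t * (f (t\<^sup>2) * (2 * t))"
    using assms(2) by (intro always_eventually) (auto simp: indicator_def)
qed

lemma has_bochner_integral_gamma_laplace:
  fixes s \<epsilon> :: real
  assumes "s > 0" "\<epsilon> > 0"
  shows "has_bochner_integral lborel
    (\<lambda>t. indicator {0..} t * (t powr (s - 1) * exp (- (\<epsilon> * t)))) (Gamma s / \<epsilon> powr s)"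
proof -
  have "has_bochner_integral lborel (\<lambda>t. indicator {0..} t * (t powr (s - 1) * exp (- t))) (Gamma s)"
  proof (rule has_bochner_integral_nn_integral)
    show "(\<integral>\<^sup>+t. ennreal (indicator {0..} t * (t powr (s - 1) * exp (- t))) \<partial>lborel) = ennreal (Gamma s)"
      unfolding Gamma_conv_nn_integral_real[OF assms(1)]
      by (intro nn_integral_cong) (simp add: exp_minus divide_inverse mult.assoc)
  qed (use assms in \<open>auto intro!: always_eventually Gamma_real_nonneg\<close>)
  then have "has_bochner_integral lborel
      (\<lambda>t. indicator {0..} (\<epsilon> * t) * ((\<epsilon> * t) powr (s - 1) * exp (- (\<epsilon> * t)))) (Gamma s / \<epsilon>)"
    using assms(2) lborel_has_bochner_integral_real_affine_iff[of \<epsilon>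
        "\<lambda>t. indicator {0..} t * (t powr (s - 1) * exp (- t))" "Gamma s" 0]
    by (simp add: divide_inverse mult.commute)
  then have "has_bochner_integral lborel
      (\<lambda>t. 1 / \<epsilon> powr (s - 1) * (indicator {0..} (\<epsilon> * t) * ((\<epsilon> * t) powr (s - 1) * exp (- (\<epsilon> * t)))))
      (1 / \<epsilon> powr (s - 1) * (Gamma s / \<epsilon>))"
    by (rule has_bochner_integral_mult_right)
  moreover have "1 / \<epsilon> powr (s - 1) * (indicator {0..} (\<epsilon> * t) * ((\<epsilon> * t) powr (s - 1) * exp (- (\<epsilon> * t))))
      = indicator {0..} t * (t powr (s - 1) * exp (- (\<epsilon> * t)))" for t
    using assms(2) by (auto simp: indicator_def zero_le_mult_iff powr_mult)
  moreover have "1 / \<epsilon> powr (s - 1) * (Gamma s / \<epsilon>) = Gamma s / \<epsilon> powr s"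
    using assms(2) by (simp add: powr_diff)
  ultimately show ?thesis by (simp only:)
qed

text \<open>The exponents of the substitution \<open>x = t\<^sup>2\<close>, with the factor
  \<open>t\<close> of its Jacobian. At \<open>t = 0\<close> both sides vanish, because
  \<open>0 powr a = 0\<close> for every \<open>a\<close>.\<close>

lemma power2_powr_times:
  fixes t p :: real
  assumes "t \<ge> 0"
  shows "(t\<^sup>2) powr (p / 2 - 1) * t = t powr (p - 1)"
proof (cases "t > 0")
  case True
  have "(t\<^sup>2) powr (p / 2 - 1) = (t powr 2) powr (p / 2 - 1)" using True by (simp add: powr_numeral)
  also have "\<dots> = t powr (p - 2)" by (simp add: powr_powr algebra_simps)
  also have "\<dots> * t = t powr (p - 1)"
    using True powr_add[of t "p - 2" 1] by simp
  finally show ?thesis .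
qed (use assms in simp)

lemma has_bochner_integral_gaussian_moment:
  fixes p \<epsilon> :: real
  assumes "p > 0" "\<epsilon> > 0"
  shows "has_bochner_integral lborel
    (\<lambda>t. indicator {0..} t * (t powr (p - 1) * exp (- (\<epsilon> * t\<^sup>2)))) (Gamma (p / 2) / (2 * \<epsilon> powr (p / 2)))"
proof -
  have "has_bochner_integral lborel (\<lambda>t. indicator {0..} t *
      ((t\<^sup>2) powr (p / 2 - 1) * exp (- (\<epsilon> * t\<^sup>2)) * (2 * t))) (Gamma (p / 2) / \<epsilon> powr (p / 2))"
    by (rule has_bochner_integral_square_substitution[OF _ _ has_bochner_integral_gamma_laplace])
       (use assms in auto)
  then have "has_bochner_integral lborel (\<lambda>t. 1 / 2 * (indicator {0..} t *
      ((t\<^sup>2) powr (p / 2 - 1) * exp (- (\<epsilon> * t\<^sup>2)) * (2 * t)))) (1 / 2 * (Gamma (p / 2) / \<epsilon> powr (p / 2)))"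
    by (rule has_bochner_integral_mult_right)
  moreover have "1 / 2 * (indicator {0..} t * ((t\<^sup>2) powr (p / 2 - 1) * exp (- (\<epsilon> * t\<^sup>2)) * (2 * t))) =
      indicator {0..} t * (t powr (p - 1) * exp (- (\<epsilon> * t\<^sup>2)))" for t
    using power2_powr_times[of t p] by (auto simp: indicator_def)
  moreover have "1 / 2 * (Gamma (p / 2) / \<epsilon> powr (p / 2)) = Gamma (p / 2) / (2 * \<epsilon> powr (p / 2))"
    by simp
  ultimately show ?thesis by (simp only:)
qed

lemma has_bochner_integral_Beta:
  fixes a b :: real
  assumes "a > 0" "b > 0"
  shows "has_bochner_integral lborel
    (\<lambda>t. indicator {0..1} t * (t powr (a - 1) * (1 - t) powr (b - 1))) (Beta a b)"
proof -
  have "set_integrable lborel {0..1} (\<lambda>t. t powr (a - 1) * (1 - t) powr (b - 1))"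
    by (rule integrable_Beta[OF assms])
  moreover have "(LINT t:{0..1}|lborel. t powr (a - 1) * (1 - t) powr (b - 1)) = Beta a b"
    using set_borel_integral_eq_integral[OF integrable_Beta[OF assms]] has_integral_Beta_real[OF assms]
    by (simp add: integral_unique)
  ultimately show ?thesis
    by (simp add: has_bochner_integral_iff set_integrable_def set_lebesgue_integral_def)
qed

section \<open>Averages of \<open>Omega\<close> over weights with given even moments\<close>

lemma Omega_scale_eq_even_series:
  assumes "l > -1"
  shows "entire_coeffs (\<lambda>k. omega_coeff l k * r ^ (2 * k))"
    and "Omega l (r * t) = even_series (\<lambda>k. omega_coeff l k * r ^ (2 * k)) t"
proof -
  show "entire_coeffs (\<lambda>k. omega_coeff l k * r ^ (2 * k))"
    unfolding entire_coeffs_def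
  proof
    fix x
    have "summable (\<lambda>k. omega_coeff l k * (r\<^sup>2 * x) ^ k)"
      using entire_omega_coeff[OF assms] by (simp add: entire_coeffs_def)
    then show "summable (\<lambda>k. omega_coeff l k * r ^ (2 * k) * x ^ k)"
      by (simp add: power_mult power_mult_distrib mult.assoc)
  qed
  show "Omega l (r * t) = even_series (\<lambda>k. omega_coeff l k * r ^ (2 * k)) t"
    by (simp add: Omega_eq_even_series[OF assms] even_series_def power_mult_distrib mult.assoc)
qed

lemma Omega_integral:
  fixes g :: "real \<Rightarrow> real"
  assumes l: "l > -1" and g: "\<And>t. 0 \<le> g t"
    and m: "\<And>k. has_bochner_integral lborel (\<lambda>t. t ^ (2 * k) * g t) (m k)"
    and s: "summable (\<lambda>k. \<bar>omega_coeff l k\<bar> * r ^ (2 * k) * m k)"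
  shows "has_bochner_integral lborel (\<lambda>t. Omega l (r * t) * g t) (\<Sum>k. omega_coeff l k * r ^ (2 * k) * m k)"
    and "summable (\<lambda>k. omega_coeff l k * r ^ (2 * k) * m k)"
proof -
  have s': "summable (\<lambda>k. \<bar>omega_coeff l k * r ^ (2 * k)\<bar> * m k)"
    using s by (simp add: abs_mult)
  show "has_bochner_integral lborel (\<lambda>t. Omega l (r * t) * g t) (\<Sum>k. omega_coeff l k * r ^ (2 * k) * m k)"
    "summable (\<lambda>k. omega_coeff l k * r ^ (2 * k) * m k)"
    unfolding Omega_scale_eq_even_series(2)[OF l]
    using even_series_integral[OF Omega_scale_eq_even_series(1)[OF l] g m s'] by auto
qed

text \<open>The common source of both integral representations. The factor
  \<open>pochhammer (l + 1) k\<close> of the moment cancels the one in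
  \<open>omega_coeff l k\<close>, and the duplication of
  \<open>pochhammer (2 * \<delta>) (2 * k)\<close> removes \<open>4 ^ k\<close> and the half-step
  symbol, leaving \<open>W_coeff \<delta> k\<close>. The kernel index \<open>l\<close> is thus
  arbitrary as long as the moments of \<open>g\<close> compensate for it.\<close>

lemma Omega_integral_W:
  fixes g :: "real \<Rightarrow> real"
  assumes l: "l > -1" and d: "\<delta> > 0" and g: "\<And>t. 0 \<le> g t"
    and m: "\<And>k. has_bochner_integral lborel (\<lambda>t. t ^ (2 * k) * g t)
      (C * (pochhammer (l + 1) k * pochhammer (2 * \<delta>) (2 * k) /
        (pochhammer (\<delta> + 1/2) k * pochhammer (3 * \<delta>) (2 * k))))" (is "\<And>k. has_bochner_integral _ _ (?m k)")
  shows "has_bochner_integral lborel (\<lambda>t. Omega l (r * t) * g t) (C * W \<delta> r)"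
proof -
  have p: "pochhammer (l + 1) k > 0" "pochhammer (\<delta> + 1/2) k > 0" "pochhammer \<delta> k > 0" for k
    using l d by (auto intro!: pochhammer_pos)
  \<comment> \<open>The moment of order 0 identifies \<open>C\<close> as the total mass of
    \<open>g\<close>.\<close>
  have C: "C \<ge> 0"
  proof -
    have "has_bochner_integral lborel g C" using m[of 0] by simp
    then have "C = integral\<^sup>L lborel g" by (simp add: has_bochner_integral_integral_eq)
    then show ?thesis using g by (simp add: Bochner_Integration.integral_nonneg)
  qed
  have eq: "omega_coeff l k * r ^ (2 * k) * ?m k = C * (W_coeff \<delta> k * r ^ (2 * k))" for k
  proof -
    have "pochhammer (2 * \<delta>) (2 * k) = 4 ^ k * pochhammer \<delta> k * pochhammer (\<delta> + 1/2) k"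
      using pochhammer_double[of \<delta> k] by (simp add: power_mult)
    then show ?thesis
      using p[of k] by (simp add: omega_coeff_def W_coeff_def)
  qed
  have mm: "0 \<le> ?m k" for k
    using C p[of k] d l by (intro mult_nonneg_nonneg divide_nonneg_nonneg pochhammer_nonneg) auto
  have "\<bar>omega_coeff l k\<bar> * r ^ (2 * k) * ?m k = C * (\<bar>W_coeff \<delta> k\<bar> * \<bar>r\<^sup>2\<bar> ^ k)" for k
  proof -
    have "\<bar>omega_coeff l k\<bar> * r ^ (2 * k) * ?m k = \<bar>omega_coeff l k * r ^ (2 * k) * ?m k\<bar>"
      unfolding abs_mult[of "omega_coeff l k * r ^ (2 * k)"] abs_of_nonneg[OF mm] by (simp add: abs_mult)
    also have "\<dots> = C * (\<bar>W_coeff \<delta> k\<bar> * \<bar>r\<^sup>2\<bar> ^ k)"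
      unfolding eq using C by (simp add: abs_mult power_mult)
    finally show ?thesis .
  qed
  then have s: "summable (\<lambda>k. \<bar>omega_coeff l k\<bar> * r ^ (2 * k) * ?m k)"
    using summable_mult[OF entire_coeffs_summable_abs[OF entire_W_coeff[OF d]], of C "r\<^sup>2"]
    by (simp only:)
  have "(\<Sum>k. omega_coeff l k * r ^ (2 * k) * ?m k) = C * W \<delta> r"
    unfolding eq W_eq_even_series[OF d]
    using sums_mult[OF even_series_sums[OF entire_W_coeff[OF d]], of C r] by (simp only: sums_unique[symmetric])
  with Omega_integral(1)[OF l g m s] show ?thesis by simp
qed

lemma Beta_ratio:
  fixes a b :: real
  assumes "a > 0" "b > 0"
  shows "Beta (a + real n) b = Beta a b * (pochhammer a n / pochhammer (a + b) n)"
proof -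
  have z: "a \<notin> \<int>\<^sub>\<le>\<^sub>0" "a + b \<notin> \<int>\<^sub>\<le>\<^sub>0" using assms by (auto elim!: nonpos_Ints_cases)
  have G: "Gamma a > 0" "Gamma (a + b) > 0" using assms by (auto intro!: Gamma_real_pos)
  have "Gamma (a + real n) = pochhammer a n * Gamma a"
    "Gamma (a + b + real n) = pochhammer (a + b) n * Gamma (a + b)"
    using pochhammer_Gamma[OF z(1), of n] pochhammer_Gamma[OF z(2), of n] G by (auto simp: field_simps)
  then show ?thesis by (simp add: Beta_def add_ac mult_ac)
qed

lemma has_bochner_integral_mono:
  fixes f g :: "'a \<Rightarrow> real"
  assumes "has_bochner_integral M f a" "has_bochner_integral M g b" "\<And>x. f x \<le> g x"
  shows "a \<le> b"
  using assms integral_mono[of M f g] by (simp add: has_bochner_integral_iff)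

text \<open>For \<open>l = \<delta> - 1/2\<close> the symbols \<open>pochhammer (l + 1) k\<close>
  and \<open>pochhammer (\<delta> + 1/2) k\<close> of the moment condition coincide. What remains is
  the ratio of \<open>Beta (2 * \<delta> + 2 * k) \<delta>\<close> to
  \<open>Beta (2 * \<delta>) \<delta>\<close>, which the weight supplies.\<close>

lemma W_eq_Beta_average:
  assumes d: "\<delta> > 0"
  shows "has_bochner_integral lborel
    (\<lambda>t. Omega (\<delta> - 1/2) (r * t) * (indicator {0..} t * (max 0 (1 - t) powr (\<delta> - 1) * t powr (2 * \<delta> - 1))))
    (Beta \<delta> (2 * \<delta>) * W \<delta> r)"
proof (rule Omega_integral_W[OF _ d])
  fix k
  let ?m = "Beta \<delta> (2 * \<delta>) * (pochhammer (\<delta> - 1 / 2 + 1) k * pochhammer (2 * \<delta>) (2 * k) /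
      (pochhammer (\<delta> + 1 / 2) k * pochhammer (3 * \<delta>) (2 * k)))"
  have "pochhammer (\<delta> + 1 / 2) k > 0" using d by (intro pochhammer_pos) auto
  then have "?m = Beta (2 * \<delta> + real (2 * k)) \<delta>"
    using Beta_ratio[of "2 * \<delta>" \<delta> "2 * k"] d by (simp add: Beta_commute[of \<delta>] add.commute)
  moreover have "t ^ (2 * k) * (indicator {0..} t * (max 0 (1 - t) powr (\<delta> - 1) * t powr (2 * \<delta> - 1))) =
      indicator {0..1} t * (t powr (2 * \<delta> + real (2 * k) - 1) * (1 - t) powr (\<delta> - 1))" for t
  proof (cases "t > 0")
    case True
    have "t powr (2 * \<delta> + real (2 * k) - 1) = t powr real (2 * k) * t powr (2 * \<delta> - 1)"
      by (simp add: powr_add[symmetric] algebra_simps)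
    also have "t powr real (2 * k) = t ^ (2 * k)" using True by (simp add: powr_realpow del: of_nat_mult)
    finally show ?thesis using True by (auto simp: indicator_def max_def)
  qed (auto simp: indicator_def)
  ultimately show "has_bochner_integral lborel
      (\<lambda>t. t ^ (2 * k) * (indicator {0..} t * (max 0 (1 - t) powr (\<delta> - 1) * t powr (2 * \<delta> - 1)))) ?m"
    using has_bochner_integral_Beta[of "2 * \<delta> + real (2 * k)" \<delta>] d by (simp only:)
qed (use d in auto)

text \<open>The weight of the average is nonnegative with mass
  \<open>Beta \<delta> (2 * \<delta>)\<close>, as the representation at \<open>r = 0\<close> shows,
  and the kernel is at most 1 because its index \<open>\<delta> - 1/2\<close> is at least
  \<open>-1/2\<close>.\<close>

lemma W_le_1:
  assumes d: "\<delta> > 0"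
  shows "W \<delta> r \<le> 1"
proof -
  let ?g = "\<lambda>t::real. indicator {0..} t * (max 0 (1 - t) powr (\<delta> - 1) * t powr (2 * \<delta> - 1))"
  have B: "Beta \<delta> (2 * \<delta>) > 0" using d by (simp add: Beta_def Gamma_real_pos)
  have O0: "Omega (\<delta> - 1/2) (0 * t) = 1" for t
    using d by simp
  have "has_bochner_integral lborel ?g (Beta \<delta> (2 * \<delta>))"
    using W_eq_Beta_average[OF d, of 0] unfolding O0 W_0[OF d] by (simp only: mult_1 mult_1_right)
  moreover have "Omega (\<delta> - 1/2) (r * t) * ?g t \<le> ?g t" for t
  proof -
    have "Omega (\<delta> - 1/2) (r * t) \<le> 1"
      using abs_Omega_le_1[of "\<delta> - 1/2" "r * t"] d by linarith
    then show ?thesis by (metis mult_1 mult_right_mono zero_le_mult_iff indicator_pos_le powr_ge_zero)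
  qed
  ultimately have "Beta \<delta> (2 * \<delta>) * W \<delta> r \<le> Beta \<delta> (2 * \<delta>)"
    by (rule has_bochner_integral_mono[OF W_eq_Beta_average[OF d, of r]])
  with B show ?thesis by simp
qed

section \<open>The function \<open>Phi\<close>\<close>

text \<open>The integrand of \<open>Phi\<close> after the shift \<open>s = t + u\<close>, using
  \<open>s\<^sup>2 - t\<^sup>2 = u * (u + 2 * t)\<close>. The range of \<open>u\<close> no longer
  depends on \<open>t\<close>: the moving endpoint is absorbed by the truncation
  \<open>max 0\<close>, so limits in \<open>t\<close> can be taken under the integral sign.\<close>

definition Phi_kernel :: "real \<Rightarrow> real \<Rightarrow> real \<Rightarrow> real \<Rightarrow> real" where
  "Phi_kernel \<alpha> \<beta> t u = indicator {0..1} u * (u powr \<alpha> * (u + 2 * t) powr \<alpha> * max 0 (1 - t - u) powr \<beta>)"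

lemma Phi_kernel_nonneg: "0 \<le> Phi_kernel \<alpha> \<beta> t u"
  by (simp add: Phi_kernel_def indicator_def)

lemma borel_measurable_Phi_kernel [measurable]: "Phi_kernel \<alpha> \<beta> t \<in> borel_measurable borel"
  unfolding Phi_kernel_def[abs_def] by measurable

text \<open>The exponent \<open>\<alpha>\<close> may have either sign. For
  \<open>\<alpha> \<ge> 0\<close> the factor \<open>(u + 2 * t) powr \<alpha>\<close> is largest at
  the upper ends, for \<open>\<alpha> < 0\<close> it is at most \<open>u powr \<alpha>\<close>; the
  sum of the two bounds serves both cases. The second one produces
  \<open>u powr (2 * \<alpha>)\<close>, integrable at 0 exactly for \<open>\<alpha> > -1/2\<close>,
  which for \<open>\<alpha> = \<delta> - (d + 1) / 2\<close> says
  \<open>\<delta> > d / 2\<close>.\<close>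

lemma Phi_kernel_bound:
  assumes "0 \<le> t" "t \<le> T" "\<beta> > 0"
  shows "Phi_kernel \<alpha> \<beta> t u \<le> (1 + 2 * T) powr \<alpha> * (indicator {0..1} u * (u powr ((\<alpha> + 1) - 1) * (1 - u) powr ((\<beta> + 1) - 1)))
    + indicator {0..1} u * (u powr ((2 * \<alpha> + 1) - 1) * (1 - u) powr ((\<beta> + 1) - 1))"
proof (cases "0 < u \<and> u \<le> 1")
  case True
  have 1: "(u + 2 * t) powr \<alpha> \<le> (1 + 2 * T) powr \<alpha> + u powr \<alpha>"
  proof (cases "\<alpha> \<ge> 0")
    case True
    then have "(u + 2 * t) powr \<alpha> \<le> (1 + 2 * T) powr \<alpha>"
      using assms \<open>0 < u \<and> u \<le> 1\<close> by (intro powr_mono2) auto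
    then show ?thesis by (simp add: add_increasing2)
  next
    case False
    then have "(u + 2 * t) powr \<alpha> \<le> u powr \<alpha>"
      using assms \<open>0 < u \<and> u \<le> 1\<close> by (intro powr_mono2') auto
    then show ?thesis by (simp add: add_increasing)
  qed
  have 2: "max 0 (1 - t - u) powr \<beta> \<le> (1 - u) powr \<beta>"
    using assms True by (intro powr_mono2) auto
  have "u powr \<alpha> * (u + 2 * t) powr \<alpha> * max 0 (1 - t - u) powr \<beta>
      \<le> u powr \<alpha> * ((1 + 2 * T) powr \<alpha> + u powr \<alpha>) * (1 - u) powr \<beta>"
    using 1 2 by (intro mult_mono mult_left_mono) auto
  also have "u powr \<alpha> * u powr \<alpha> = u powr (2 * \<alpha>)" by (simp add: powr_add[symmetric])
  then have "u powr \<alpha> * ((1 + 2 * T) powr \<alpha> + u powr \<alpha>) * (1 - u) powr \<beta> =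
      (1 + 2 * T) powr \<alpha> * (u powr \<alpha> * (1 - u) powr \<beta>) + u powr (2 * \<alpha>) * (1 - u) powr \<beta>"
    by (simp add: algebra_simps)
  finally show ?thesis using True by (simp add: Phi_kernel_def)
next
  case False
  then have "Phi_kernel \<alpha> \<beta> t u = 0" by (cases "u = 0") (auto simp: Phi_kernel_def indicator_def)
  then show ?thesis by (simp add: indicator_def)
qed

lemma integrable_Phi_kernel_bound:
  assumes "\<alpha> > -1/2" "\<beta> > 0"
  shows "integrable lborel (\<lambda>u::real. C * (indicator {0..1} u * (u powr ((\<alpha> + 1) - 1) * (1 - u) powr ((\<beta> + 1) - 1)))
    + indicator {0..1} u * (u powr ((2 * \<alpha> + 1) - 1) * (1 - u) powr ((\<beta> + 1) - 1)))"
  using has_bochner_integral_Beta[of "\<alpha> + 1" "\<beta> + 1"] has_bochner_integral_Beta[of "2 * \<alpha> + 1" "\<beta> + 1"] assms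
  by (intro Bochner_Integration.integrable_add integrable_mult_right) (auto simp only: has_bochner_integral_iff)

lemma integrable_Phi_kernel:
  assumes "\<alpha> > -1/2" "\<beta> > 0" "t \<ge> 0"
  shows "integrable lborel (Phi_kernel \<alpha> \<beta> t)"
  by (rule Bochner_Integration.integrable_bound[OF integrable_Phi_kernel_bound[OF assms(1,2), of "(1 + 2 * t) powr \<alpha>"]])
     (use Phi_kernel_bound[OF assms(3) order_refl assms(2), of \<alpha>] Phi_kernel_nonneg[of \<alpha> \<beta> t] in
       \<open>auto intro!: always_eventually order_trans[OF _ abs_ge_self] simp del: add_diff_cancel_right'\<close>)

text \<open>For \<open>u > 0\<close> the base \<open>u + 2 * t\<close> stays away from 0, and the
  truncated factor is continuous even where its base reaches 0, since \<open>\<beta> > 0\<close>. At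
  \<open>u = 0\<close> the kernel is 0 by the convention for \<open>0 powr \<alpha>\<close>.\<close>

lemma tendsto_Phi_kernel:
  assumes "\<beta> > 0" "t \<ge> 0" "x \<longlonglongrightarrow> t"
  shows "(\<lambda>n. Phi_kernel \<alpha> \<beta> (x n) u) \<longlonglongrightarrow> Phi_kernel \<alpha> \<beta> t u"
proof (cases "u > 0")
  case True
  have "(\<lambda>n. (u + 2 * x n) powr \<alpha>) \<longlonglongrightarrow> (u + 2 * t) powr \<alpha>"
    using assms True by (intro tendsto_intros) auto
  moreover have "(\<lambda>n. max 0 (1 - x n - u) powr \<beta>) \<longlonglongrightarrow> max 0 (1 - t - u) powr \<beta>"
    using assms by (intro tendsto_powr' tendsto_intros) (auto intro!: always_eventually)
  ultimately show ?thesis unfolding Phi_kernel_def by (intro tendsto_mult tendsto_const)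
next
  case False
  then show ?thesis by (cases "u = 0") (auto simp: Phi_kernel_def indicator_def)
qed

text \<open>Dominated convergence: a convergent sequence of arguments is bounded by some
  \<open>T\<close>, and the majorant of \<open>Phi_kernel_bound\<close> depends on \<open>T\<close>
  only.\<close>

lemma continuous_on_integral_Phi_kernel:
  assumes "\<alpha> > -1/2" "\<beta> > 0"
  shows "continuous_on {0..} (\<lambda>t. integral\<^sup>L lborel (Phi_kernel \<alpha> \<beta> t))"
  unfolding continuous_on_sequentially o_def
proof (intro allI ballI impI, elim conjE)
  fix x :: "nat \<Rightarrow> real" and t
  assume t: "t \<in> {0..}" and x: "\<forall>n. x n \<in> {0..}" "x \<longlonglongrightarrow> t"
  obtain T where T: "\<And>n. x n \<le> T"
  proof -
    have "Bseq x" using x(2) by (intro convergent_imp_Bseq) (auto simp: convergent_def)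
    then obtain K where "\<And>n. norm (x n) \<le> K" unfolding Bseq_def by blast
    then have "x n \<le> K" for n by (metis abs_le_D1 real_norm_def)
    then show ?thesis by (rule that)
  qed
  show "(\<lambda>n. integral\<^sup>L lborel (Phi_kernel \<alpha> \<beta> (x n))) \<longlonglongrightarrow> integral\<^sup>L lborel (Phi_kernel \<alpha> \<beta> t)"
  proof (rule integral_dominated_convergence[OF _ _ integrable_Phi_kernel_bound[OF assms, of "(1 + 2 * T) powr \<alpha>"]])
    show "AE u in lborel. (\<lambda>n. Phi_kernel \<alpha> \<beta> (x n) u) \<longlonglongrightarrow> Phi_kernel \<alpha> \<beta> t u"
      using t x assms by (intro always_eventually allI tendsto_Phi_kernel) auto
    fix n
    show "AE u in lborel. norm (Phi_kernel \<alpha> \<beta> (x n) u) \<le> (1 + 2 * T) powr \<alpha> * (indicator {0..1} u * (u powr ((\<alpha> + 1) - 1) * (1 - u) powr ((\<beta> + 1) - 1)))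
    + indicator {0..1} u * (u powr ((2 * \<alpha> + 1) - 1) * (1 - u) powr ((\<beta> + 1) - 1))"
      unfolding real_norm_def abs_of_nonneg[OF Phi_kernel_nonneg]
      using x(1) T assms by (intro always_eventually allI Phi_kernel_bound) auto
  qed auto
qed

lemma Phi_kernel_shift:
  assumes "t \<ge> 0" "\<beta> > 0"
  shows "Phi_kernel \<alpha> \<beta> t u = indicator {t..1} (t + u) * (((t + u)\<^sup>2 - t\<^sup>2) powr \<alpha> * (1 - (t + u)) powr \<beta>)"
proof (cases "u \<ge> 0 \<and> t + u \<le> 1")
  case True
  have "(t + u)\<^sup>2 - t\<^sup>2 = u * (u + 2 * t)" by (simp add: power2_eq_square algebra_simps)
  then show ?thesis
    using True assms by (simp add: Phi_kernel_def powr_mult max_def diff_diff_eq)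
next
  case False
  then have "indicator {0..1} u * max 0 (1 - t - u) powr \<beta> = 0" by (auto simp: indicator_def max_def)
  then have "Phi_kernel \<alpha> \<beta> t u = 0" by (auto simp: Phi_kernel_def)
  moreover have "indicator {t..1} (t + u) = (0::real)" using False by (auto simp: indicator_def)
  ultimately show ?thesis by simp
qed

text \<open>One formula for all \<open>t \<ge> 0\<close>: beyond \<open>t = 1\<close> the kernel
  vanishes identically, in agreement with the default value of \<open>Phi\<close>. Continuity across
  \<open>t = 1\<close> is then no special case.\<close>

lemma Phi_eq_integral_Phi_kernel:
  assumes "\<delta> > 1" "t \<ge> 0"
  shows "Phi d \<delta> t = integral\<^sup>L lborel (Phi_kernel (\<delta> - (real d + 1) / 2) (\<delta> - 1) t) / Beta (2 * \<delta> - real d) \<delta>"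
proof -
  have beta: "\<delta> - 1 > 0" using assms(1) by simp
  have "(LINT s:{t..1}|lborel. (s\<^sup>2 - t\<^sup>2) powr (\<delta> - (real d + 1) / 2) * (1 - s) powr (\<delta> - 1)) =
      integral\<^sup>L lborel (Phi_kernel (\<delta> - (real d + 1) / 2) (\<delta> - 1) t)"
    unfolding set_lebesgue_integral_def
    unfolding Phi_kernel_shift[OF assms(2) beta, abs_def]
    by (subst lborel_integral_real_affine[of 1 _ t]) simp_all
  moreover have "integral\<^sup>L lborel (Phi_kernel (\<delta> - (real d + 1) / 2) (\<delta> - 1) t) = 0" if "t > 1"
  proof -
    have "Phi_kernel (\<delta> - (real d + 1) / 2) (\<delta> - 1) t = (\<lambda>u. 0)"
      using that by (auto simp: Phi_kernel_def indicator_def max_def fun_eq_iff)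
    then show ?thesis by simp
  qed
  ultimately show ?thesis using assms by (auto simp: Phi_def)
qed

lemma continuous_on_Phi:
  assumes "\<delta> > 1" "\<delta> > real d / 2"
  shows "continuous_on {0..} (Phi d \<delta>)"
proof -
  have "Gamma (2 * \<delta> - real d) > 0" "Gamma \<delta> > 0" "Gamma (2 * \<delta> - real d + \<delta>) > 0"
    using assms by (auto intro!: Gamma_real_pos)
  then have "Beta (2 * \<delta> - real d) \<delta> \<noteq> 0"
    by (simp add: Beta_def)
  then have "continuous_on {0..} (\<lambda>t. integral\<^sup>L lborel (Phi_kernel (\<delta> - (real d + 1) / 2) (\<delta> - 1) t) / Beta (2 * \<delta> - real d) \<delta>)"
    using assms by (intro continuous_intros continuous_on_integral_Phi_kernel) (auto simp: field_simps)
  then show ?thesis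
    by (rule continuous_on_cong[THEN iffD1, OF refl, rotated]) (use assms Phi_eq_integral_Phi_kernel[of \<delta>] in auto)
qed

lemma Phi_nonneg:
  assumes "\<delta> > 1" "\<delta> > real d / 2"
  shows "Phi d \<delta> t \<ge> 0"
proof (cases "t \<ge> 0")
  case True
  have "Beta (2 * \<delta> - real d) \<delta> > 0"
    using assms by (simp add: Beta_def Gamma_real_pos)
  then show ?thesis
    using True assms by (simp add: Phi_eq_integral_Phi_kernel Bochner_Integration.integral_nonneg Phi_kernel_nonneg)
qed (simp add: Phi_def)

lemma nn_integral_has_bochner_integral:
  fixes f :: "'a \<Rightarrow> real"
  assumes "has_bochner_integral M f x" "\<And>t. 0 \<le> f t"
  shows "(\<integral>\<^sup>+t. ennreal (f t) \<partial>M) = ennreal x"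
  using assms by (simp add: has_bochner_integral_iff nn_integral_eq_integral)

text \<open>Real and natural powers differ at 0, since \<open>0 powr 0 = 0\<close> while
  \<open>0 ^ 0 = 1\<close>. One point is a null set, so moments may be computed in either
  form.\<close>

lemma has_bochner_integral_cong_except_0:
  fixes f :: "real \<Rightarrow> 'b::{banach, second_countable_topology}"
  assumes "\<And>x. x \<noteq> 0 \<Longrightarrow> f x = g x"
  shows "has_bochner_integral lborel f v \<longleftrightarrow> has_bochner_integral lborel g v"
  by (rule has_bochner_integral_discrete_difference[of "{0}"]) (use assms in auto)

text \<open>The Beta integral under \<open>x = (t / s)\<^sup>2\<close>. It is the inner integral of
  the moments of \<open>Phi\<close>, taken over \<open>t\<close> at fixed \<open>s\<close>.\<close>

lemma has_bochner_integral_scaled_Beta: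
  fixes s \<alpha> q :: real
  assumes "s > 0" "\<alpha> > -1" "q > -1"
  shows "has_bochner_integral lborel
    (\<lambda>t. indicator {0..s} t * (t powr q * (s\<^sup>2 - t\<^sup>2) powr \<alpha>))
    (s powr (q + 1 + 2 * \<alpha>) * (Beta ((q + 1) / 2) (\<alpha> + 1) / 2))"
proof -
  let ?b = "\<lambda>x::real. indicator {..1} x * (x powr ((q + 1) / 2 - 1) * (1 - x) powr \<alpha>)"
  have "has_bochner_integral lborel (\<lambda>x::real. indicator {0..} x * ?b x) (Beta ((q + 1) / 2) (\<alpha> + 1))"
  proof -
    have "(\<lambda>x::real. indicator {0..} x * ?b x) =
        (\<lambda>t. indicator {0..1} t * (t powr ((q + 1) / 2 - 1) * (1 - t) powr (\<alpha> + 1 - 1)))"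
      by (auto simp: indicator_def fun_eq_iff)
    then show ?thesis
      using has_bochner_integral_Beta[of "(q + 1) / 2" "\<alpha> + 1"] assms by simp
  qed
  then have "has_bochner_integral lborel (\<lambda>t. indicator {0..} t * (?b (t\<^sup>2) * (2 * t))) (Beta ((q + 1) / 2) (\<alpha> + 1))"
    by (rule has_bochner_integral_square_substitution[rotated 2]) auto
  then have "has_bochner_integral lborel (\<lambda>t. indicator {0..} (t / s) * (?b ((t / s)\<^sup>2) * (2 * (t / s))))
      (s * Beta ((q + 1) / 2) (\<alpha> + 1))"
    using lborel_has_bochner_integral_real_affine_iff[of "1 / s"
        "\<lambda>t. indicator {0..} t * (?b (t\<^sup>2) * (2 * t))" "Beta ((q + 1) / 2) (\<alpha> + 1)" 0] assms(1)
    by (simp add: mult.commute)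
  then have "has_bochner_integral lborel
      (\<lambda>t. s powr (q + 2 * \<alpha>) / 2 * (indicator {0..} (t / s) * (?b ((t / s)\<^sup>2) * (2 * (t / s)))))
      (s powr (q + 2 * \<alpha>) / 2 * (s * Beta ((q + 1) / 2) (\<alpha> + 1)))"
    by (rule has_bochner_integral_mult_right)
  moreover have "s powr (q + 2 * \<alpha>) / 2 * (indicator {0..} (t / s) * (?b ((t / s)\<^sup>2) * (2 * (t / s)))) =
      indicator {0..s} t * (t powr q * (s\<^sup>2 - t\<^sup>2) powr \<alpha>)" for t
  proof (cases "0 \<le> t \<and> t \<le> s")
    case True
    have le: "(t / s)\<^sup>2 \<le> 1" using True assms(1) by (simp add: power_le_one)
    have "(1 - (t / s)\<^sup>2) powr \<alpha> = (s\<^sup>2 - t\<^sup>2) powr \<alpha> / s powr (2 * \<alpha>)"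
    proof -
      have "1 - (t / s)\<^sup>2 = (s\<^sup>2 - t\<^sup>2) / s\<^sup>2" using assms(1) by (simp add: power_divide diff_divide_distrib)
      moreover have "t\<^sup>2 \<le> s\<^sup>2" using True by (intro power_mono) auto
      moreover have "(s\<^sup>2) powr \<alpha> = s powr (2 * \<alpha>)" using assms(1) powr_powr[of s 2 \<alpha>] by (simp add: powr_numeral)
      ultimately show ?thesis by (simp add: powr_divide)
    qed
    moreover have "((t / s)\<^sup>2) powr ((q + 1) / 2 - 1) * (t / s) = t powr q / s powr q"
      using power2_powr_times[of "t / s" "q + 1"] True assms(1) by (simp add: powr_divide)
    moreover have "s powr (q + 2 * \<alpha>) = s powr q * s powr (2 * \<alpha>)" by (simp add: powr_add)
    moreover have "s powr q > 0" "s powr (2 * \<alpha>) > 0" using assms(1) by auto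
    ultimately have "s powr (q + 2 * \<alpha>) * (((t / s)\<^sup>2) powr ((q + 1) / 2 - 1) * (t / s)) * (1 - (t / s)\<^sup>2) powr \<alpha>
        = t powr q * (s\<^sup>2 - t\<^sup>2) powr \<alpha>"
      by simp
    then show ?thesis using True assms(1) le by (simp add: mult_ac)
  next
    case False
    have "indicator {0..} (t / s) * indicator {..1} ((t / s)\<^sup>2) = (0::real)"
    proof (cases "t < 0")
      case False
      then have "t / s > 1" using \<open>\<not> (0 \<le> t \<and> t \<le> s)\<close> assms(1) by simp
      then have "(t / s)\<^sup>2 > 1" by (simp add: one_less_power)
      then show ?thesis by simp
    qed (use assms(1) in \<open>auto simp: divide_nonneg_pos indicator_def zero_le_divide_iff\<close>)
    then show ?thesis using False by (auto simp: indicator_def)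
  qed
  moreover have "s powr (q + 2 * \<alpha>) / 2 * (s * Beta ((q + 1) / 2) (\<alpha> + 1)) =
      s powr (q + 1 + 2 * \<alpha>) * (Beta ((q + 1) / 2) (\<alpha> + 1) / 2)"
    using assms(1) powr_add[of s "q + 2 * \<alpha>" 1] by (simp add: algebra_simps)
  ultimately show ?thesis by (simp only:)
qed

text \<open>Tonelli on the triangle \<open>0 \<le> t \<le> s \<le> 1\<close>. Integrating over
  \<open>t\<close> first leaves a power of \<open>s\<close> times half a Beta value, and the
  remaining integral over \<open>s\<close> is a second Beta integral.\<close>

lemma has_bochner_integral_Phi_kernel_moment:
  fixes q \<alpha> \<beta> :: real
  assumes "\<alpha> > -1/2" "\<beta> > 0" "q \<ge> 0"
  shows "has_bochner_integral lborel
    (\<lambda>t. indicator {0..} t * (t powr q * integral\<^sup>L lborel (Phi_kernel \<alpha> \<beta> t)))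
    (Beta ((q + 1) / 2) (\<alpha> + 1) / 2 * Beta (q + 2 * \<alpha> + 2) (\<beta> + 1))"
proof (rule has_bochner_integral_nn_integral)
  define Q where "Q t = integral\<^sup>L lborel (Phi_kernel \<alpha> \<beta> t)" for t
  have "(\<lambda>t. if t \<in> {0..} then Q t else 0) \<in> borel_measurable borel"
    by (rule borel_measurable_continuous_on_if)
       (use assms in \<open>auto simp: Q_def[abs_def] intro: continuous_on_integral_Phi_kernel\<close>)
  then have "(\<lambda>t. indicator {0..} t * (t powr q * (if t \<in> {0..} then Q t else 0))) \<in> borel_measurable lborel"
    by measurable
  moreover have "(\<lambda>t. indicator {0..} t * (t powr q * (if t \<in> {0..} then Q t else 0))) =
      (\<lambda>t. indicator {0..} t * (t powr q * Q t))" by (auto simp: indicator_def)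
  ultimately show "(\<lambda>t. indicator {0..} t * (t powr q * integral\<^sup>L lborel (Phi_kernel \<alpha> \<beta> t))) \<in> borel_measurable lborel"
    by (simp add: Q_def)
  show "AE t in lborel. 0 \<le> indicator {0..} t * (t powr q * integral\<^sup>L lborel (Phi_kernel \<alpha> \<beta> t))"
    by (intro always_eventually allI mult_nonneg_nonneg Bochner_Integration.integral_nonneg Phi_kernel_nonneg) auto
  have "(q + 1) / 2 + (\<alpha> + 1) > 0" using assms by (simp add: field_simps)
  then have B: "Beta ((q + 1) / 2) (\<alpha> + 1) \<ge> 0" "Beta (q + 2 * \<alpha> + 2) (\<beta> + 1) \<ge> 0"
    using assms by (auto simp: Beta_def intro!: divide_nonneg_nonneg mult_nonneg_nonneg Gamma_real_nonneg)
  then show "0 \<le> Beta ((q + 1) / 2) (\<alpha> + 1) / 2 * Beta (q + 2 * \<alpha> + 2) (\<beta> + 1)" by simp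
  \<comment> \<open>The triangle lives in the two indicators, so both orders of integration run over
    the whole line with the same integrand.\<close>
  let ?F = "\<lambda>t s::real. indicator {0..s} t * (t powr q * (s\<^sup>2 - t\<^sup>2) powr \<alpha>) * (indicator {0..1} s * (1 - s) powr \<beta>)"
  have "(\<integral>\<^sup>+t. ennreal (indicator {0..} t * (t powr q * Q t)) \<partial>lborel) =
      (\<integral>\<^sup>+t. (\<integral>\<^sup>+s. ennreal (?F t s) \<partial>lborel) \<partial>lborel)"
  proof (rule nn_integral_cong)
    fix t :: real
    show "ennreal (indicator {0..} t * (t powr q * Q t)) = (\<integral>\<^sup>+s. ennreal (?F t s) \<partial>lborel)"
    proof (cases "t \<ge> 0")
      case True
      have "ennreal (indicator {0..} t * (t powr q * Q t)) = ennreal (t powr q) * ennreal (Q t)"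
        using True by (simp add: ennreal_mult')
      also have "ennreal (Q t) = (\<integral>\<^sup>+u. ennreal (Phi_kernel \<alpha> \<beta> t u) \<partial>lborel)"
        unfolding Q_def using True assms
        by (intro nn_integral_eq_integral[symmetric] integrable_Phi_kernel always_eventually allI Phi_kernel_nonneg) auto
      also have "\<dots> = (\<integral>\<^sup>+u. ennreal (indicator {t..1} (t + 1 * u) * (((t + 1 * u)\<^sup>2 - t\<^sup>2) powr \<alpha> * (1 - (t + 1 * u)) powr \<beta>)) \<partial>lborel)"
        using True assms by (simp add: Phi_kernel_shift)
      also have "\<dots> = (\<integral>\<^sup>+s. ennreal (indicator {t..1} s * ((s\<^sup>2 - t\<^sup>2) powr \<alpha> * (1 - s) powr \<beta>)) \<partial>lborel)"
        using nn_integral_real_affine[of "\<lambda>s. ennreal (indicator {t..1} s * ((s\<^sup>2 - t\<^sup>2) powr \<alpha> * (1 - s) powr \<beta>))" 1 t]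
        by simp
      also have "ennreal (t powr q) * \<dots> = (\<integral>\<^sup>+s. ennreal (t powr q) * ennreal (indicator {t..1} s * ((s\<^sup>2 - t\<^sup>2) powr \<alpha> * (1 - s) powr \<beta>)) \<partial>lborel)"
        by (rule nn_integral_cmult[symmetric]) measurable
      also have "\<dots> = (\<integral>\<^sup>+s. ennreal (?F t s) \<partial>lborel)"
        using True by (intro nn_integral_cong) (auto simp: indicator_def ennreal_mult'[symmetric] mult_ac)
      finally show ?thesis .
    qed (auto simp: indicator_def)
  qed
  also have "\<dots> = (\<integral>\<^sup>+s. (\<integral>\<^sup>+t. ennreal (?F t s) \<partial>lborel) \<partial>lborel)"
  proof (rule lborel_pair.Fubini'[symmetric])
    have "(\<lambda>p. (if 0 \<le> fst p \<and> fst p \<le> snd p then 1 else 0) * (fst p powr q * ((snd p)\<^sup>2 - (fst p)\<^sup>2) powr \<alpha>) *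
        (indicator {0..1} (snd p) * (1 - snd p) powr \<beta>) :: real) \<in> borel_measurable (lborel \<Otimes>\<^sub>M lborel)"
      by measurable
    then show "(\<lambda>(t, s). ennreal (?F t s)) \<in> borel_measurable (lborel \<Otimes>\<^sub>M lborel)"
      by (simp add: case_prod_beta indicator_def)
  qed
  also have "\<dots> = (\<integral>\<^sup>+s. ennreal (Beta ((q + 1) / 2) (\<alpha> + 1) / 2) *
      ennreal (indicator {0..1} s * (s powr (q + 2 * \<alpha> + 2 - 1) * (1 - s) powr (\<beta> + 1 - 1))) \<partial>lborel)"
  proof (rule nn_integral_cong)
    fix s :: real
    show "(\<integral>\<^sup>+t. ennreal (?F t s) \<partial>lborel) = ennreal (Beta ((q + 1) / 2) (\<alpha> + 1) / 2) *
      ennreal (indicator {0..1} s * (s powr (q + 2 * \<alpha> + 2 - 1) * (1 - s) powr (\<beta> + 1 - 1)))"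
    proof (cases "0 < s \<and> s \<le> 1")
      case True
      have "has_bochner_integral lborel (\<lambda>t. ?F t s)
          (s powr (q + 1 + 2 * \<alpha>) * (Beta ((q + 1) / 2) (\<alpha> + 1) / 2) * (indicator {0..1} s * (1 - s) powr \<beta>))"
        using True assms by (intro has_bochner_integral_mult_left has_bochner_integral_scaled_Beta) auto
      then have "(\<integral>\<^sup>+t. ennreal (?F t s) \<partial>lborel) =
          ennreal (s powr (q + 1 + 2 * \<alpha>) * (Beta ((q + 1) / 2) (\<alpha> + 1) / 2) * (indicator {0..1} s * (1 - s) powr \<beta>))"
        by (rule nn_integral_has_bochner_integral) (auto simp: indicator_def)
      then show ?thesis using True B by (simp add: ennreal_mult'[symmetric] mult_ac add_ac)
    next
      case False
      then have F: "?F t s = 0" for t by (cases "s = 0") (auto simp: indicator_def)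
      have "(\<integral>\<^sup>+t. ennreal (?F t s) \<partial>lborel) = 0" by (simp only: F ennreal_0 nn_integral_const mult_zero_left)
      then show ?thesis using False by (cases "s = 0") (auto simp: indicator_def)
    qed
  qed
  also have "\<dots> = ennreal (Beta ((q + 1) / 2) (\<alpha> + 1) / 2) *
      (\<integral>\<^sup>+s. ennreal (indicator {0..1} s * (s powr (q + 2 * \<alpha> + 2 - 1) * (1 - s) powr (\<beta> + 1 - 1))) \<partial>lborel)"
    by (rule nn_integral_cmult) measurable
  also have "(\<integral>\<^sup>+s. ennreal (indicator {0..1} s * (s powr (q + 2 * \<alpha> + 2 - 1) * (1 - s) powr (\<beta> + 1 - 1))) \<partial>lborel)
      = ennreal (Beta (q + 2 * \<alpha> + 2) (\<beta> + 1))"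
    using has_bochner_integral_Beta[of "q + 2 * \<alpha> + 2" "\<beta> + 1"] assms
    by (subst nn_integral_eq_integral) (auto simp: has_bochner_integral_iff indicator_def)
  finally show "(\<integral>\<^sup>+t. ennreal (indicator {0..} t * (t powr q * integral\<^sup>L lborel (Phi_kernel \<alpha> \<beta> t))) \<partial>lborel) =
      ennreal (Beta ((q + 1) / 2) (\<alpha> + 1) / 2 * Beta (q + 2 * \<alpha> + 2) (\<beta> + 1))"
    using B by (simp add: Q_def ennreal_mult'[symmetric])
qed

lemma omega_pos:
  assumes "d > 0" "\<delta> > real d / 2"
  shows "omega d \<delta> > 0"
proof -
  have "Gamma (3 * \<delta>) > 0" "Gamma (\<delta> - real d / 2) > 0" "Gamma \<delta> > 0" "Gamma (3 * \<delta> - real d) > 0" "Gamma (real d / 2) > 0"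
    using assms by (auto intro!: Gamma_real_pos)
  then show ?thesis by (simp add: omega_def)
qed

text \<open>The right-hand side is the moment of order 0 of \<open>Phi\<close> against
  \<open>t ^ (d - 1)\<close>. Its half-integer Gamma values are removed by Legendre duplication at
  \<open>\<delta>\<close> and at \<open>\<delta> - d / 2\<close>; the two factors
  \<open>sqrt pi\<close> cancel and the powers of 2 leave the \<open>2 powr (1 - d)\<close> of
  \<open>omega\<close>.\<close>

lemma omega_normalization:
  assumes "d > 0" "\<delta> > real d / 2"
  shows "1 / omega d \<delta> = Beta (real d / 2) (\<delta> - (real d + 1) / 2 + 1) * Beta (2 * \<delta>) \<delta> / (2 * Beta (2 * \<delta> - real d) \<delta>)"
proof -
  let ?z = "\<delta> - real d / 2"
  have p: "Gamma (3 * \<delta>) > 0" "Gamma ?z > 0" "Gamma \<delta> > 0" "Gamma (3 * \<delta> - real d) > 0" "Gamma (real d / 2) > 0"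
    "Gamma (2 * \<delta>) > 0" "Gamma (2 * \<delta> - real d) > 0" "Gamma (\<delta> + 1/2) > 0" "Gamma (?z + 1/2) > 0"
    using assms by (auto intro!: Gamma_real_pos)
  have dup: "Gamma z * Gamma (z + 1/2) = 2 powr (1 - 2 * z) * sqrt pi * Gamma (2 * z)" if "z > 0" for z :: real
  proof -
    have "z \<notin> \<int>\<^sub>\<le>\<^sub>0" "z + 1/2 \<notin> \<int>\<^sub>\<le>\<^sub>0" using that by (auto elim!: nonpos_Ints_cases)
    then have "complex_of_real z \<notin> \<int>\<^sub>\<le>\<^sub>0" "complex_of_real z + 1/2 \<notin> \<int>\<^sub>\<le>\<^sub>0"
      using of_real_in_nonpos_Ints_iff[of z, where 'a = complex]
        of_real_in_nonpos_Ints_iff[of "z + 1/2", where 'a = complex] by (auto simp del: of_real_in_nonpos_Ints_iff)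
    then have "Gamma (complex_of_real z) * Gamma (complex_of_real z + 1/2) =
        exp ((1 - 2 * complex_of_real z) * of_real (ln 2)) * of_real (sqrt pi) * Gamma (2 * complex_of_real z)"
      by (rule Gamma_legendre_duplication)
    also have "\<dots> = complex_of_real (2 powr (1 - 2 * z) * sqrt pi * Gamma (2 * z))"
      by (simp add: powr_def exp_of_real[symmetric] Gamma_complex_of_real[symmetric])
    also have "Gamma (complex_of_real z) * Gamma (complex_of_real z + 1/2) = complex_of_real (Gamma z * Gamma (z + 1/2))"
      by (simp add: Gamma_complex_of_real[symmetric])
    finally show ?thesis by (simp only: of_real_eq_iff)
  qed
  have G1: "Gamma \<delta> * Gamma (\<delta> + 1/2) = 2 powr (1 - 2 * \<delta>) * sqrt pi * Gamma (2 * \<delta>)"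
    using assms by (intro dup) auto
  have G2: "Gamma ?z * Gamma (?z + 1/2) = 2 powr (1 - 2 * \<delta> + real d) * sqrt pi * Gamma (2 * \<delta> - real d)"
    using dup[of ?z] assms by (simp add: algebra_simps)
  have e: "2 powr (1 - real d) * 2 powr (1 - 2 * \<delta> + real d) = 2 * (2::real) powr (1 - 2 * \<delta>)"
    by (simp add: powr_add[symmetric] powr_mult_base)
  have z: "\<delta> - (real d + 1) / 2 + 1 = ?z + 1/2" "real d / 2 + (?z + 1/2) = \<delta> + 1/2"
    "2 * \<delta> + \<delta> = 3 * \<delta>" "2 * \<delta> - real d + \<delta> = 3 * \<delta> - real d" by (simp_all add: field_simps)
  have "2 powr (1 - real d) * (Gamma ?z * Gamma (?z + 1/2)) * Gamma (2 * \<delta>) =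
      2 * (Gamma \<delta> * Gamma (\<delta> + 1/2)) * Gamma (2 * \<delta> - real d)"
    unfolding G1 G2 using e by (simp add: algebra_simps)
  then show ?thesis
    unfolding omega_def Beta_def z using p by (simp add: divide_simps) (simp add: algebra_simps)
qed

text \<open>The exponents of \<open>Phi\<close> are made for the moment condition of
  \<open>Omega_integral_W\<close>. With \<open>q = 2 * k + d - 1\<close> the inner Beta value has
  arguments \<open>d / 2 + k\<close> and \<open>\<alpha> + 1\<close>, where
  \<open>d / 2 + \<alpha> + 1 = \<delta> + 1/2\<close>, and the outer one has
  \<open>q + 2 * \<alpha> + 2 = 2 * \<delta> + 2 * k\<close>. Their ratios to \<open>k = 0\<close>
  are the required Pochhammer quotients.\<close>

lemma W_eq_Phi_average:
  assumes d: "d > 0" "\<delta> > 1" "\<delta> > real d / 2"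
  shows "has_bochner_integral lborel
    (\<lambda>t. Omega ((real d - 2) / 2) (r * t) * (indicator {0..} t * (Phi d \<delta> t * t ^ (d - 1)))) (W \<delta> r / omega d \<delta>)"
proof -
  let ?\<alpha> = "\<delta> - (real d + 1) / 2" and ?B = "Beta (2 * \<delta> - real d) \<delta>" and ?l = "(real d - 2) / 2"
  have "has_bochner_integral lborel
    (\<lambda>t. Omega ?l (r * t) * (indicator {0..} t * (Phi d \<delta> t * t ^ (d - 1)))) (1 / omega d \<delta> * W \<delta> r)"
  proof (rule Omega_integral_W)
    show "?l > -1" "\<delta> > 0" using d by auto
    show "0 \<le> indicator {0..} t * (Phi d \<delta> t * t ^ (d - 1))" for t
      using Phi_nonneg[OF d(2,3), of t] by (auto simp: indicator_def)
    fix k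
    let ?q = "real (2 * k + (d - 1))"
    have q: "?q + 1 = real d + 2 * real k" using d by (simp add: of_nat_diff)
    have hb: "has_bochner_integral lborel
        (\<lambda>t. 1 / ?B * (indicator {0..} t * (t powr ?q * integral\<^sup>L lborel (Phi_kernel ?\<alpha> (\<delta> - 1) t))))
        (1 / ?B * (Beta ((?q + 1) / 2) (?\<alpha> + 1) / 2 * Beta (?q + 2 * ?\<alpha> + 2) (\<delta> - 1 + 1)))"
      using d by (intro has_bochner_integral_mult_right has_bochner_integral_Phi_kernel_moment) (auto simp: field_simps)
    have p: "pochhammer (real d / 2 + (?\<alpha> + 1)) k > 0" using d by (intro pochhammer_pos) (simp add: field_simps)
    have e1: "Beta ((?q + 1) / 2) (?\<alpha> + 1) = Beta (real d / 2) (?\<alpha> + 1) *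
        (pochhammer (real d / 2) k / pochhammer (\<delta> + 1/2) k)"
    proof -
      have a: "(?q + 1) / 2 = real d / 2 + real k" "real d / 2 + (?\<alpha> + 1) = \<delta> + 1/2"
        unfolding q by (simp_all add: field_simps)
      show ?thesis
        using Beta_ratio[of "real d / 2" "?\<alpha> + 1" k] d unfolding a by (simp add: field_simps)
    qed
    have e2: "Beta (?q + 2 * ?\<alpha> + 2) (\<delta> - 1 + 1) = Beta (2 * \<delta>) \<delta> *
        (pochhammer (2 * \<delta>) (2 * k) / pochhammer (3 * \<delta>) (2 * k))"
    proof -
      have "?q + 2 * ?\<alpha> + 2 = (?q + 1) + 2 * ?\<alpha> + 1" by simp
      also have "\<dots> = 2 * \<delta> + real (2 * k)" unfolding q by (simp add: field_simps)
      finally have a: "?q + 2 * ?\<alpha> + 2 = 2 * \<delta> + real (2 * k)" .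
      show ?thesis unfolding a using Beta_ratio[of "2 * \<delta>" \<delta> "2 * k"] d by simp
    qed
    have v: "1 / ?B * (Beta ((?q + 1) / 2) (?\<alpha> + 1) / 2 * Beta (?q + 2 * ?\<alpha> + 2) (\<delta> - 1 + 1)) =
        1 / omega d \<delta> * (pochhammer (?l + 1) k * pochhammer (2 * \<delta>) (2 * k) /
        (pochhammer (\<delta> + 1/2) k * pochhammer (3 * \<delta>) (2 * k)))"
    proof -
      have a: "?l + 1 = real d / 2" by (simp add: field_simps)
      show ?thesis
        unfolding a e1 e2 omega_normalization[OF d(1,3)] by (simp add: mult_ac)
    qed
    show "has_bochner_integral lborel (\<lambda>t. t ^ (2 * k) * (indicator {0..} t * (Phi d \<delta> t * t ^ (d - 1))))
      (1 / omega d \<delta> * (pochhammer (?l + 1) k * pochhammer (2 * \<delta>) (2 * k) /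
        (pochhammer (\<delta> + 1/2) k * pochhammer (3 * \<delta>) (2 * k))))"
      unfolding v[symmetric]
    proof (rule has_bochner_integral_cong_except_0[THEN iffD1, OF _ hb])
      fix t :: real assume "t \<noteq> 0"
      show "1 / ?B * (indicator {0..} t * (t powr ?q * integral\<^sup>L lborel (Phi_kernel ?\<alpha> (\<delta> - 1) t))) =
          t ^ (2 * k) * (indicator {0..} t * (Phi d \<delta> t * t ^ (d - 1)))"
      proof (cases "t > 0")
        case True
        then have "t powr ?q = t ^ (2 * k) * t ^ (d - 1)" by (simp add: powr_realpow power_add del: of_nat_add of_nat_mult)
        then show ?thesis using True d by (simp add: Phi_eq_integral_Phi_kernel)
      qed (use \<open>t \<noteq> 0\<close> in auto)
    qed
  qed
  then show ?thesis by simp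
qed

section \<open>The differential equation of \<open>W\<close>\<close>

text \<open>
  With \<open>\<theta> = t d/dt\<close>, \<open>W1\<close> and \<open>W2\<close> are \<open>(\<theta> + 2\<delta>)W\<close> and \<open>(\<theta> + 2\<delta>)\<^sup>2W\<close>, so that
  \<open>h0 = t\<^sup>2\<^sup>\<delta> W\<close> has the derivatives \<open>h1\<close> and \<open>h2\<close>.
\<close>
definition W1 :: "real \<Rightarrow> real \<Rightarrow> real" where
  "W1 \<delta> = even_series (\<lambda>k. (2 * real k + 2 * \<delta>) * W_coeff \<delta> k)"

definition W2 :: "real \<Rightarrow> real \<Rightarrow> real" where
  "W2 \<delta> = even_series (\<lambda>k. (2 * real k + 2 * \<delta>) * ((2 * real k + 2 * \<delta>) * W_coeff \<delta> k))"

lemma even_series_affine: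
  assumes "entire_coeffs b"
  shows "even_series (\<lambda>k. (p * real k + q) * b k) t = p * even_series (\<lambda>k. real k * b k) t + q * even_series b t"
  using even_series_add[OF entire_coeffs_cmult[OF entire_coeffs_times_index[OF assms], of p] entire_coeffs_cmult[OF assms, of q], of t]
    even_series_cmult[OF entire_coeffs_times_index[OF assms], of p t] even_series_cmult[OF assms, of q t]
  by (simp add: distrib_right mult.assoc)

lemma DERIV_even_series_affine:
  assumes "entire_coeffs b" "t \<noteq> 0"
  shows "(even_series b has_real_derivative
    (even_series (\<lambda>k. (2 * real k + p) * b k) t - p * even_series b t) / t) (at t)"
proof -
  have "even_series (\<lambda>k. 2 * real k * b k) t = even_series (\<lambda>k. (2 * real k + p) * b k) t - p * even_series b t"
    using even_series_affine[OF assms(1), of 2 p t] even_series_affine[OF assms(1), of 2 0 t] by simp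
  then show ?thesis using DERIV_even_series_euler[OF assms] by simp
qed

lemma entire_W1_coeff: "\<delta> > 0 \<Longrightarrow> entire_coeffs (\<lambda>k. (2 * real k + 2 * \<delta>) * W_coeff \<delta> k)"
  by (intro entire_coeffs_times_affine entire_W_coeff)

lemma entire_W2_coeff:
  "\<delta> > 0 \<Longrightarrow> entire_coeffs (\<lambda>k. (2 * real k + 2 * \<delta>) * ((2 * real k + 2 * \<delta>) * W_coeff \<delta> k))"
  by (intro entire_coeffs_times_affine entire_W_coeff)

lemma DERIV_W: "\<delta> > 0 \<Longrightarrow> t \<noteq> 0 \<Longrightarrow> (W \<delta> has_real_derivative (W1 \<delta> t - 2 * \<delta> * W \<delta> t) / t) (at t)"
  unfolding W1_def W_eq_even_series by (rule DERIV_even_series_affine[OF entire_W_coeff])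

lemma DERIV_W1: "\<delta> > 0 \<Longrightarrow> t \<noteq> 0 \<Longrightarrow> (W1 \<delta> has_real_derivative (W2 \<delta> t - 2 * \<delta> * W1 \<delta> t) / t) (at t)"
  unfolding W1_def W2_def by (rule DERIV_even_series_affine[OF entire_W1_coeff])

lemma even_series_lincomb:
  assumes "entire_coeffs a" "entire_coeffs b" "entire_coeffs c" "entire_coeffs e"
  shows "even_series (\<lambda>k. a k + (p * b k + (q * c k + r * e k))) t =
    even_series a t + (p * even_series b t + (q * even_series c t + r * even_series e t))"
proof -
  have "(\<lambda>k. a k * t ^ (2 * k) + (p * (b k * t ^ (2 * k)) + (q * (c k * t ^ (2 * k)) + r * (e k * t ^ (2 * k))))) sums
      (even_series a t + (p * even_series b t + (q * even_series c t + r * even_series e t)))"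
    by (intro sums_add sums_mult even_series_sums assms)
  then show ?thesis
    unfolding even_series_def[of "\<lambda>k. a k + (p * b k + (q * c k + r * e k))"]
    by (intro sums_unique[symmetric]) (simp add: distrib_right mult.assoc)
qed

text \<open>The hypergeometric equation \<open>\<theta> (\<theta> + 3\<delta> - 2) (\<theta> +
  3\<delta> - 1) W = - t\<^sup>2 (\<theta> + 2\<delta>) W\<close> with
  \<open>\<theta> = t d/dt\<close>, expanded in powers of \<open>\<theta> + 2\<delta>\<close>. With
  this shift the right side is a multiple of \<open>W1\<close> alone and the square has coefficient
  3; as \<open>t\<^sup>3 h''' = \<theta> (\<theta> - 1) (\<theta> - 2) h\<close>, this is what keeps
  \<open>h''\<close> out of the equation for \<open>h0\<close>.\<close>

lemma W3_ode:
  assumes "\<delta> > 0"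
  shows "even_series (\<lambda>k. (2 * real k + 2 * \<delta>) * ((2 * real k + 2 * \<delta>) * ((2 * real k + 2 * \<delta>) * W_coeff \<delta> k))) t =
    3 * W2 \<delta> t + (3 * \<delta>\<^sup>2 - 3 * \<delta> - 2) * W1 \<delta> t + 2 * \<delta> * (\<delta> - 1) * (\<delta> - 2) * W \<delta> t - t\<^sup>2 * W1 \<delta> t"
proof -
  let ?c = "W_coeff \<delta>" and ?x = "\<lambda>k. 2 * real k + 2 * \<delta>"
  let ?c1 = "\<lambda>k. ?x k * ?c k" and ?c2 = "\<lambda>k. ?x k * (?x k * ?c k)" and ?c3 = "\<lambda>k. ?x k * (?x k * (?x k * ?c k))"
  let ?p = "3 * \<delta>\<^sup>2 - 3 * \<delta> - 2" and ?q = "2 * \<delta> * (\<delta> - 1) * (\<delta> - 2)"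
  note e = entire_W_coeff[OF assms]
  have e1: "entire_coeffs ?c1" and e2: "entire_coeffs ?c2" and e3: "entire_coeffs ?c3"
    by (intro entire_coeffs_times_affine e)+
  let ?d = "\<lambda>k. ?c3 k + (- 3 * ?c2 k + (- ?p * ?c1 k + - ?q * ?c k))"
  have d_eq: "?d k = (2 * real k) * (2 * real k + 3 * \<delta> - 2) * (2 * real k + 3 * \<delta> - 1) * ?c k" for k
    by (simp add: algebra_simps power2_eq_square)
  have lin: "x + (- 3 * y + (- p * z + - q * w)) = x - 3 * y - p * z - q * w" for x y z w p q :: real by simp
  have "even_series ?d t = even_series ?c3 t - 3 * W2 \<delta> t - ?p * W1 \<delta> t - ?q * W \<delta> t"
    unfolding W1_def W2_def W_eq_even_series[OF assms]
    by (subst even_series_lincomb[OF e3 e2 e1 e]) (rule lin)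
  moreover have "even_series ?d t = t\<^sup>2 * even_series (\<lambda>k. ?d (Suc k)) t"
  proof (rule even_series_shift)
    show "entire_coeffs ?d"
      by (rule entire_coeffs_add[OF e3 entire_coeffs_add[OF entire_coeffs_cmult[OF e2]
            entire_coeffs_add[OF entire_coeffs_cmult[OF e1] entire_coeffs_cmult[OF e]]]])
    show "?d 0 = 0" unfolding d_eq by simp
  qed
  moreover have "(\<lambda>k. ?d (Suc k)) = (\<lambda>k. - 1 * ?c1 k)"
  proof
    fix k
    have pos: "3 * \<delta> + 2 * real k \<noteq> 0" "3 * \<delta> + 2 * real k + 1 \<noteq> 0" using assms by auto
    have "?d (Suc k) = 2 * ((real k + 1) * (3 * \<delta> + 2 * real k) * (3 * \<delta> + 2 * real k + 1) * ?c (Suc k))"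
      unfolding d_eq by (simp add: algebra_simps)
    also have "(real k + 1) * (3 * \<delta> + 2 * real k) * (3 * \<delta> + 2 * real k + 1) * ?c (Suc k) = - (\<delta> + real k) * ?c k"
      unfolding W_coeff_Suc using pos by simp (simp add: algebra_simps)
    finally show "?d (Suc k) = - 1 * ?c1 k" by (simp add: algebra_simps)
  qed
  moreover have "even_series (\<lambda>k. - 1 * ?c1 k) t = - W1 \<delta> t"
    using even_series_cmult[OF e1, of "-1" t] by (simp add: W1_def)
  ultimately show ?thesis by simp
qed

lemma DERIV_W2:
  assumes "\<delta> > 0" "t \<noteq> 0"
  shows "(W2 \<delta> has_real_derivative (3 * W2 \<delta> t + (3 * \<delta>\<^sup>2 - 3 * \<delta> - 2) * W1 \<delta> t
    + 2 * \<delta> * (\<delta> - 1) * (\<delta> - 2) * W \<delta> t - t\<^sup>2 * W1 \<delta> t - 2 * \<delta> * W2 \<delta> t) / t) (at t)"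
  using DERIV_even_series_affine[OF entire_W2_coeff[OF assms(1)] assms(2), of "2 * \<delta>"]
  unfolding W3_ode[OF assms(1)] W2_def[symmetric] .

definition h0 :: "real \<Rightarrow> real \<Rightarrow> real" where "h0 \<delta> t = t powr (2 * \<delta>) * W \<delta> t"
definition h1 :: "real \<Rightarrow> real \<Rightarrow> real" where "h1 \<delta> t = t powr (2 * \<delta> - 1) * W1 \<delta> t"
definition h2 :: "real \<Rightarrow> real \<Rightarrow> real" where "h2 \<delta> t = t powr (2 * \<delta> - 2) * (W2 \<delta> t - W1 \<delta> t)"

lemma powr_split:
  fixes t :: real
  assumes "t > 0"
  shows "t powr (2 * \<delta>) = t powr (2 * \<delta> - 3) * t ^ 3" "t powr (2 * \<delta> - 1) = t powr (2 * \<delta> - 3) * t\<^sup>2"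
    "t powr (2 * \<delta> - 2) = t powr (2 * \<delta> - 3) * t"
  using assms powr_add[of t "2 * \<delta> - 3" 3] powr_add[of t "2 * \<delta> - 3" 2] powr_add[of t "2 * \<delta> - 3" 1]
  by (simp_all add: powr_numeral)

lemma DERIV_powr_times:
  fixes F :: "real \<Rightarrow> real"
  assumes "t > 0" "(F has_real_derivative D) (at t)"
  shows "((\<lambda>t. t powr p * F t) has_real_derivative t powr (p - 1) * (p * F t + t * D)) (at t)"
proof -
  have "((\<lambda>t. t powr p * F t) has_real_derivative p * t powr (p - 1) * F t + D * t powr p) (at t)"
    using DERIV_mult[OF has_real_derivative_powr[OF assms(1), of p] assms(2)] by simp
  moreover have "t powr p = t powr (p - 1) * t"
    using powr_add[of t "p - 1" 1] assms(1) by simp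
  ultimately show ?thesis by (simp add: algebra_simps)
qed

lemma DERIV_h0:
  assumes "\<delta> > 0" "t > 0"
  shows "(h0 \<delta> has_real_derivative h1 \<delta> t) (at t)"
  using DERIV_powr_times[OF assms(2) DERIV_W[OF assms(1)], of "2 * \<delta>"] assms(2)
  by (simp add: h0_def[abs_def] h1_def)

lemma DERIV_h1:
  assumes "\<delta> > 0" "t > 0"
  shows "(h1 \<delta> has_real_derivative h2 \<delta> t) (at t)"
proof -
  have "(2 * \<delta> - 1) * W1 \<delta> t + t * ((W2 \<delta> t - 2 * \<delta> * W1 \<delta> t) / t) = W2 \<delta> t - W1 \<delta> t"
  proof -
    have "t * (x / t) = x" for x using assms(2) by simp
    then show ?thesis by (simp only:) (simp add: algebra_simps)
  qed
  moreover have "2 * \<delta> - 1 - 1 = 2 * \<delta> - 2" by simp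
  ultimately show ?thesis
    using DERIV_powr_times[OF assms(2) DERIV_W1[OF assms(1)], of "2 * \<delta> - 1"] assms(2)
    unfolding h1_def[abs_def] h2_def by (simp only:)
qed

text \<open>The right side of the equation \<open>h''' + h' = force\<close>. It has no
  \<open>h''\<close> term and decays like \<open>1 / t\<^sup>2\<close> as soon as \<open>h\<close>
  and \<open>h'\<close> are bounded.\<close>

definition h_force :: "real \<Rightarrow> real \<Rightarrow> real" where
  "h_force \<delta> t = \<delta> * (\<delta> - 1) * (3 * h1 \<delta> t / t\<^sup>2 + 2 * (\<delta> - 2) * h0 \<delta> t / t ^ 3)"

lemma DERIV_h2:
  assumes "\<delta> > 0" "t > 0"
  shows "(h2 \<delta> has_real_derivative h_force \<delta> t - h1 \<delta> t) (at t)"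
proof -
  let ?D2 = "(3 * W2 \<delta> t + (3 * \<delta>\<^sup>2 - 3 * \<delta> - 2) * W1 \<delta> t
    + 2 * \<delta> * (\<delta> - 1) * (\<delta> - 2) * W \<delta> t - t\<^sup>2 * W1 \<delta> t - 2 * \<delta> * W2 \<delta> t) / t"
  let ?D1 = "(W2 \<delta> t - 2 * \<delta> * W1 \<delta> t) / t"
  have "((\<lambda>t. t powr (2 * \<delta> - 2) * (W2 \<delta> t - W1 \<delta> t)) has_real_derivative
      t powr (2 * \<delta> - 2 - 1) * ((2 * \<delta> - 2) * (W2 \<delta> t - W1 \<delta> t) + t * (?D2 - ?D1))) (at t)"
    using assms by (intro DERIV_powr_times DERIV_diff DERIV_W2 DERIV_W1) auto
  moreover have "t * (?D2 - ?D1) = (3 * W2 \<delta> t + (3 * \<delta>\<^sup>2 - 3 * \<delta> - 2) * W1 \<delta> t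
    + 2 * \<delta> * (\<delta> - 1) * (\<delta> - 2) * W \<delta> t - t\<^sup>2 * W1 \<delta> t - 2 * \<delta> * W2 \<delta> t) - (W2 \<delta> t - 2 * \<delta> * W1 \<delta> t)"
  proof -
    have "t * (X / t - Y / t) = X - Y" for X Y using assms by (simp add: right_diff_distrib)
    then show ?thesis .
  qed
  moreover have "h_force \<delta> t - h1 \<delta> t = t powr (2 * \<delta> - 3) *
      (\<delta> * (\<delta> - 1) * (3 * W1 \<delta> t + 2 * (\<delta> - 2) * W \<delta> t) - t\<^sup>2 * W1 \<delta> t)"
  proof -
    have "3 * (P * t\<^sup>2 * w) / t\<^sup>2 = 3 * P * w" "2 * c * (P * t ^ 3 * w) / t ^ 3 = 2 * c * P * w" for P w c
      using assms(2) by simp_all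
    then show ?thesis
      unfolding h_force_def h0_def h1_def powr_split[OF assms(2)] by (simp only:) (simp add: algebra_simps)
  qed
  moreover have "(2 * \<delta> - 2) * (w2 - w1) + ((3 * w2 + (3 * \<delta>\<^sup>2 - 3 * \<delta> - 2) * w1
    + 2 * \<delta> * (\<delta> - 1) * (\<delta> - 2) * w - t\<^sup>2 * w1 - 2 * \<delta> * w2) - (w2 - 2 * \<delta> * w1)) =
      \<delta> * (\<delta> - 1) * (3 * w1 + 2 * (\<delta> - 2) * w) - t\<^sup>2 * w1" for w w1 w2
    by (simp add: algebra_simps power2_eq_square)
  moreover have "2 * \<delta> - 2 - 1 = 2 * \<delta> - 3" by simp
  ultimately show ?thesis unfolding h2_def[abs_def] by (simp only:)
qed

section \<open>Positivity of \<open>W\<close>\<close>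

text \<open>For \<open>t > 0\<close> this is \<open>h h'' - h'\<^sup>2 / 2 + 2 Q h\<^sup>2\<close>
  with the potential \<open>Q\<close> of the symmetric square. Pulling out
  \<open>t powr (4 * \<delta> - 2)\<close> makes the definition meaningful at 0, where it is
  continuous with value 0 for \<delta> > 1, although the potential is singular there.\<close>

definition h_energy :: "real \<Rightarrow> real \<Rightarrow> real" where
  "h_energy \<delta> t = t powr (4 * \<delta> - 2) *
    (W \<delta> t * (W2 \<delta> t - W1 \<delta> t) - (W1 \<delta> t)\<^sup>2 / 2 + (t\<^sup>2 - 3 * \<delta> * (\<delta> - 1)) * (W \<delta> t)\<^sup>2 / 2)"

lemma h_energy_eq:
  assumes "t > 0"
  shows "h_energy \<delta> t = h0 \<delta> t * h2 \<delta> t - (h1 \<delta> t)\<^sup>2 / 2 + (1 - 3 * \<delta> * (\<delta> - 1) / t\<^sup>2) * (h0 \<delta> t)\<^sup>2 / 2"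
proof -
  let ?P = "t powr (2 * \<delta> - 3)"
  have "t powr (4 * \<delta> - 2) = ?P * ?P * t ^ 4"
    using assms powr_add[of t "(2 * \<delta> - 3) + (2 * \<delta> - 3)" 4] powr_add[of t "2 * \<delta> - 3" "2 * \<delta> - 3"]
    by (simp add: powr_numeral)
  then show ?thesis
    unfolding h_energy_def h0_def h1_def h2_def powr_split[OF assms] using assms
    by (simp add: field_simps power2_eq_square power3_eq_cube power4_eq_xxxx)
qed

text \<open>
  The operator \<open>h''' + 4Qh' + 2Q'h\<close> with \<open>4Q = 1 - 3\<delta>(\<delta>-1)/t\<^sup>2\<close> is a symmetric square. Multiplication by
  \<open>h\<close> turns it into a total derivative, and the remaining term of the equation for \<open>h\<close> has a sign.
\<close>
lemma DERIV_h_energy: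
  assumes "\<delta> > 0" "t > 0"
  shows "(h_energy \<delta> has_real_derivative \<delta> * (\<delta> - 1) * (2 * \<delta> - 1) * (h0 \<delta> t)\<^sup>2 / t ^ 3) (at t)"
proof -
  note d = DERIV_h0[OF assms] DERIV_h1[OF assms] DERIV_h2[OF assms]
  have "((\<lambda>t. 1 - 3 * \<delta> * (\<delta> - 1) / t\<^sup>2) has_real_derivative 6 * \<delta> * (\<delta> - 1) / t ^ 3) (at t)"
    using assms by (auto intro!: derivative_eq_intros simp: field_simps power2_eq_square power3_eq_cube)
  note d' = this
  have "((\<lambda>t. h0 \<delta> t * h2 \<delta> t - (h1 \<delta> t)\<^sup>2 / 2 + (1 - 3 * \<delta> * (\<delta> - 1) / t\<^sup>2) * (h0 \<delta> t)\<^sup>2 / 2) has_real_derivative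
     (h1 \<delta> t * h2 \<delta> t + (h_force \<delta> t - h1 \<delta> t) * h0 \<delta> t) - (2 * h1 \<delta> t * h2 \<delta> t) / 2 +
     (6 * \<delta> * (\<delta> - 1) / t ^ 3 * (h0 \<delta> t)\<^sup>2 + (2 * h0 \<delta> t * h1 \<delta> t) * (1 - 3 * \<delta> * (\<delta> - 1) / t\<^sup>2)) / 2) (at t)"
    using DERIV_add[OF DERIV_diff[OF DERIV_mult[OF d(1) d(3)] DERIV_cdivide[OF DERIV_power[OF d(2), of 2], of 2]]
        DERIV_cdivide[OF DERIV_mult[OF d' DERIV_power[OF d(1), of 2]], of 2]]
    by (simp add: mult_ac)
  moreover have "(h1 \<delta> t * h2 \<delta> t + (h_force \<delta> t - h1 \<delta> t) * h0 \<delta> t) - (2 * h1 \<delta> t * h2 \<delta> t) / 2 +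
     (6 * \<delta> * (\<delta> - 1) / t ^ 3 * (h0 \<delta> t)\<^sup>2 + (2 * h0 \<delta> t * h1 \<delta> t) * (1 - 3 * \<delta> * (\<delta> - 1) / t\<^sup>2)) / 2 =
     \<delta> * (\<delta> - 1) * (2 * \<delta> - 1) * (h0 \<delta> t)\<^sup>2 / t ^ 3"
    unfolding h_force_def using assms by (simp add: field_simps power2_eq_square power3_eq_cube)
  ultimately show ?thesis
    using has_field_derivative_transform_within_open[of _ _ t "{0<..}" "h_energy \<delta>"] assms
    by (simp add: h_energy_eq)
qed

lemma continuous_on_h_energy:
  assumes "\<delta> > 1"
  shows "continuous_on {0..T} (h_energy \<delta>)"
proof -
  have "continuous_on {0..T} (\<lambda>t::real. t powr (4 * \<delta> - 2))"
    using assms by (intro continuous_on_powr' continuous_intros) auto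
  then show ?thesis
    unfolding h_energy_def W1_def W2_def W_eq_even_series[OF less_trans[OF zero_less_one assms]]
    using assms by (intro continuous_on_mult[OF \<open>continuous_on {0..T} (\<lambda>t. t powr (4 * \<delta> - 2))\<close>] continuous_intros continuous_on_even_series entire_coeffs_times_affine entire_W_coeff) auto
qed

text \<open>The energy at a zero \<open>T\<close> is only known to be nonpositive, not negative.
  Squeezed between its values at 0 and at \<open>T\<close>, it is identically 0 in between, and this
  is what leads to the contradiction.\<close>

lemma W_nonzero:
  assumes \<delta>: "\<delta> > 1" and T: "T > 0"
  shows "W \<delta> T \<noteq> 0"
proof
  assume zero: "W \<delta> T = 0"
  have pos: "\<delta> > 0" using \<delta> by simp
  have mono: "h_energy \<delta> a \<le> h_energy \<delta> b" if "0 \<le> a" "a \<le> b" for a b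
  proof (rule DERIV_nonneg_imp_increasing_open[OF that(2)])
    fix x assume x: "a < x" "x < b"
    have "0 \<le> \<delta> * (\<delta> - 1) * (2 * \<delta> - 1) * (h0 \<delta> x)\<^sup>2 / x ^ 3"
      using x that \<delta> by (intro divide_nonneg_nonneg mult_nonneg_nonneg) auto
    then show "\<exists>y. (h_energy \<delta> has_real_derivative y) (at x) \<and> 0 \<le> y"
      using DERIV_h_energy[OF pos, of x] x that by fastforce
  qed (rule continuous_on_subset[OF continuous_on_h_energy[OF \<delta>, of b]], use that in auto)
  have "h_energy \<delta> 0 = 0" by (simp add: h_energy_def)
  moreover have "h_energy \<delta> T \<le> 0"
    unfolding h_energy_def zero by (simp add: mult_nonneg_nonpos)
  ultimately have E0: "h_energy \<delta> x = 0" if "0 < x" "x < T" for x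
    using mono[of 0 x] mono[of x T] that by simp
  \<comment> \<open>A constant energy has derivative 0, and for \<delta> > 1 that derivative is a
    positive multiple of the square of \<open>h0\<close>. So \<open>W\<close> would vanish on the
    whole interval up to \<open>T\<close>, against \<open>W \<delta> 0 = 1\<close> and
    continuity.\<close>
  have W0: "W \<delta> x = 0" if "0 < x" "x < T" for x
  proof -
    have "((\<lambda>_. 0) has_real_derivative \<delta> * (\<delta> - 1) * (2 * \<delta> - 1) * (h0 \<delta> x)\<^sup>2 / x ^ 3) (at x)"
      by (rule has_field_derivative_transform_within_open[OF DERIV_h_energy[OF pos that(1)], of "{0<..<T}"])
         (use that E0 in auto)
    then have "\<delta> * (\<delta> - 1) * (2 * \<delta> - 1) * (h0 \<delta> x)\<^sup>2 / x ^ 3 = 0"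
      using DERIV_unique DERIV_const by blast
    then show ?thesis using \<delta> that by (simp add: h0_def)
  qed
  have "(\<lambda>n. T / (real n + 2)) \<longlonglongrightarrow> 0" by real_asymp
  moreover have "isCont (W \<delta>) 0"
    using continuous_on_W[OF pos, of UNIV] by (simp add: continuous_on_eq_continuous_at)
  ultimately have "(\<lambda>n. W \<delta> (T / (real n + 2))) \<longlonglongrightarrow> W \<delta> 0"
    by (rule isCont_tendsto_compose[rotated])
  moreover have "W \<delta> (T / (real n + 2)) = 0" for n
    by (rule W0) (use T in \<open>auto simp: field_simps intro: add_pos_nonneg\<close>)
  ultimately show False using pos by (simp add: LIMSEQ_const_iff)
qed

lemma W_pos:
  assumes "\<delta> > 1" "r \<ge> 0"
  shows "W \<delta> r > 0"
proof (rule ccontr)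
  assume "\<not> W \<delta> r > 0"
  then obtain x where "0 \<le> x" "x \<le> r" "W \<delta> x = 0"
    using IVT2'[of "W \<delta>" r 0 0] continuous_on_W[of \<delta> "{0..r}"] assms by auto
  then show False using W_nonzero[OF assms(1), of x] assms(1) by (cases "x = 0") auto
qed

section \<open>The form of \<open>h0\<close> at infinity\<close>

text \<open>The function \<open>f - M / t\<close> increases and \<open>f + M / t\<close> decreases,
  so every value of the first lies below every value of the second. The supremum of the first is the
  limit, and the gap gives the rate \<open>M / t\<close>.\<close>

lemma bounded_inverse_square_derivative_limit:
  fixes f :: "real \<Rightarrow> real"
  assumes d: "\<And>t. t \<ge> 1 \<Longrightarrow> (f has_real_derivative f' t) (at t)"
    and b: "\<And>t. t \<ge> 1 \<Longrightarrow> \<bar>f' t\<bar> \<le> M / t\<^sup>2"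
  shows "\<exists>L. \<forall>t\<ge>1. \<bar>f t - L\<bar> \<le> M / t"
proof -
  have M: "M \<ge> 0" using b[of 1] by simp
  have dM: "((\<lambda>t. M / t) has_real_derivative - M / t\<^sup>2) (at t)" if "t \<ge> 1" for t
    using that by (auto intro!: derivative_eq_intros simp: power2_eq_square)
  have up: "f s - M / s \<le> f t - M / t" and dn: "f t + M / t \<le> f s + M / s" if "1 \<le> s" "s \<le> t" for s t
  proof -
    show "f s - M / s \<le> f t - M / t"
    proof (rule DERIV_nonneg_imp_nondecreasing[OF that(2)])
      fix x assume "s \<le> x" "x \<le> t"
      then have x: "x \<ge> 1" using that by simp
      show "\<exists>y. ((\<lambda>t. f t - M / t) has_real_derivative y) (at x) \<and> 0 \<le> y"
        using DERIV_diff[OF d[OF x] dM[OF x]] b[OF x] by (intro exI[of _ "f' x - - M / x\<^sup>2"]) auto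
    qed
    show "f t + M / t \<le> f s + M / s"
    proof (rule DERIV_nonpos_imp_nonincreasing[OF that(2)])
      fix x assume "s \<le> x" "x \<le> t"
      then have x: "x \<ge> 1" using that by simp
      show "\<exists>y. ((\<lambda>t. f t + M / t) has_real_derivative y) (at x) \<and> y \<le> 0"
        using DERIV_add[OF d[OF x] dM[OF x]] b[OF x] by (intro exI[of _ "f' x + - M / x\<^sup>2"]) auto
    qed
  qed
  have cross: "f t - M / t \<le> f s + M / s" if "s \<ge> 1" "t \<ge> 1" for s t
  proof -
    have "M / t \<ge> 0" "M / s \<ge> 0" using M that by auto
    then show ?thesis using up[of t s] dn[of s t] that by (cases "s \<le> t") auto
  qed
  define L where "L = (SUP t\<in>{1..}. f t - M / t)"
  have "f t - M / t \<le> L" if "t \<ge> 1" for t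
    unfolding L_def using that cross[of 1] by (intro cSUP_upper bdd_aboveI[of _ "f 1 + M / 1"]) auto
  moreover have "L \<le> f s + M / s" if "s \<ge> 1" for s
    unfolding L_def using cross[OF that] by (intro cSUP_least) auto
  ultimately show ?thesis by (intro exI[of _ L]) (auto simp: abs_le_iff algebra_simps)
qed

lemma abs_diff_sum3_le:
  "\<bar>x\<bar> \<le> 1 \<Longrightarrow> \<bar>y\<bar> \<le> b \<Longrightarrow> \<bar>z\<bar> \<le> c \<Longrightarrow> \<bar>x - (a + - y + z)\<bar> \<le> 1 + \<bar>a\<bar> + b + c" for x y z a b c :: real
  by linarith

lemma abs_diff_add_le: "\<bar>x - y + z\<bar> \<le> \<bar>x\<bar> + \<bar>y\<bar> + \<bar>z\<bar>" for x y z :: real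
  by linarith

lemma le_double_sum_add: "u \<le> 2 * (x + y) \<Longrightarrow> 0 \<le> b \<Longrightarrow> u \<le> 2 * (x + b + y)" for u x y b :: real
  by simp

lemma le_sum_of_double_le: "u \<le> 2 * (x + y) \<Longrightarrow> 0 \<le> b \<Longrightarrow> 2 * v \<le> b + u \<Longrightarrow> v \<le> x + b + y" for u v x y b :: real
  by simp

text \<open>Variation of constants for \<open>h''' + h' = force\<close>. Boundedness of
  \<open>h\<close> and its derivatives is not known beforehand and comes from a Gronwall estimate;
  after it the force is \<open>O(1 / t\<^sup>2)\<close> and the three varied constants converge with
  rate \<open>1 / t\<close>.\<close>

lemma h0_asymptotic_form:
  assumes \<delta>: "\<delta> > 1"
  shows "\<exists>A P Q C. \<forall>t>0. \<bar>h0 \<delta> t - (A + P * cos t + Q * sin t)\<bar> \<le> C / t"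
proof -
  have pos: "\<delta> > 0" using \<delta> by simp
  define \<kappa> where "\<kappa> = \<delta> * (\<delta> - 1)"
  have \<kappa>: "\<kappa> > 0" using \<delta> by (simp add: \<kappa>_def)
  \<comment> \<open>The three first integrals of the unperturbed equation
    \<open>h''' + h' = 0\<close>. Along the perturbed one their derivatives are the force times 1,
    \<open>cos t\<close> and \<open>- sin t\<close>.\<close>
  define A where "A t = h0 \<delta> t + h2 \<delta> t" for t
  define p where "p t = h2 \<delta> t * cos t + h1 \<delta> t * sin t" for t
  define q where "q t = h1 \<delta> t * cos t - h2 \<delta> t * sin t" for t
  define f where "f = h_force \<delta>"
  have dA: "(A has_real_derivative f t) (at t)" if "t > 0" for t
    using DERIV_add[OF DERIV_h0[OF pos that] DERIV_h2[OF pos that]] by (simp add: A_def[abs_def] f_def)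
  have dp: "(p has_real_derivative f t * cos t) (at t)" if "t > 0" for t
    using DERIV_add[OF DERIV_mult[OF DERIV_h2[OF pos that] DERIV_cos] DERIV_mult[OF DERIV_h1[OF pos that] DERIV_sin]]
    by (simp add: p_def[abs_def] f_def algebra_simps)
  have dq: "(q has_real_derivative - (f t * sin t)) (at t)" if "t > 0" for t
    using DERIV_diff[OF DERIV_mult[OF DERIV_h1[OF pos that] DERIV_cos] DERIV_mult[OF DERIV_h2[OF pos that] DERIV_sin]]
    by (simp add: q_def[abs_def] f_def algebra_simps)
  have h2_eq: "h2 \<delta> t = p t * cos t - q t * sin t" for t
  proof -
    have "p t * cos t - q t * sin t = h2 \<delta> t * ((cos t)\<^sup>2 + (sin t)\<^sup>2)"
      unfolding p_def q_def by algebra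
    then show ?thesis by simp
  qed
  \<comment> \<open>Here \<open>h0\<close> is replaced by \<open>A - h2\<close>, so that the bound
    involves only quantities controlled by \<open>N\<close> below; for \<open>t \<ge> 1\<close> the
    weight \<open>1 / t ^ 3\<close> is absorbed by \<open>1 / t\<^sup>2\<close>.\<close>
  have f_bound: "\<bar>f t\<bar> \<le> \<kappa> * (3 * \<bar>h1 \<delta> t\<bar> + 2 * \<bar>\<delta> - 2\<bar> * (\<bar>A t\<bar> + \<bar>h2 \<delta> t\<bar>)) / t\<^sup>2" if "t \<ge> 1" for t
  proof -
    have t3: "t ^ 2 \<le> t ^ 3" using that by (intro power_increasing) auto
    have "\<bar>h0 \<delta> t\<bar> \<le> \<bar>A t\<bar> + \<bar>h2 \<delta> t\<bar>" by (simp add: A_def)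
    then have "\<bar>h0 \<delta> t\<bar> / t ^ 3 \<le> (\<bar>A t\<bar> + \<bar>h2 \<delta> t\<bar>) / t\<^sup>2"
      using that t3 by (intro frac_le) auto
    then have "2 * \<bar>\<delta> - 2\<bar> * (\<bar>h0 \<delta> t\<bar> / t ^ 3) \<le> 2 * \<bar>\<delta> - 2\<bar> * ((\<bar>A t\<bar> + \<bar>h2 \<delta> t\<bar>) / t\<^sup>2)"
      by (intro mult_left_mono) auto
    moreover have "\<bar>3 * h1 \<delta> t / t\<^sup>2 + 2 * (\<delta> - 2) * h0 \<delta> t / t ^ 3\<bar> \<le>
        3 * \<bar>h1 \<delta> t\<bar> / t\<^sup>2 + 2 * \<bar>\<delta> - 2\<bar> * (\<bar>h0 \<delta> t\<bar> / t ^ 3)"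
    proof -
      have "\<bar>3 * x / t\<^sup>2 + 2 * c * y / t ^ 3\<bar> \<le> 3 * \<bar>x\<bar> / t\<^sup>2 + 2 * \<bar>c\<bar> * (\<bar>y\<bar> / t ^ 3)" for x y c
        by (rule order_trans[OF abs_triangle_ineq]) (use that in \<open>simp add: abs_mult\<close>)
      then show ?thesis .
    qed
    moreover have "(3 * x + y * z) / t\<^sup>2 = 3 * x / t\<^sup>2 + y * (z / t\<^sup>2)" for x y z
      by (simp add: add_divide_distrib)
    ultimately have "\<bar>3 * h1 \<delta> t / t\<^sup>2 + 2 * (\<delta> - 2) * h0 \<delta> t / t ^ 3\<bar> \<le>
        (3 * \<bar>h1 \<delta> t\<bar> + 2 * \<bar>\<delta> - 2\<bar> * (\<bar>A t\<bar> + \<bar>h2 \<delta> t\<bar>)) / t\<^sup>2"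
      by (simp only:)
    then have "\<kappa> * \<bar>3 * h1 \<delta> t / t\<^sup>2 + 2 * (\<delta> - 2) * h0 \<delta> t / t ^ 3\<bar> \<le>
        \<kappa> * ((3 * \<bar>h1 \<delta> t\<bar> + 2 * \<bar>\<delta> - 2\<bar> * (\<bar>A t\<bar> + \<bar>h2 \<delta> t\<bar>)) / t\<^sup>2)"
      using \<kappa> by (intro mult_left_mono) auto
    moreover have "\<bar>f t\<bar> = \<kappa> * \<bar>3 * h1 \<delta> t / t\<^sup>2 + 2 * (\<delta> - 2) * h0 \<delta> t / t ^ 3\<bar>"
      unfolding f_def h_force_def \<kappa>_def[symmetric] using \<kappa> by (simp only: abs_mult abs_of_pos)
    ultimately show ?thesis by simp
  qed
  \<comment> \<open>The pair \<open>(p, q)\<close> comes from \<open>(h2, h1)\<close> by a rotation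
    and a reflection, so \<open>N\<close> is also the squared length of \<open>(A, h1, h2)\<close>;
    it changes only through the force.\<close>
  define N where "N t = (A t)\<^sup>2 + (p t)\<^sup>2 + (q t)\<^sup>2" for t
  have N_eq: "N t = (A t)\<^sup>2 + (h1 \<delta> t)\<^sup>2 + (h2 \<delta> t)\<^sup>2" for t
  proof -
    have "(p t)\<^sup>2 + (q t)\<^sup>2 = ((h1 \<delta> t)\<^sup>2 + (h2 \<delta> t)\<^sup>2) * ((cos t)\<^sup>2 + (sin t)\<^sup>2)"
      unfolding p_def q_def by algebra
    then show ?thesis by (simp add: N_def)
  qed
  have N0: "N t \<ge> 0" for t by (simp add: N_def)
  have dN: "(N has_real_derivative 2 * f t * (A t + h2 \<delta> t)) (at t)" if "t > 0" for t
    using DERIV_add[OF DERIV_add[OF DERIV_power[OF dA[OF that], of 2] DERIV_power[OF dp[OF that], of 2]] DERIV_power[OF dq[OF that], of 2]]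
    by (simp add: N_def[abs_def] h2_eq algebra_simps)
  \<comment> \<open>The term \<open>3\<close> comes from
    \<open>\<bar>h1\<bar> * (\<bar>A\<bar> + \<bar>h2\<bar>) \<le> N\<close>, the term
    \<open>4 * \<bar>\<delta> - 2\<bar>\<close> from
    \<open>(\<bar>A\<bar> + \<bar>h2\<bar>)\<^sup>2 \<le> 2 * N\<close>, and the outer 2 from
    differentiating squares.\<close>
  define K where "K = 2 * \<kappa> * (3 + 4 * \<bar>\<delta> - 2\<bar>)"
  have dN_bound: "2 * f t * (A t + h2 \<delta> t) \<le> K * N t / t\<^sup>2" if "t \<ge> 1" for t
  proof -
    let ?a = "\<bar>A t\<bar> + \<bar>h2 \<delta> t\<bar>"
    have a2': "?a * ?a \<le> 2 * ((A t)\<^sup>2 + (h2 \<delta> t)\<^sup>2)"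
      using zero_le_power2[of "\<bar>A t\<bar> - \<bar>h2 \<delta> t\<bar>"] by (simp add: power2_eq_square algebra_simps)
    have a2: "?a * ?a \<le> 2 * N t"
      unfolding N_eq by (rule le_double_sum_add[OF a2' zero_le_power2])
    have a1: "\<bar>h1 \<delta> t\<bar> * ?a \<le> N t"
    proof -
      have "2 * (\<bar>h1 \<delta> t\<bar> * ?a) \<le> (h1 \<delta> t)\<^sup>2 + ?a * ?a"
        using zero_le_power2[of "\<bar>h1 \<delta> t\<bar> - ?a"] by (simp add: power2_eq_square algebra_simps)
      then show ?thesis unfolding N_eq by (rule le_sum_of_double_le[OF a2' zero_le_power2])
    qed
    have "f t * (A t + h2 \<delta> t) \<le> \<bar>f t\<bar> * \<bar>A t + h2 \<delta> t\<bar>"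
      by (simp only: abs_mult[symmetric] abs_ge_self)
    also have "\<dots> \<le> \<bar>f t\<bar> * ?a"
      by (intro mult_left_mono abs_triangle_ineq abs_ge_zero)
    also have "\<dots> \<le> \<kappa> * (3 * \<bar>h1 \<delta> t\<bar> + 2 * \<bar>\<delta> - 2\<bar> * ?a) / t\<^sup>2 * ?a"
      by (intro mult_right_mono f_bound that) auto
    also have "\<dots> = \<kappa> * (3 * (\<bar>h1 \<delta> t\<bar> * ?a) + 2 * \<bar>\<delta> - 2\<bar> * (?a * ?a)) / t\<^sup>2"
    proof -
      have "\<kappa> * (3 * x + c * a) / t\<^sup>2 * a = \<kappa> * (3 * (x * a) + c * (a * a)) / t\<^sup>2" for x c a
        by (simp add: algebra_simps)
      then show ?thesis .
    qed
    also have "\<dots> \<le> \<kappa> * (3 * N t + 2 * \<bar>\<delta> - 2\<bar> * (2 * N t)) / t\<^sup>2"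
      using \<kappa> a1 a2 by (intro divide_right_mono mult_left_mono add_mono) auto
    finally have "2 * (f t * (A t + h2 \<delta> t)) \<le> 2 * (\<kappa> * (3 * N t + 2 * \<bar>\<delta> - 2\<bar> * (2 * N t)) / t\<^sup>2)"
      by (intro mult_left_mono) auto
    moreover have "K * N t / t\<^sup>2 = 2 * (\<kappa> * (3 * N t + 2 * \<bar>\<delta> - 2\<bar> * (2 * N t)) / t\<^sup>2)"
    proof -
      have "2 * \<kappa> * (3 + 4 * c) * n / t\<^sup>2 = 2 * (\<kappa> * (3 * n + 2 * c * (2 * n)) / t\<^sup>2)" for c n
        by (simp add: algebra_simps)
      then show ?thesis unfolding K_def .
    qed
    ultimately show ?thesis by (simp only: mult.assoc)
  qed
  have N_bound: "N t \<le> N 1 * exp K" if "t \<ge> 1" for t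
  proof -
    have K: "K \<ge> 0" using \<kappa> by (simp add: K_def)
    \<comment> \<open>Gronwall with the integrating factor \<open>exp (K / t)\<close>: its
      logarithmic derivative \<open>- K / t\<^sup>2\<close> offsets the growth bound for
      \<open>N\<close>, and it stays between 1 and \<open>exp K\<close> for
      \<open>t \<ge> 1\<close>.\<close>
    have "N t * exp (K / t) \<le> N 1 * exp (K / 1)"
    proof (rule DERIV_nonpos_imp_nonincreasing[OF that])
      fix x :: real assume x: "1 \<le> x" "x \<le> t"
      have "((\<lambda>t. exp (K / t)) has_real_derivative - (exp (K / x) * (K / x\<^sup>2))) (at x)"
        using x by (auto intro!: derivative_eq_intros simp: power2_eq_square)
      then have "((\<lambda>t. N t * exp (K / t)) has_real_derivative
          2 * f x * (A x + h2 \<delta> x) * exp (K / x) + - (exp (K / x) * (K / x\<^sup>2)) * N x) (at x)"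
        using x by (intro DERIV_mult dN) auto
      moreover have "2 * f x * (A x + h2 \<delta> x) * exp (K / x) + - (exp (K / x) * (K / x\<^sup>2)) * N x \<le> 0"
      proof -
        have "2 * f x * (A x + h2 \<delta> x) * exp (K / x) \<le> K * N x / x\<^sup>2 * exp (K / x)"
          using x by (intro mult_right_mono dN_bound) auto
        also have "\<dots> = exp (K / x) * (K / x\<^sup>2) * N x" by simp
        finally show ?thesis by simp
      qed
      ultimately show "\<exists>y. ((\<lambda>t. N t * exp (K / t)) has_real_derivative y) (at x) \<and> y \<le> 0"
        by blast
    qed
    moreover have "N t * 1 \<le> N t * exp (K / t)"
      using N0[of t] K that by (intro mult_left_mono) auto
    ultimately show ?thesis by simp
  qed
  define B where "B = sqrt (N 1 * exp K)"
  have comp: "\<bar>A t\<bar> \<le> B" "\<bar>h1 \<delta> t\<bar> \<le> B" "\<bar>h2 \<delta> t\<bar> \<le> B" if "t \<ge> 1" for t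
  proof -
    have "\<bar>x\<bar> \<le> B" if "x\<^sup>2 \<le> N t" for x
      unfolding B_def using order_trans[OF that N_bound[OF \<open>t \<ge> 1\<close>]] by (intro real_le_rsqrt) simp
    then show "\<bar>A t\<bar> \<le> B" "\<bar>h1 \<delta> t\<bar> \<le> B" "\<bar>h2 \<delta> t\<bar> \<le> B" by (simp_all add: N_eq)
  qed
  define M where "M = \<kappa> * (3 * B + 2 * \<bar>\<delta> - 2\<bar> * (B + B))"
  have fM: "\<bar>f t\<bar> \<le> M / t\<^sup>2" if "t \<ge> 1" for t
    unfolding M_def using \<kappa> comp[OF that]
    by (intro order_trans[OF f_bound[OF that]] divide_right_mono mult_left_mono add_mono) simp_all
  have trig: "\<bar>f t * c\<bar> \<le> M / t\<^sup>2" if "t \<ge> 1" "\<bar>c\<bar> \<le> 1" for t c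
    using fM[OF that(1)] mult_left_le[OF that(2), of "\<bar>f t\<bar>"] by (simp add: abs_mult)
  obtain A0 where A0: "\<And>t. t \<ge> 1 \<Longrightarrow> \<bar>A t - A0\<bar> \<le> M / t"
    using bounded_inverse_square_derivative_limit[of A f M] dA fM by auto
  obtain P where P: "\<And>t. t \<ge> 1 \<Longrightarrow> \<bar>p t - P\<bar> \<le> M / t"
    using bounded_inverse_square_derivative_limit[of p "\<lambda>t. f t * cos t" M] dp trig by auto
  obtain Q where Q: "\<And>t. t \<ge> 1 \<Longrightarrow> \<bar>q t - Q\<bar> \<le> M / t"
    using bounded_inverse_square_derivative_limit[of q "\<lambda>t. - (f t * sin t)" M] dq trig by auto
  \<comment> \<open>The first entry adds up the three rates for \<open>t \<ge> 1\<close>. The second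
    is a crude bound for \<open>t < 1\<close>, where \<open>\<bar>h0\<bar> \<le> 1\<close> and
    \<open>C \<le> C / t\<close>. A bound on all of \<open>t > 0\<close> is wanted because it is
    integrated against a Laplace kernel later. The coefficient of the cosine is \<open>- P\<close>,
    since \<open>h0 = A - h2\<close> and \<open>h2 = p cos - q sin\<close>.\<close>
  define C where "C = max (3 * M) (1 + \<bar>A0\<bar> + \<bar>P\<bar> + \<bar>Q\<bar>)"
  have "\<bar>h0 \<delta> t - (A0 + - P * cos t + Q * sin t)\<bar> \<le> C / t" if t: "t > 0" for t
  proof (cases "t \<ge> 1")
    case True
    have "h0 \<delta> t - (A0 + - P * cos t + Q * sin t) = (A t - A0) - (p t - P) * cos t + (q t - Q) * sin t"
      using h2_eq[of t] by (simp add: A_def algebra_simps)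
    also have "\<bar>\<dots>\<bar> \<le> \<bar>A t - A0\<bar> + \<bar>(p t - P) * cos t\<bar> + \<bar>(q t - Q) * sin t\<bar>"
      by (rule abs_diff_add_le)
    also have "\<dots> \<le> M / t + M / t + M / t"
      using A0[OF True] P[OF True] Q[OF True] mult_left_le[OF abs_cos_le_one[of t], of "\<bar>p t - P\<bar>"]
        mult_left_le[OF abs_sin_le_one[of t], of "\<bar>q t - Q\<bar>"]
      by (intro add_mono) (auto simp: abs_mult)
    also have "\<dots> = 3 * M / t" by simp
    also have "\<dots> \<le> C / t" using t by (intro divide_right_mono) (auto simp: C_def)
    finally show ?thesis .
  next
    case False
    have "\<bar>W \<delta> t\<bar> \<le> 1" using W_pos[OF \<delta>, of t] W_le_1[OF pos, of t] t by simp
    moreover have "t powr (2 * \<delta>) \<le> 1 powr (2 * \<delta>)" using t False pos by (intro powr_mono2) auto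
    ultimately have "\<bar>h0 \<delta> t\<bar> \<le> 1" unfolding h0_def abs_mult by (intro mult_le_one) auto
    moreover have "\<bar>P * cos t\<bar> \<le> \<bar>P\<bar>" "\<bar>Q * sin t\<bar> \<le> \<bar>Q\<bar>"
      using mult_left_le[OF abs_cos_le_one[of t], of "\<bar>P\<bar>"] mult_left_le[OF abs_sin_le_one[of t], of "\<bar>Q\<bar>"]
      by (auto simp: abs_mult)
    ultimately have "\<bar>h0 \<delta> t - (A0 + - (P * cos t) + Q * sin t)\<bar> \<le> 1 + \<bar>A0\<bar> + \<bar>P\<bar> + \<bar>Q\<bar>"
      by (rule abs_diff_sum3_le)
    then have "\<bar>h0 \<delta> t - (A0 + - P * cos t + Q * sin t)\<bar> \<le> C"
      unfolding mult_minus_left C_def by (rule order_trans[OF _ max.cobounded2])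
    also have "C \<le> C / t"
    proof -
      have "C \<ge> 0" by (simp add: C_def)
      then show ?thesis using t False by (simp add: field_simps mult_left_le)
    qed
    finally show ?thesis .
  qed
  then show ?thesis by blast
qed

section \<open>Laplace transforms\<close>

definition laplace :: "(real \<Rightarrow> real) \<Rightarrow> complex \<Rightarrow> complex" where
  "laplace \<phi> z = (\<integral>t. exp (- z * of_real t) * of_real (\<phi> t) \<partial>lborel)"

text \<open>Exactly what makes the transform converge absolutely on the open right half-plane.
  Growth up to every subexponential order is allowed, and the support condition makes it a one-sided
  transform.\<close>

definition laplace_admissible :: "(real \<Rightarrow> real) \<Rightarrow> bool" where
  "laplace_admissible \<phi> \<longleftrightarrow> (\<forall>t<0. \<phi> t = 0) \<and> \<phi> \<in> borel_measurable borel \<and>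
     (\<forall>\<sigma>>0. integrable lborel (\<lambda>t. \<phi> t * exp (- (\<sigma> * t))))"

lemma laplace_integrable:
  assumes "laplace_admissible \<phi>" "Re z > 0"
  shows "integrable lborel (\<lambda>t. exp (- z * of_real t) * of_real (\<phi> t))"
proof (rule Bochner_Integration.integrable_bound)
  show "integrable lborel (\<lambda>t. \<phi> t * exp (- (Re z * t)))"
    using assms by (simp add: laplace_admissible_def)
  have [measurable]: "\<phi> \<in> borel_measurable borel" using assms by (simp add: laplace_admissible_def)
  show "(\<lambda>t. exp (- z * of_real t) * of_real (\<phi> t)) \<in> borel_measurable lborel"
    by measurable
  show "AE t in lborel. norm (exp (- z * of_real t) * of_real (\<phi> t)) \<le> norm (\<phi> t * exp (- (Re z * t)))"
    by (intro always_eventually allI) (simp add: norm_mult abs_mult)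
qed

text \<open>The exponential is expanded about a real centre \<open>R\<close>. For
  \<open>\<bar>z - R\<bar> < R\<close> the series of absolute values sums to
  \<open>\<bar>\<phi> t\<bar> * exp (- ((R - \<bar>z - R\<bar>) * t))\<close>, which still decays,
  so sum and integral may be exchanged. The coefficients do not depend on \<open>z\<close>, and
  holomorphy follows at once.\<close>

lemma laplace_sums:
  assumes adm: "laplace_admissible \<phi>" and R: "R > 0" and z: "z \<in> ball (of_real R) R"
  shows "(\<lambda>n. (\<integral>t. of_real ((-t) ^ n / fact n * exp (- (R * t)) * \<phi> t) \<partial>lborel) * (z - of_real R) ^ n) sums laplace \<phi> z"
proof -
  have [measurable]: "\<phi> \<in> borel_measurable borel" and supp: "\<And>t. t < 0 \<Longrightarrow> \<phi> t = 0"
    using adm by (auto simp: laplace_admissible_def)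
  let ?w = "z - of_real R"
  have w: "cmod ?w < R" using z by (simp add: dist_norm norm_minus_commute)
  let ?f = "\<lambda>n t. of_real ((-t) ^ n / fact n * exp (- (R * t)) * \<phi> t) * ?w ^ n"
  let ?g = "\<lambda>n t. (t * cmod ?w) ^ n / fact n * (exp (- (R * t)) * \<bar>\<phi> t\<bar>)"
  have norm_f: "cmod (?f n t) = ?g n t" for n t
  proof (cases "t \<ge> 0")
    case True
    then show ?thesis
      by (simp add: norm_mult norm_power norm_divide power_mult_distrib abs_mult)
  qed (simp add: supp)
  have g_sums: "(\<lambda>n. ?g n t) sums (\<bar>\<phi> t\<bar> * exp (- ((R - cmod ?w) * t)))" for t
  proof -
    have "(\<lambda>n. (t * cmod ?w) ^ n /\<^sub>R fact n * (exp (- (R * t)) * \<bar>\<phi> t\<bar>)) sums (exp (t * cmod ?w) * (exp (- (R * t)) * \<bar>\<phi> t\<bar>))"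
      by (intro sums_mult2 exp_converges)
    moreover have "exp (t * cmod ?w) * exp (- (R * t)) = exp (- ((R - cmod ?w) * t))"
      unfolding exp_add[symmetric] by (simp add: algebra_simps)
    then have "exp (t * cmod ?w) * (exp (- (R * t)) * \<bar>\<phi> t\<bar>) = \<bar>\<phi> t\<bar> * exp (- ((R - cmod ?w) * t))"
      by (simp only: mult.assoc[symmetric]) (simp only: mult.commute)
    moreover have "(t * cmod ?w) ^ n /\<^sub>R fact n * (exp (- (R * t)) * \<bar>\<phi> t\<bar>) = ?g n t" for n
      by (simp add: divide_inverse)
    ultimately show ?thesis by (simp only:)
  qed
  have g_nonneg: "?g n t \<ge> 0" for n t
    unfolding norm_f[symmetric] by (rule norm_ge_zero)
  have g_partial: "(\<Sum>n\<in>F. ?g n t) \<le> \<bar>\<phi> t\<bar> * exp (- ((R - cmod ?w) * t))" if "finite F" for F t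
  proof -
    have "(\<Sum>n\<in>F. ?g n t) \<le> (\<Sum>n. ?g n t)"
      by (rule sum_le_suminf[OF sums_summable[OF g_sums] that g_nonneg])
    also have "\<dots> = \<bar>\<phi> t\<bar> * exp (- ((R - cmod ?w) * t))"
      by (rule sums_unique[symmetric, OF g_sums])
    finally show ?thesis .
  qed
  have int_total: "integrable lborel (\<lambda>t. \<bar>\<phi> t\<bar> * exp (- ((R - cmod ?w) * t)))"
  proof -
    have "integrable lborel (\<lambda>t. \<bar>\<phi> t * exp (- ((R - cmod ?w) * t))\<bar>)"
      using adm w by (intro Bochner_Integration.integrable_abs) (simp add: laplace_admissible_def)
    then show ?thesis by (simp add: abs_mult)
  qed
  have int_g: "integrable lborel (?g n)" for n
  proof (rule Bochner_Integration.integrable_bound[OF int_total])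
    show "?g n \<in> borel_measurable lborel" by measurable
    have "?g n t \<le> \<bar>\<phi> t\<bar> * exp (- ((R - cmod ?w) * t))" for t
      using g_partial[of "{n}" t] by simp
    then show "AE t in lborel. norm (?g n t) \<le> norm (\<bar>\<phi> t\<bar> * exp (- ((R - cmod ?w) * t)))"
      unfolding real_norm_def abs_of_nonneg[OF g_nonneg]
      by (intro always_eventually allI) (rule order_trans[OF _ abs_ge_self])
  qed
  have int_f: "integrable lborel (?f n)" for n
    by (rule Bochner_Integration.integrable_bound[OF int_g[of n]])
      (measurable, intro always_eventually allI, simp only: norm_f real_norm_def abs_of_nonneg[OF g_nonneg] order_refl)
  have summ: "summable (\<lambda>n. \<integral>t. cmod (?f n t) \<partial>lborel)"
    unfolding norm_f
  proof (rule bounded_imp_summable)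
    fix n show "0 \<le> (\<integral>t. ?g n t \<partial>lborel)" by (intro Bochner_Integration.integral_nonneg g_nonneg)
    fix m
    have "(\<Sum>n\<le>m. \<integral>t. ?g n t \<partial>lborel) = (\<integral>t. (\<Sum>n\<le>m. ?g n t) \<partial>lborel)"
      by (rule Bochner_Integration.integral_sum[symmetric]) (rule int_g)
    also have "\<dots> \<le> (\<integral>t. \<bar>\<phi> t\<bar> * exp (- ((R - cmod ?w) * t)) \<partial>lborel)"
    proof (rule integral_mono[OF _ int_total])
      show "integrable lborel (\<lambda>t. \<Sum>n\<le>m. ?g n t)" by (intro Bochner_Integration.integrable_sum int_g)
      show "(\<Sum>n\<le>m. ?g n t) \<le> \<bar>\<phi> t\<bar> * exp (- ((R - cmod ?w) * t))" for t
        by (rule g_partial) simp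
    qed
    finally show "(\<Sum>n\<le>m. \<integral>t. ?g n t \<partial>lborel) \<le> (\<integral>t. \<bar>\<phi> t\<bar> * exp (- ((R - cmod ?w) * t)) \<partial>lborel)" .
  qed
  have f_sum: "(\<Sum>n. ?f n t) = exp (- z * of_real t) * of_real (\<phi> t)" for t
  proof -
    have "(\<lambda>n. (- (of_real t * ?w)) ^ n /\<^sub>R fact n * of_real (exp (- (R * t)) * \<phi> t)) sums
        (exp (- (of_real t * ?w)) * of_real (exp (- (R * t)) * \<phi> t))"
      by (intro sums_mult2 exp_converges)
    moreover have "(- (of_real t * ?w)) ^ n /\<^sub>R fact n * of_real (exp (- (R * t)) * \<phi> t) = ?f n t" for n
    proof -
      have "(- (of_real t * ?w)) ^ n = of_real ((- t) ^ n) * ?w ^ n"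
        by (simp only: of_real_power of_real_minus power_mult_distrib[symmetric] mult_minus_left)
      then show ?thesis by (simp add: scaleR_conv_of_real divide_inverse mult_ac)
    qed
    moreover have "exp (- (of_real t * ?w)) * of_real (exp (- (R * t)) * \<phi> t) = exp (- z * of_real t) * of_real (\<phi> t)"
    proof -
      have "exp (- (of_real t * ?w)) * of_real (exp (- (R * t))) = exp (- z * of_real t)"
        by (simp add: exp_of_real[symmetric] exp_add[symmetric] algebra_simps)
      then show ?thesis by (simp add: mult.assoc[symmetric])
    qed
    ultimately show ?thesis by (simp only: sums_unique[symmetric])
  qed
  have "(\<lambda>n. integral\<^sup>L lborel (?f n)) sums (\<integral>t. (\<Sum>n. ?f n t) \<partial>lborel)"
  proof (rule sums_integral[OF int_f _ summ])
    show "AE t in lborel. summable (\<lambda>n. norm (?f n t))"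
      unfolding norm_f using g_sums by (intro always_eventually allI sums_summable)
  qed
  then show ?thesis unfolding f_sum laplace_def by simp
qed

lemma holomorphic_laplace:
  assumes "laplace_admissible \<phi>" "R > 0"
  shows "laplace \<phi> holomorphic_on ball (of_real R) R"
  by (rule power_series_holomorphic) (rule laplace_sums[OF assms])

text \<open>Identity theorem on one large disc. The discs with centre \<open>R\<close> and radius
  \<open>R\<close> exhaust the open right half-plane, and agreement on a real interval beyond
  \<open>s0\<close> suffices. A closed form is thus needed only for large real arguments, where
  series converge.\<close>

lemma laplace_eqI:
  assumes adm: "laplace_admissible \<phi>" and g: "g holomorphic_on {z. Re z > 0}"
    and eq: "\<And>s. s > s0 \<Longrightarrow> laplace \<phi> (of_real s) = g (of_real s)" and z: "Re z > 0"
  shows "laplace \<phi> z = g z"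
proof -
  \<comment> \<open>The inequality \<open>\<bar>z - R\<bar> < R\<close> is equivalent to
    \<open>\<bar>z\<bar>\<^sup>2 < 2 * R * Re z\<close>, whence the quotient; \<open>s0\<close>
    keeps the interval from \<open>R\<close> to \<open>2 * R\<close> inside the range of the
    hypothesis.\<close>
  define R where "R = max (max s0 1) ((cmod z)\<^sup>2 / (2 * Re z) + 1)"
  have R: "R > 0" "R \<ge> s0" "(cmod z)\<^sup>2 / (2 * Re z) < R" by (auto simp: R_def max_def)
  have zR: "z \<in> ball (of_real R) R"
  proof -
    have "(cmod (z - of_real R))\<^sup>2 = (cmod z)\<^sup>2 - 2 * R * Re z + R\<^sup>2"
      unfolding cmod_power2 by (simp add: power2_eq_square algebra_simps)
    also have "\<dots> < R\<^sup>2" using R(3) z by (simp add: field_simps)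
    finally have "cmod (z - of_real R) < R" using R(1) by (simp add: power_less_imp_less_base)
    then show ?thesis by (simp add: dist_norm norm_minus_commute)
  qed
  have sub: "ball (of_real R) R \<subseteq> {z. Re z > 0}"
  proof
    fix w assume "w \<in> ball (complex_of_real R) R"
    then have "cmod (of_real R - w) < R" by (simp add: dist_norm)
    then have "\<bar>Re (of_real R - w)\<bar> < R" using abs_Re_le_cmod[of "of_real R - w"] by linarith
    then show "w \<in> {z. Re z > 0}" by (auto simp: abs_less_iff)
  qed
  let ?U = "complex_of_real ` {R<..<2 * R}"
  have "laplace \<phi> z - g z = 0"
  proof (rule analytic_continuation[of "\<lambda>z. laplace \<phi> z - g z" "ball (of_real R) R" ?U "of_real R"])
    show "(\<lambda>z. laplace \<phi> z - g z) holomorphic_on ball (of_real R) R"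
      by (intro holomorphic_intros holomorphic_laplace adm R holomorphic_on_subset[OF g sub])
    show "?U \<subseteq> ball (of_real R) R"
      by (auto simp: dist_norm simp flip: of_real_diff)
    show "complex_of_real R islimpt ?U"
      unfolding islimpt_approachable
    proof (intro allI impI)
      fix e :: real assume e: "e > 0"
      let ?x = "R + min (e / 2) (R / 2)"
      have "of_real ?x \<in> ?U" using e R(1) by (intro imageI) (auto simp: min_def)
      moreover have "complex_of_real ?x \<noteq> of_real R" using e R(1) unfolding of_real_eq_iff by (simp add: min_def)
      moreover have "dist (complex_of_real ?x) (of_real R) < e"
        using e R(1) by (simp add: dist_norm min_def del: of_real_add flip: of_real_diff)
      ultimately show "\<exists>x'\<in>?U. x' \<noteq> of_real R \<and> dist x' (of_real R) < e" by blast
    qed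
    show "laplace \<phi> w - g w = 0" if "w \<in> ?U" for w
      using that eq R(2) by auto
  qed (use R zR in auto)
  then show ?thesis by simp
qed

definition power_density :: "real \<Rightarrow> real \<Rightarrow> real" where
  "power_density a t = indicator {0..} t * t powr (a - 1)"

lemma power_density_admissible:
  assumes "a > 0"
  shows "laplace_admissible (power_density a)"
proof -
  have "integrable lborel (\<lambda>t. power_density a t * exp (- (\<sigma> * t)))" if "\<sigma> > 0" for \<sigma>
    using has_bochner_integral_gamma_laplace[OF assms that]
    by (simp add: has_bochner_integral_iff power_density_def mult.assoc)
  then show ?thesis
    by (simp add: laplace_admissible_def power_density_def[abs_def])
qed

lemma laplace_of_real:
  assumes "has_bochner_integral lborel (\<lambda>t. \<phi> t * exp (- (s * t))) v"
  shows "laplace \<phi> (of_real s) = of_real v"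
proof -
  have "laplace \<phi> (of_real s) = (\<integral>t. complex_of_real (\<phi> t * exp (- (s * t))) \<partial>lborel)"
    unfolding laplace_def by (intro Bochner_Integration.integral_cong refl)
      (simp add: exp_of_real[symmetric] mult.commute)
  also have "\<dots> = of_real v"
    by (rule has_bochner_integral_integral_eq) (rule has_bochner_integral_of_real[OF assms])
  finally show ?thesis .
qed

lemma laplace_power_density:
  assumes "a > 0" "Re z > 0"
  shows "laplace (power_density a) z = of_real (Gamma a) * z powr (of_real (- a))"
proof (rule laplace_eqI[OF power_density_admissible[OF assms(1)] _ _ assms(2), of _ 0])
  show "(\<lambda>z. complex_of_real (Gamma a) * z powr of_real (- a)) holomorphic_on {z. Re z > 0}"
    by (intro holomorphic_intros) (auto simp: complex_nonpos_Reals_iff)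
  fix s :: real assume s: "s > 0"
  have "has_bochner_integral lborel (\<lambda>t. power_density a t * exp (- (s * t))) (Gamma a / s powr a)"
    using has_bochner_integral_gamma_laplace[OF assms(1) s] by (simp add: power_density_def mult.assoc)
  then have "laplace (power_density a) (of_real s) = of_real (Gamma a / s powr a)" by (rule laplace_of_real)
  also have "\<dots> = of_real (Gamma a) * of_real s powr (of_real (- a))"
    using s by (simp add: powr_of_real powr_minus divide_inverse del: of_real_minus)
  finally show "laplace (power_density a) (of_real s) = of_real (Gamma a) * of_real s powr (of_real (- a))" .
qed

text \<open>The exponent \<open>3 * \<delta> - 1\<close> is the one for which the Laplace moments
  contain \<open>pochhammer (3 * \<delta>) (2 * k)\<close>, the denominator of
  \<open>W_coeff\<close>. In terms of \<open>h0\<close> the density is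
  \<open>t powr (\<delta> - 1) * h0 \<delta> t\<close>, so a constant term of \<open>h0\<close>
  shows up as a singularity of order \<delta> at 0.\<close>

definition W_density :: "real \<Rightarrow> real \<Rightarrow> real" where
  "W_density \<delta> t = indicator {0..} t * (t powr (3 * \<delta> - 1) * W \<delta> t)"

lemma W_density_eq: "W_density \<delta> t = power_density \<delta> t * h0 \<delta> t"
  by (simp add: W_density_def power_density_def h0_def powr_add[symmetric] flip: mult.assoc)

lemma borel_measurable_W [measurable]: "\<delta> > 0 \<Longrightarrow> W \<delta> \<in> borel_measurable borel"
  by (intro borel_measurable_continuous_onI continuous_on_W)

lemma W_density_admissible:
  assumes "\<delta> > 1"
  shows "laplace_admissible (W_density \<delta>)"
proof -
  have pos: "\<delta> > 0" using assms by simp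
  note [measurable] = borel_measurable_W[OF pos]
  have "integrable lborel (\<lambda>t. W_density \<delta> t * exp (- (\<sigma> * t)))" if "\<sigma> > 0" for \<sigma>
  proof (rule Bochner_Integration.integrable_bound)
    show "integrable lborel (\<lambda>t. power_density (3 * \<delta>) t * exp (- (\<sigma> * t)))"
      using power_density_admissible[of "3 * \<delta>"] pos that by (simp add: laplace_admissible_def)
    show "(\<lambda>t. W_density \<delta> t * exp (- (\<sigma> * t))) \<in> borel_measurable lborel"
      unfolding W_density_def by measurable
    have "\<bar>W_density \<delta> t\<bar> \<le> \<bar>power_density (3 * \<delta>) t\<bar>" for t
      using W_pos[OF assms, of t] W_le_1[OF pos, of t]
      by (auto simp: W_density_def power_density_def indicator_def abs_mult mult_left_le)
    then show "AE t in lborel. norm (W_density \<delta> t * exp (- (\<sigma> * t))) \<le> norm (power_density (3 * \<delta>) t * exp (- (\<sigma> * t)))"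
      by (intro always_eventually allI) (simp add: abs_mult)
  qed
  moreover have "W_density \<delta> \<in> borel_measurable borel"
    unfolding W_density_def[abs_def] by measurable
  ultimately show ?thesis by (simp add: laplace_admissible_def W_density_def)
qed

text \<open>After cancellation of the Gamma moments the series is the binomial series of
  \<open>(1 + 1 / s\<^sup>2) powr (- \<delta>)\<close>, which converges for
  \<open>s > 1\<close>.\<close>

lemma laplace_W_density_real:
  assumes "\<delta> > 0" "s > 1"
  shows "has_bochner_integral lborel (\<lambda>t. W_density \<delta> t * exp (- (s * t)))
    (Gamma (3 * \<delta>) * s powr (- \<delta>) * (s\<^sup>2 + 1) powr (- \<delta>))"
proof -
  let ?m = "\<lambda>k. Gamma (3 * \<delta> + real (2 * k)) / s powr (3 * \<delta> + real (2 * k))"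
  let ?g = "\<lambda>t. indicator {0..} t * (t powr (3 * \<delta> - 1) * exp (- (s * t)))"
  have m: "has_bochner_integral lborel (\<lambda>t. t ^ (2 * k) * ?g t) (?m k)" for k
  proof -
    have "t ^ (2 * k) * ?g t = indicator {0..} t * (t powr (3 * \<delta> + real (2 * k) - 1) * exp (- (s * t)))" for t
    proof (cases "t > 0")
      case True
      have "t powr (3 * \<delta> + real (2 * k) - 1) = t powr real (2 * k) * t powr (3 * \<delta> - 1)"
        by (simp add: powr_add[symmetric] algebra_simps)
      also have "t powr real (2 * k) = t ^ (2 * k)" using True by (simp add: powr_realpow del: of_nat_mult)
      finally show ?thesis by simp
    qed (auto simp: indicator_def)
    then show ?thesis
      using has_bochner_integral_gamma_laplace[of "3 * \<delta> + real (2 * k)" s] assms by (simp only:)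
  qed
  have z: "3 * \<delta> \<notin> \<int>\<^sub>\<le>\<^sub>0" using assms by (auto elim!: nonpos_Ints_cases)
  have G: "Gamma (3 * \<delta>) > 0" using assms by (intro Gamma_real_pos) auto
  have m_eq: "?m k = Gamma (3 * \<delta>) * s powr (- (3 * \<delta>)) * (pochhammer (3 * \<delta>) (2 * k) * (1 / s\<^sup>2) ^ k)" for k
  proof -
    have "Gamma (3 * \<delta> + real (2 * k)) = pochhammer (3 * \<delta>) (2 * k) * Gamma (3 * \<delta>)"
      using pochhammer_Gamma[OF z, of "2 * k"] G by (simp add: field_simps)
    moreover have "s powr (3 * \<delta> + real (2 * k)) = s powr (3 * \<delta>) * (s\<^sup>2) ^ k"
      using assms by (simp add: powr_add powr_realpow power_mult del: of_nat_mult)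
    ultimately show ?thesis by (simp add: powr_minus power_one_over divide_inverse mult_ac power_inverse)
  qed
  let ?K = "Gamma (3 * \<delta>) * s powr (- (3 * \<delta>))"
  have p: "pochhammer (3 * \<delta>) (2 * k) > 0" "pochhammer \<delta> k > 0" for k
    using assms by (auto intro!: pochhammer_pos)
  have coeff_term: "W_coeff \<delta> k * ?m k = ?K * (((- \<delta>) gchoose k) * (1 / s\<^sup>2) ^ k)" for k
    unfolding m_eq W_coeff_def gbinomial_pochhammer using p(1)[of k] by simp
  \<comment> \<open>The numbers \<open>(-1) ^ k * ((- \<delta>) gchoose k)\<close> are positive, so
    taking absolute values only changes the sign of the argument of the binomial series.\<close>
  have abs_term: "\<bar>W_coeff \<delta> k\<bar> * ?m k = ?K * (((- \<delta>) gchoose k) * (- (1 / s\<^sup>2)) ^ k)" for k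
  proof -
    have "(- (1 / s\<^sup>2)) ^ k = (-1) ^ k * (1 / s\<^sup>2) ^ k" by (subst power_minus) simp
    moreover have "(-1) ^ k * (-1) ^ k = (1::real)" by (simp flip: power_mult_distrib)
    moreover have "\<bar>W_coeff \<delta> k\<bar> = pochhammer \<delta> k / (fact k * pochhammer (3 * \<delta>) (2 * k))"
      using p[of k] by (simp add: W_coeff_def abs_mult)
    ultimately show ?thesis unfolding m_eq gbinomial_pochhammer using p(1)[of k] by simp
  qed
  have s2: "\<bar>1 / s\<^sup>2\<bar> < 1" using assms by (simp add: one_less_power)
  have "summable (\<lambda>k. ((- \<delta>) gchoose k) * (- (1 / s\<^sup>2)) ^ k)"
    using gen_binomial_real[of "- (1 / s\<^sup>2)" "- \<delta>"] s2 by (intro sums_summable) auto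
  then have sum: "summable (\<lambda>k. \<bar>W_coeff \<delta> k\<bar> * ?m k)" unfolding abs_term by (rule summable_mult)
  have g0: "0 \<le> ?g t" for t by simp
  have "(\<lambda>k. W_coeff \<delta> k * ?m k) sums (?K * (1 + 1 / s\<^sup>2) powr (- \<delta>))"
    unfolding coeff_term using gen_binomial_real[OF s2, of "- \<delta>"] by (intro sums_mult)
  then have "(\<Sum>k. W_coeff \<delta> k * ?m k) = ?K * (1 + 1 / s\<^sup>2) powr (- \<delta>)" by (simp only: sums_unique[symmetric])
  moreover have "?K * (1 + 1 / s\<^sup>2) powr (- \<delta>) = Gamma (3 * \<delta>) * s powr (- \<delta>) * (s\<^sup>2 + 1) powr (- \<delta>)"
  proof -
    have "1 + 1 / s\<^sup>2 = (s\<^sup>2 + 1) / s\<^sup>2" using assms by (simp add: field_simps)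
    moreover have "(s\<^sup>2) powr (- \<delta>) = s powr (- (2 * \<delta>))"
      using assms powr_powr[of s 2 "- \<delta>"] by (simp add: powr_numeral)
    moreover have "s powr (- (3 * \<delta>)) = s powr (- \<delta>) * s powr (- (2 * \<delta>))" by (simp add: powr_add[symmetric])
    moreover have "s powr (- (2 * \<delta>)) > 0" using assms by simp
    ultimately show ?thesis using assms by (simp add: powr_divide)
  qed
  moreover have "even_series (W_coeff \<delta>) t * ?g t = W_density \<delta> t * exp (- (s * t))" for t
    by (simp add: W_density_def W_eq_even_series[OF assms(1)])
  ultimately show ?thesis
    using even_series_integral(1)[OF entire_W_coeff[OF assms(1)] g0 m sum] by (simp only:)
qed

text \<open>The product form gives each of the singularities 0, \<i> and -\<i> its own factor, whose
  principal branch is holomorphic for positive real part. At real \<open>s\<close> the last two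
  factors are conjugate, so their logarithms add up to the real number
  \<open>ln (s\<^sup>2 + 1)\<close>.\<close>

lemma laplace_W_density:
  assumes "\<delta> > 1" "Re z > 0"
  shows "laplace (W_density \<delta>) z = of_real (Gamma (3 * \<delta>)) *
    (z powr of_real (- \<delta>) * (z - \<i>) powr of_real (- \<delta>) * (z + \<i>) powr of_real (- \<delta>))"
proof (rule laplace_eqI[OF W_density_admissible[OF assms(1)] _ _ assms(2), of _ 1])
  show "(\<lambda>z. complex_of_real (Gamma (3 * \<delta>)) * (z powr of_real (- \<delta>) * (z - \<i>) powr of_real (- \<delta>) * (z + \<i>) powr of_real (- \<delta>)))
      holomorphic_on {z. Re z > 0}"
    by (intro holomorphic_intros) (auto simp: complex_nonpos_Reals_iff)
  fix s :: real assume s: "s > 1"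
  have "has_bochner_integral lborel (\<lambda>t. W_density \<delta> t * exp (- (s * t)))
      (Gamma (3 * \<delta>) * s powr (- \<delta>) * (s\<^sup>2 + 1) powr (- \<delta>))"
    using assms s by (intro laplace_W_density_real) auto
  then have "laplace (W_density \<delta>) (of_real s) = of_real (Gamma (3 * \<delta>) * s powr (- \<delta>) * (s\<^sup>2 + 1) powr (- \<delta>))"
    by (rule laplace_of_real)
  moreover have "(of_real s - \<i>) powr of_real (- \<delta>) * (of_real s + \<i>) powr of_real (- \<delta>) = of_real ((s\<^sup>2 + 1) powr (- \<delta>))"
  proof -
    let ?u = "of_real s + \<i>"
    have u: "of_real s - \<i> = cnj ?u" by (simp add: complex_eq_iff)
    have nz: "?u \<notin> \<real>\<^sub>\<le>\<^sub>0" "?u \<noteq> 0" using s by (auto simp: complex_nonpos_Reals_iff complex_eq_iff)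
    have "(cnj ?u) powr of_real (- \<delta>) * ?u powr of_real (- \<delta>) = exp (of_real (- \<delta>) * (Ln (cnj ?u) + Ln ?u))"
      using nz u complex_cnj_zero_iff[of ?u] by (simp add: powr_def exp_add[symmetric] distrib_left del: of_real_minus)
    also have "Ln (cnj ?u) + Ln ?u = of_real (ln (s\<^sup>2 + 1))"
    proof -
      have "Ln (cnj ?u) + Ln ?u = cnj (Ln ?u) + Ln ?u" by (simp only: cnj_Ln[OF nz(1)])
      also have "\<dots> = of_real (2 * Re (Ln ?u))" by (simp add: complex_eq_iff)
      also have "Re (Ln ?u) = ln (cmod ?u)" using nz(2) by simp
      also have "2 * ln (cmod ?u) = ln ((cmod ?u)\<^sup>2)" using nz(2) by (simp add: ln_realpow)
      also have "(cmod ?u)\<^sup>2 = s\<^sup>2 + 1" by (simp add: cmod_power2)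
      finally show ?thesis .
    qed
    also have "exp (of_real (- \<delta>) * complex_of_real (ln (s\<^sup>2 + 1))) = of_real ((s\<^sup>2 + 1) powr (- \<delta>))"
    proof -
      have "s\<^sup>2 + 1 \<noteq> 0" by (simp add: add_nonneg_eq_0_iff)
      then show ?thesis by (simp add: powr_def flip: exp_of_real)
    qed
    finally show ?thesis unfolding u .
  qed
  moreover have "complex_of_real s powr of_real (- \<delta>) = of_real (s powr (- \<delta>))"
    using s by (simp add: powr_of_real del: of_real_minus)
  ultimately show "laplace (W_density \<delta>) (of_real s) = of_real (Gamma (3 * \<delta>)) *
      (of_real s powr of_real (- \<delta>) * (of_real s - \<i>) powr of_real (- \<delta>) * (of_real s + \<i>) powr of_real (- \<delta>))"
    by (simp only: of_real_mult mult.assoc)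
qed

text \<open>Multiplication by \<open>cis t\<close> or \<open>cis (- t)\<close> shifts the transform
  by \<i> or -\<i>, and \<open>P cos t + Q sin t\<close> is the real part of
  \<open>(P - \<i> Q) cis t\<close>; hence the two halved coefficients. The error
  \<open>C / t\<close> lowers the power of the density by one, so its transform is of order
  \<open>1 - \<delta>\<close>, with \<open>Gamma (\<delta> - 1)\<close> finite because \<delta> >
  1.\<close>

lemma laplace_asymptotic_form_bound:
  assumes \<delta>: "\<delta> > 1" and z: "Re z > 0"
    and C: "\<And>t. t > 0 \<Longrightarrow> \<bar>h0 \<delta> t - (A + P * cos t + Q * sin t)\<bar> \<le> C / t"
  shows "cmod (laplace (W_density \<delta>) z - (of_real A * laplace (power_density \<delta>) z
     + Complex P (- Q) / 2 * laplace (power_density \<delta>) (z - \<i>)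
     + Complex P Q / 2 * laplace (power_density \<delta>) (z + \<i>))) \<le> C * Gamma (\<delta> - 1) * Re z powr (1 - \<delta>)"
proof -
  let ?e = "\<lambda>z t. exp (- z * of_real t) * complex_of_real (power_density \<delta> t)"
  have adm: "laplace_admissible (power_density \<delta>)" using \<delta> by (intro power_density_admissible) auto
  have i: "integrable lborel (?e z)" "integrable lborel (?e (z - \<i>))" "integrable lborel (?e (z + \<i>))"
    by (rule laplace_integrable[OF adm], use z in simp)+
  have iW: "integrable lborel (\<lambda>t. exp (- z * of_real t) * complex_of_real (W_density \<delta> t))"
    by (rule laplace_integrable[OF W_density_admissible[OF \<delta>] z])
  let ?r = "\<lambda>t. exp (- z * of_real t) * complex_of_real (W_density \<delta> t) -
      (of_real A * ?e z t + Complex P (- Q) / 2 * ?e (z - \<i>) t + Complex P Q / 2 * ?e (z + \<i>) t)"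
  have r: "laplace (W_density \<delta>) z - (of_real A * laplace (power_density \<delta>) z
     + Complex P (- Q) / 2 * laplace (power_density \<delta>) (z - \<i>)
     + Complex P Q / 2 * laplace (power_density \<delta>) (z + \<i>)) = (\<integral>t. ?r t \<partial>lborel)"
    unfolding laplace_def using i iW by simp
  have r_eq: "?r t = exp (- z * of_real t) * of_real (power_density \<delta> t * (h0 \<delta> t - (A + P * cos t + Q * sin t)))" for t
  proof -
    have e1: "exp (- (z - \<i>) * of_real t) = exp (- z * of_real t) * cis t"
      by (simp add: cis_conv_exp exp_add[symmetric] algebra_simps)
    have e2: "exp (- (z + \<i>) * of_real t) = exp (- z * of_real t) * cis (- t)"
      by (simp add: cis_conv_exp exp_add[symmetric] algebra_simps)
    have c: "Complex P (- Q) / 2 * cis t + Complex P Q / 2 * cis (- t) = of_real (P * cos t + Q * sin t)"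
      by (simp add: complex_eq_iff Re_divide_numeral Im_divide_numeral field_simps)
    have "?r t = exp (- z * of_real t) * of_real (power_density \<delta> t) * (of_real (h0 \<delta> t) -
        (of_real A + (Complex P (- Q) / 2 * cis t + Complex P Q / 2 * cis (- t))))"
      unfolding e1 e2 W_density_eq by (simp add: algebra_simps)
    then show ?thesis unfolding c by simp
  qed
  have "(\<integral>t. cmod (?r t) \<partial>lborel) \<le> C * (Gamma (\<delta> - 1) / Re z powr (\<delta> - 1))"
  proof -
    have hb: "has_bochner_integral lborel (\<lambda>t. C * (indicator {0..} t * (t powr (\<delta> - 1 - 1) * exp (- (Re z * t)))))
        (C * (Gamma (\<delta> - 1) / Re z powr (\<delta> - 1)))"
      using \<delta> z by (intro has_bochner_integral_mult_right has_bochner_integral_gamma_laplace) auto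
    have "cmod (?r t) \<le> C * (indicator {0..} t * (t powr (\<delta> - 1 - 1) * exp (- (Re z * t))))" for t
    proof (cases "t > 0")
      case True
      have "cmod (?r t) = exp (- (Re z * t)) * (t powr (\<delta> - 1) * \<bar>h0 \<delta> t - (A + P * cos t + Q * sin t)\<bar>)"
        unfolding r_eq using True by (simp add: norm_mult power_density_def abs_mult del: of_real_mult of_real_diff of_real_add)
      also have "\<dots> \<le> exp (- (Re z * t)) * (t powr (\<delta> - 1) * (C / t))"
        using True by (intro mult_left_mono C) auto
      also have "t powr (\<delta> - 1) = t powr (\<delta> - 1 - 1) * t"
        using True powr_add[of t "\<delta> - 1 - 1" 1] by simp
      finally show ?thesis using True by (simp add: mult_ac)
    next
      case False
      then have "power_density \<delta> t = 0" by (cases "t = 0") (auto simp: power_density_def)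
      then show ?thesis using False unfolding r_eq by (cases "t = 0") auto
    qed
    then have "(\<integral>t. cmod (?r t) \<partial>lborel) \<le> (\<integral>t. C * (indicator {0..} t * (t powr (\<delta> - 1 - 1) * exp (- (Re z * t)))) \<partial>lborel)"
      using hb i iW by (intro integral_mono) (auto simp: has_bochner_integral_iff simp del: norm_mult)
    then show ?thesis using hb by (simp add: has_bochner_integral_iff)
  qed
  moreover have "cmod (\<integral>t. ?r t \<partial>lborel) \<le> (\<integral>t. cmod (?r t) \<partial>lborel)" by (rule integral_norm_bound)
  moreover have "C * (Gamma (\<delta> - 1) / Re z powr (\<delta> - 1)) = C * Gamma (\<delta> - 1) * Re z powr (1 - \<delta>)"
    using powr_minus_divide[of "Re z" "\<delta> - 1"] by simp
  ultimately show ?thesis unfolding r by linarith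
qed

section \<open>The asymptotic constants\<close>

text \<open>Multiplying by \<open>\<sigma> powr \<delta>\<close> normalises the singular part: the
  error becomes \<open>O(\<sigma>)\<close>, the regular part \<open>G\<close> is damped to 0, and
  the limit \<open>L\<close> of the cofactor of the singularity must equal its coefficient
  \<open>K\<close>.\<close>

lemma abelian_limit_eq:
  fixes X F G :: "real \<Rightarrow> complex"
  assumes \<delta>: "\<delta> > 0"
    and eq: "\<And>\<sigma>. \<sigma> > 0 \<Longrightarrow> of_real (\<sigma> powr \<delta>) * X \<sigma> = F \<sigma> - K - of_real (\<sigma> powr \<delta>) * G \<sigma>"
    and X: "\<And>\<sigma>. \<sigma> > 0 \<Longrightarrow> cmod (X \<sigma>) \<le> D * \<sigma> powr (1 - \<delta>)"
    and F: "(F \<longlongrightarrow> L) (at_right 0)" and G: "(G \<longlongrightarrow> M) (at_right 0)"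
  shows "L = K"
proof -
  have pw: "((\<lambda>\<sigma>. \<sigma> powr \<delta>) \<longlongrightarrow> 0 powr \<delta>) (at_right (0::real))"
    using \<delta> by (intro tendsto_powr' tendsto_intros) (auto simp: eventually_at_filter)
  have c0: "((\<lambda>\<sigma>. complex_of_real (\<sigma> powr \<delta>)) \<longlongrightarrow> of_real 0) (at_right 0)"
    using tendsto_of_real[OF pw, where 'a = complex] by simp
  have "((\<lambda>\<sigma>. F \<sigma> - K - of_real (\<sigma> powr \<delta>) * G \<sigma>) \<longlongrightarrow> L - K - of_real 0 * M) (at_right 0)"
    by (intro tendsto_diff tendsto_mult tendsto_const F G c0)
  moreover have "((\<lambda>\<sigma>. F \<sigma> - K - of_real (\<sigma> powr \<delta>) * G \<sigma>) \<longlongrightarrow> 0) (at_right 0)"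
  proof (rule Lim_null_comparison)
    have "norm (F \<sigma> - K - of_real (\<sigma> powr \<delta>) * G \<sigma>) \<le> D * \<sigma>" if \<sigma>: "\<sigma> > 0" for \<sigma>
    proof -
      have "norm (F \<sigma> - K - of_real (\<sigma> powr \<delta>) * G \<sigma>) = \<sigma> powr \<delta> * cmod (X \<sigma>)"
        unfolding eq[OF \<sigma>, symmetric] by (simp add: norm_mult)
      also have "\<dots> \<le> \<sigma> powr \<delta> * (D * \<sigma> powr (1 - \<delta>))" by (intro mult_left_mono X \<sigma>) simp
      also have "\<dots> = D * (\<sigma> powr \<delta> * \<sigma> powr (1 - \<delta>))" by simp
      also have "\<sigma> powr \<delta> * \<sigma> powr (1 - \<delta>) = \<sigma>" using \<sigma> by (simp add: powr_add[symmetric])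
      finally show ?thesis .
    qed
    then show "\<forall>\<^sub>F \<sigma> in at_right 0. norm (F \<sigma> - K - of_real (\<sigma> powr \<delta>) * G \<sigma>) \<le> D * \<sigma>"
      by (auto simp: eventually_at_filter)
    show "((\<lambda>\<sigma>. D * \<sigma>) \<longlongrightarrow> 0) (at_right 0)"
      by (auto intro!: tendsto_eq_intros)
  qed
  ultimately show ?thesis
    using tendsto_unique[OF trivial_limit_at_right_real] by fastforce
qed

lemma tendsto_powr_at_right_0:
  fixes w a :: complex
  assumes "w \<notin> \<real>\<^sub>\<le>\<^sub>0"
  shows "((\<lambda>\<sigma>. (of_real \<sigma> + w) powr a) \<longlongrightarrow> w powr a) (at_right 0)"
proof -
  have "((\<lambda>\<sigma>. of_real \<sigma> + w) \<longlongrightarrow> of_real 0 + w) (at_right 0)" by (intro tendsto_intros)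
  then show ?thesis using assms by (intro tendsto_powr_complex tendsto_const) auto
qed

text \<open>Approaching 0 from the right isolates \<open>A\<close>, approaching \<i> isolates
  \<open>P - \<i> Q\<close>; in each case the terms belonging to the other two singularities stay
  bounded. Both \<open>P\<close> and \<open>Q\<close> are read off the one complex coefficient at
  \<i>.\<close>

lemma asymptotic_coefficients:
  assumes \<delta>: "\<delta> > 1"
    and C: "\<And>t. t > 0 \<Longrightarrow> \<bar>h0 \<delta> t - (A + P * cos t + Q * sin t)\<bar> \<le> C / t"
  shows "A = Gamma (3 * \<delta>) / Gamma \<delta>"
    and "P = Gamma (3 * \<delta>) / Gamma \<delta> / 2 powr (\<delta> - 1) * cos (\<delta> * pi)"
    and "Q = Gamma (3 * \<delta>) / Gamma \<delta> / 2 powr (\<delta> - 1) * sin (\<delta> * pi)"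
proof -
  let ?a = "complex_of_real (- \<delta>)" and ?k1 = "Complex P (- Q) / 2" and ?k2 = "Complex P Q / 2"
  let ?G = "complex_of_real (Gamma \<delta>)" and ?G3 = "complex_of_real (Gamma (3 * \<delta>))"
  have G: "Gamma \<delta> > 0" using \<delta> by (intro Gamma_real_pos) auto
  let ?X = "\<lambda>z. laplace (W_density \<delta>) z - (of_real A * laplace (power_density \<delta>) z
     + ?k1 * laplace (power_density \<delta>) (z - \<i>) + ?k2 * laplace (power_density \<delta>) (z + \<i>))"
  have X_eq: "?X z = ?G3 * (z powr ?a * (z - \<i>) powr ?a * (z + \<i>) powr ?a) -
      (of_real A * (?G * z powr ?a) + ?k1 * (?G * (z - \<i>) powr ?a) + ?k2 * (?G * (z + \<i>) powr ?a))"
    if "Re z > 0" for z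
    using laplace_W_density[OF \<delta> that] laplace_power_density[of \<delta> z] laplace_power_density[of \<delta> "z - \<i>"]
      laplace_power_density[of \<delta> "z + \<i>"] \<delta> that by simp
  have cancel: "of_real (\<sigma> powr \<delta>) * complex_of_real \<sigma> powr ?a = 1" if "\<sigma> > 0" for \<sigma>
  proof -
    have "complex_of_real \<sigma> powr ?a = of_real (\<sigma> powr (- \<delta>))" using that by (simp add: powr_of_real del: of_real_minus)
    then show ?thesis using that by (simp add: powr_minus flip: of_real_mult)
  qed
  have bound: "cmod (?X z) \<le> C * Gamma (\<delta> - 1) * Re z powr (1 - \<delta>)" if "Re z > 0" for z
    by (rule laplace_asymptotic_form_bound[OF \<delta> that C])
  have ni: "- \<i> \<notin> \<real>\<^sub>\<le>\<^sub>0" "\<i> \<notin> \<real>\<^sub>\<le>\<^sub>0" "2 * \<i> \<notin> \<real>\<^sub>\<le>\<^sub>0" by (auto simp: complex_nonpos_Reals_iff)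
  have "?G3 * ((- \<i>) powr ?a * \<i> powr ?a) = of_real A * ?G"
  proof (rule abelian_limit_eq)
    show "cmod (?X (of_real \<sigma>)) \<le> C * Gamma (\<delta> - 1) * \<sigma> powr (1 - \<delta>)" if "\<sigma> > 0" for \<sigma>
      using bound[of "of_real \<sigma>"] that by simp
    show "((\<lambda>\<sigma>. ?G3 * ((of_real \<sigma> + - \<i>) powr ?a * (of_real \<sigma> + \<i>) powr ?a)) \<longlongrightarrow>
        ?G3 * ((- \<i>) powr ?a * \<i> powr ?a)) (at_right 0)"
      by (intro tendsto_mult tendsto_const tendsto_powr_at_right_0 ni)
    show "((\<lambda>\<sigma>. ?k1 * (?G * (of_real \<sigma> + - \<i>) powr ?a) + ?k2 * (?G * (of_real \<sigma> + \<i>) powr ?a)) \<longlongrightarrow>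
        ?k1 * (?G * (- \<i>) powr ?a) + ?k2 * (?G * \<i> powr ?a)) (at_right 0)"
      by (intro tendsto_add tendsto_mult tendsto_const tendsto_powr_at_right_0 ni)
    fix \<sigma> :: real assume \<sigma>: "\<sigma> > 0"
    have "u * ?X (of_real \<sigma>) = ?G3 * (u * of_real \<sigma> powr ?a) * ((of_real \<sigma> + - \<i>) powr ?a * (of_real \<sigma> + \<i>) powr ?a) -
        of_real A * ?G * (u * of_real \<sigma> powr ?a) -
        u * (?k1 * (?G * (of_real \<sigma> + - \<i>) powr ?a) + ?k2 * (?G * (of_real \<sigma> + \<i>) powr ?a))" for u
    proof -
      have "u * (g3 * (x * y * v) - (a * (g * x) + k1 * (g * y) + k2 * (g * v))) =
          g3 * (u * x) * (y * v) - a * g * (u * x) - u * (k1 * (g * y) + k2 * (g * v))"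
        for g3 x y v a g k1 k2 :: complex by (simp add: algebra_simps)
      then show ?thesis using \<sigma>
        by (subst X_eq) (simp_all only: diff_conv_add_uminus Re_complex_of_real)
    qed
    then show "of_real (\<sigma> powr \<delta>) * ?X (of_real \<sigma>) = ?G3 * ((of_real \<sigma> + - \<i>) powr ?a * (of_real \<sigma> + \<i>) powr ?a) -
        of_real A * ?G - of_real (\<sigma> powr \<delta>) *
        (?k1 * (?G * (of_real \<sigma> + - \<i>) powr ?a) + ?k2 * (?G * (of_real \<sigma> + \<i>) powr ?a))"
      by (simp only: cancel[OF \<sigma>] mult_1_right)
  qed (use \<delta> in auto)
  also have "(- \<i>) powr ?a * \<i> powr ?a = 1"
    by (simp add: powr_def exp_add[symmetric])
  finally have "of_real (Gamma (3 * \<delta>)) = complex_of_real (A * Gamma \<delta>)" by simp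
  then have "Gamma (3 * \<delta>) = A * Gamma \<delta>" by (simp only: of_real_eq_iff)
  then show "A = Gamma (3 * \<delta>) / Gamma \<delta>" using G by (simp add: field_simps)
  have "?G3 * (\<i> powr ?a * (2 * \<i>) powr ?a) = ?k1 * ?G"
  proof (rule abelian_limit_eq)
    show "cmod (?X (of_real \<sigma> + \<i>)) \<le> C * Gamma (\<delta> - 1) * \<sigma> powr (1 - \<delta>)" if "\<sigma> > 0" for \<sigma>
      using bound[of "of_real \<sigma> + \<i>"] that by simp
    show "((\<lambda>\<sigma>. ?G3 * ((of_real \<sigma> + \<i>) powr ?a * (of_real \<sigma> + 2 * \<i>) powr ?a)) \<longlongrightarrow>
        ?G3 * (\<i> powr ?a * (2 * \<i>) powr ?a)) (at_right 0)"
      by (intro tendsto_mult tendsto_const tendsto_powr_at_right_0 ni)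
    show "((\<lambda>\<sigma>. of_real A * (?G * (of_real \<sigma> + \<i>) powr ?a) + ?k2 * (?G * (of_real \<sigma> + 2 * \<i>) powr ?a)) \<longlongrightarrow>
        of_real A * (?G * \<i> powr ?a) + ?k2 * (?G * (2 * \<i>) powr ?a)) (at_right 0)"
      by (intro tendsto_add tendsto_mult tendsto_const tendsto_powr_at_right_0 ni)
    fix \<sigma> :: real assume \<sigma>: "\<sigma> > 0"
    have shift: "of_real \<sigma> + \<i> - \<i> = complex_of_real \<sigma>" "of_real \<sigma> + \<i> + \<i> = of_real \<sigma> + 2 * \<i>" by simp_all
    have "u * ?X (of_real \<sigma> + \<i>) = ?G3 * (u * of_real \<sigma> powr ?a) * ((of_real \<sigma> + \<i>) powr ?a * (of_real \<sigma> + 2 * \<i>) powr ?a) -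
        ?k1 * ?G * (u * of_real \<sigma> powr ?a) -
        u * (of_real A * (?G * (of_real \<sigma> + \<i>) powr ?a) + ?k2 * (?G * (of_real \<sigma> + 2 * \<i>) powr ?a))" for u
    proof -
      have "u * (g3 * (x * y * v) - (a * (g * x) + k1 * (g * y) + k2 * (g * v))) =
          g3 * (u * y) * (x * v) - k1 * g * (u * y) - u * (a * (g * x) + k2 * (g * v))"
        for g3 x y v a g k1 k2 :: complex by (simp add: algebra_simps)
      then show ?thesis using \<sigma> by (subst X_eq) (simp_all only: shift Re_complex_of_real plus_complex.sel imaginary_unit.sel add_0_right)
    qed
    then show "of_real (\<sigma> powr \<delta>) * ?X (of_real \<sigma> + \<i>) = ?G3 * ((of_real \<sigma> + \<i>) powr ?a * (of_real \<sigma> + 2 * \<i>) powr ?a) -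
        ?k1 * ?G - of_real (\<sigma> powr \<delta>) *
        (of_real A * (?G * (of_real \<sigma> + \<i>) powr ?a) + ?k2 * (?G * (of_real \<sigma> + 2 * \<i>) powr ?a))"
      by (simp only: cancel[OF \<sigma>] mult_1_right)
  qed (use \<delta> in auto)
  \<comment> \<open>Both factors have argument \<open>pi / 2\<close>, so the arguments add up to
    \<open>pi\<close>: this is the source of the phase \<open>\<delta> * pi\<close> in the
    asymptotic formula.\<close>
  also have "\<i> powr ?a * (2 * \<i>) powr ?a = of_real (2 powr (- \<delta>)) * cis (- (\<delta> * pi))"
  proof -
    have L: "Ln (2 * \<i>) = of_real (ln 2) + \<i> * of_real pi / 2"
      using Ln_times_of_real[of 2 \<i>] Ln_of_real[of 2] by simp
    have "\<i> powr ?a * (2 * \<i>) powr ?a = exp (?a * (\<i> * of_real pi / 2)) * exp (?a * (of_real (ln 2) + \<i> * of_real pi / 2))"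
      unfolding powr_def L Ln_ii by simp
    also have "\<dots> = exp (of_real (- \<delta> * ln 2) + \<i> * of_real (- (\<delta> * pi)))"
    proof -
      have "a * (x / 2) + a * (l + x / 2) = a * l + a * x" for a x l :: complex by (simp add: algebra_simps)
      moreover have "?a * of_real (ln 2) + ?a * (\<i> * of_real pi) = of_real (- \<delta> * ln 2) + \<i> * of_real (- (\<delta> * pi))"
        by simp
      ultimately show ?thesis unfolding exp_add[symmetric] by (simp only:)
    qed
    also have "\<dots> = exp (of_real (- \<delta> * ln 2)) * exp (\<i> * of_real (- (\<delta> * pi)))"
      by (rule exp_add)
    also have "exp (complex_of_real (- \<delta> * ln 2)) = of_real (2 powr (- \<delta>))"
      by (simp only: powr_def exp_of_real) simp
    finally show ?thesis by (simp only: cis_conv_exp)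
  qed
  finally have k: "?G3 * (of_real (2 powr (- \<delta>)) * cis (- (\<delta> * pi))) = ?k1 * ?G" .
  \<comment> \<open>The coefficient \<open>?k1\<close> is only half of \<open>P - \<i> Q\<close>,
    which turns \<open>2 powr (- \<delta>)\<close> into the amplitude
    \<open>1 / 2 powr (\<delta> - 1)\<close>.\<close>
  have pw: "2 * (2::real) powr (- \<delta>) = 1 / 2 powr (\<delta> - 1)"
  proof -
    have p1: "(2::real) powr (\<delta> - 1) = 2 powr \<delta> / 2" by (simp add: powr_diff)
    have p2: "(2::real) powr (- \<delta>) = 1 / 2 powr \<delta>" by (rule powr_minus_divide)
    show ?thesis unfolding p1 p2 by simp
  qed
  have "Complex P (- Q) * ?G = 2 * (?k1 * ?G)" by simp
  also have "\<dots> = of_real (Gamma (3 * \<delta>) * (2 * 2 powr (- \<delta>))) * cis (- (\<delta> * pi))"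
    unfolding k[symmetric] by simp
  finally have PQ: "Complex P (- Q) * ?G = of_real (Gamma (3 * \<delta>) * (1 / 2 powr (\<delta> - 1))) * cis (- (\<delta> * pi))"
    unfolding pw .
  have "P * Gamma \<delta> = Gamma (3 * \<delta>) * (1 / 2 powr (\<delta> - 1)) * cos (\<delta> * pi)"
    using arg_cong[OF PQ, of Re] by simp
  then have "P = Gamma (3 * \<delta>) * (1 / 2 powr (\<delta> - 1)) * cos (\<delta> * pi) / Gamma \<delta>"
    using G by (subst nonzero_eq_divide_eq) simp_all
  then show "P = Gamma (3 * \<delta>) / Gamma \<delta> / 2 powr (\<delta> - 1) * cos (\<delta> * pi)" by simp
  have "Q * Gamma \<delta> = Gamma (3 * \<delta>) * (1 / 2 powr (\<delta> - 1)) * sin (\<delta> * pi)"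
    using arg_cong[OF PQ, of Im] by simp
  then have "Q = Gamma (3 * \<delta>) * (1 / 2 powr (\<delta> - 1)) * sin (\<delta> * pi) / Gamma \<delta>"
    using G by (subst nonzero_eq_divide_eq) simp_all
  then show "Q = Gamma (3 * \<delta>) / Gamma \<delta> / 2 powr (\<delta> - 1) * sin (\<delta> * pi)" by simp
qed

lemma h0_asymptotics:
  assumes \<delta>: "\<delta> > 1"
  obtains C where "\<And>r. r > 0 \<Longrightarrow>
    \<bar>h0 \<delta> r - Gamma (3 * \<delta>) / Gamma \<delta> * (1 + cos (r - \<delta> * pi) / 2 powr (\<delta> - 1))\<bar> \<le> C / r"
proof -
  obtain A P Q C where C: "\<And>t. t > 0 \<Longrightarrow> \<bar>h0 \<delta> t - (A + P * cos t + Q * sin t)\<bar> \<le> C / t"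
    using h0_asymptotic_form[OF \<delta>] by blast
  have cA: "A = Gamma (3 * \<delta>) / Gamma \<delta>"
    by (rule asymptotic_coefficients(1)[OF \<delta>]) (rule C)
  have cP: "P = Gamma (3 * \<delta>) / Gamma \<delta> / 2 powr (\<delta> - 1) * cos (\<delta> * pi)"
    by (rule asymptotic_coefficients(2)[OF \<delta>]) (rule C)
  have cQ: "Q = Gamma (3 * \<delta>) / Gamma \<delta> / 2 powr (\<delta> - 1) * sin (\<delta> * pi)"
    by (rule asymptotic_coefficients(3)[OF \<delta>]) (rule C)
  have eq: "A + P * cos t + Q * sin t = Gamma (3 * \<delta>) / Gamma \<delta> * (1 + cos (t - \<delta> * pi) / 2 powr (\<delta> - 1))" for t
    unfolding cos_diff
    unfolding cA cP cQ by (simp add: distrib_left add_divide_distrib mult_ac)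
  show ?thesis
    by (rule that[of C]) (use C in \<open>simp only: eq\<close>)
qed

lemma W_asymptotics:
  assumes \<delta>: "\<delta> > 1"
  shows "(\<lambda>r. W \<delta> r - Gamma (3 * \<delta>) / Gamma \<delta> * r powr (- 2 * \<delta>) * (1 + cos (r - \<delta> * pi) / 2 powr (\<delta> - 1)))
    \<in> O[at_top](\<lambda>r. r powr (- 2 * \<delta> - 1))"
proof -
  obtain C where C: "\<And>r. r > 0 \<Longrightarrow>
    \<bar>h0 \<delta> r - Gamma (3 * \<delta>) / Gamma \<delta> * (1 + cos (r - \<delta> * pi) / 2 powr (\<delta> - 1))\<bar> \<le> C / r"
    using h0_asymptotics[OF \<delta>] by blast
  have "norm (W \<delta> r - Gamma (3 * \<delta>) / Gamma \<delta> * r powr (- 2 * \<delta>) * (1 + cos (r - \<delta> * pi) / 2 powr (\<delta> - 1)))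
      \<le> C * norm (r powr (- 2 * \<delta> - 1))" if r: "r > 0" for r
  proof -
    let ?T = "Gamma (3 * \<delta>) / Gamma \<delta> * (1 + cos (r - \<delta> * pi) / 2 powr (\<delta> - 1))"
    have "W \<delta> r = r powr (- 2 * \<delta>) * h0 \<delta> r"
    proof -
      have "r powr (- 2 * \<delta>) * r powr (2 * \<delta>) = 1" using r by (simp add: powr_add[symmetric])
      then show ?thesis unfolding h0_def by (simp only: mult.assoc[symmetric] mult_1)
    qed
    then have "W \<delta> r - Gamma (3 * \<delta>) / Gamma \<delta> * r powr (- 2 * \<delta>) * (1 + cos (r - \<delta> * pi) / 2 powr (\<delta> - 1))
        = r powr (- 2 * \<delta>) * (h0 \<delta> r - ?T)"
      by (simp only: right_diff_distrib mult_ac)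
    then have "norm (W \<delta> r - Gamma (3 * \<delta>) / Gamma \<delta> * r powr (- 2 * \<delta>) * (1 + cos (r - \<delta> * pi) / 2 powr (\<delta> - 1)))
        = r powr (- 2 * \<delta>) * \<bar>h0 \<delta> r - ?T\<bar>"
      by (simp only: real_norm_def abs_mult) simp
    also have "\<dots> \<le> r powr (- 2 * \<delta>) * (C / r)" by (intro mult_left_mono C r) simp
    also have "\<dots> = C * norm (r powr (- 2 * \<delta> - 1))"
      using r powr_diff[of r "- 2 * \<delta>" 1] by simp
    finally show ?thesis .
  qed
  then show ?thesis
    by (intro bigoI[of _ C]) (use eventually_gt_at_top[of "0::real"] in eventually_elim, blast)
qed

section \<open>Two-sided bounds for \<open>W\<close>\<close>

lemma continuous_positive_comparable_on_compact:
  fixes f :: "real \<Rightarrow> real"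
  assumes "continuous_on {a..b} f" "\<And>x. x \<in> {a..b} \<Longrightarrow> f x > 0" "a \<le> b"
  obtains c1 c2 where "c1 > 0" "\<And>x. x \<in> {a..b} \<Longrightarrow> c1 \<le> f x" "\<And>x. x \<in> {a..b} \<Longrightarrow> f x \<le> c2"
proof -
  obtain x where x: "x \<in> {a..b}" "\<forall>y\<in>{a..b}. f x \<le> f y"
    using continuous_attains_inf[OF _ _ assms(1)] assms(3) by auto
  obtain z where z: "z \<in> {a..b}" "\<forall>y\<in>{a..b}. f y \<le> f z"
    using continuous_attains_sup[OF _ _ assms(1)] assms(3) by auto
  show ?thesis by (rule that[of "f x" "f z"]) (use x z assms(2) in auto)
qed

text \<open>Because \<delta> > 1, the amplitude \<open>1 / 2 powr (\<delta> - 1)\<close> of the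
  cosine is below 1, so the bracket in the asymptotic formula never drops below a positive
  \<open>\<epsilon>\<close>. This settles large \<open>r\<close>; on a compact interval continuity
  and \<open>W_pos\<close> suffice.\<close>

lemma W_comparable:
  assumes \<delta>: "\<delta> > 1"
  shows "comparable_on {0..} (W \<delta>) (\<lambda>r. (1 + r) powr (- 2 * \<delta>))"
proof -
  have pos: "\<delta> > 0" using \<delta> by simp
  obtain C where C: "\<And>r. r > 0 \<Longrightarrow>
    \<bar>h0 \<delta> r - Gamma (3 * \<delta>) / Gamma \<delta> * (1 + cos (r - \<delta> * pi) / 2 powr (\<delta> - 1))\<bar> \<le> C / r"
    using h0_asymptotics[OF \<delta>] by blast
  define K where "K = Gamma (3 * \<delta>) / Gamma \<delta>"
  have K: "K > 0" using pos by (simp add: K_def Gamma_real_pos)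
  define \<epsilon> where "\<epsilon> = 1 - 1 / 2 powr (\<delta> - 1)"
  have "(2::real) powr (\<delta> - 1) > 1" using \<delta> by (simp add: gr_one_powr)
  then have \<epsilon>: "\<epsilon> > 0" by (simp add: \<epsilon>_def)
  have C0: "C \<ge> 0" using order_trans[OF abs_ge_zero C[of 1]] by simp
  \<comment> \<open>Beyond this point the error \<open>C / r\<close> is at most half of the lower
    bound \<open>K * \<epsilon>\<close> of the main term.\<close>
  define R where "R = max 1 (2 * C / (K * \<epsilon>))"
  have R: "R \<ge> 1" by (simp add: R_def)
  have cosb: "\<epsilon> \<le> 1 + cos x / 2 powr (\<delta> - 1)" "1 + cos x / 2 powr (\<delta> - 1) \<le> 2" for x
  proof -
    have p: "(2::real) powr (\<delta> - 1) > 1" by fact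
    have "- 1 / 2 powr (\<delta> - 1) \<le> cos x / 2 powr (\<delta> - 1)" using p by (intro divide_right_mono) auto
    then show "\<epsilon> \<le> 1 + cos x / 2 powr (\<delta> - 1)" by (simp add: \<epsilon>_def)
    have "cos x / 2 powr (\<delta> - 1) \<le> 1 / 2 powr (\<delta> - 1)" using p by (intro divide_right_mono) auto
    also have "\<dots> \<le> 1" using p by simp
    finally show "1 + cos x / 2 powr (\<delta> - 1) \<le> 2" by simp
  qed
  have h_lower: "K * \<epsilon> / 2 \<le> h0 \<delta> r" and h_upper: "h0 \<delta> r \<le> 2 * K + C" if r: "r \<ge> R" for r
  proof -
    have r0: "r > 0" "r \<ge> 1" using r R by auto
    have "C / r \<le> K * \<epsilon> / 2"
    proof -
      have "2 * C / (K * \<epsilon>) \<le> r" using r by (simp add: R_def)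
      then show ?thesis using K \<epsilon> r0 by (simp add: field_simps)
    qed
    moreover have "C / r \<le> C" using C0 r0 by (simp add: divide_le_eq mult_le_cancel_left1)
    moreover have "K * \<epsilon> \<le> K * (1 + cos (r - \<delta> * pi) / 2 powr (\<delta> - 1))"
      "K * (1 + cos (r - \<delta> * pi) / 2 powr (\<delta> - 1)) \<le> K * 2"
      using cosb K by (auto intro!: mult_left_mono)
    moreover have "h0 \<delta> r - K * (1 + cos (r - \<delta> * pi) / 2 powr (\<delta> - 1)) \<le> C / r"
      "- (C / r) \<le> h0 \<delta> r - K * (1 + cos (r - \<delta> * pi) / 2 powr (\<delta> - 1))"
      using C[OF r0(1)] unfolding K_def[symmetric] abs_le_iff by auto
    ultimately show "K * \<epsilon> / 2 \<le> h0 \<delta> r" "h0 \<delta> r \<le> 2 * K + C" by linarith+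
  qed
  let ?f = "\<lambda>r. W \<delta> r * (1 + r) powr (2 * \<delta>)"
  have "continuous_on {0..R} ?f"
    using pos by (intro continuous_intros continuous_on_W) auto
  then obtain c1 c2 where c: "c1 > 0" "\<And>x. x \<in> {0..R} \<Longrightarrow> c1 \<le> ?f x" "\<And>x. x \<in> {0..R} \<Longrightarrow> ?f x \<le> c2"
    using continuous_positive_comparable_on_compact[of 0 R ?f] W_pos[OF \<delta>] R by auto
  \<comment> \<open>The factor \<open>2 powr (2 * \<delta>)\<close> pays for replacing
    \<open>1 + r\<close> by \<open>2 * r\<close> when \<open>r \<ge> 1\<close>.\<close>
  define D where "D = max c2 (2 powr (2 * \<delta>) * (2 * K + C))"
  define c where "c = min c1 (K * \<epsilon> / 2)"
  have cpos: "c > 0" using c(1) K \<epsilon> by (simp add: c_def)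
  have Dpos: "D > 0"
  proof -
    have "2 powr (2 * \<delta>) * (2 * K + C) > 0" using K C0 by (intro mult_pos_pos) auto
    then show ?thesis by (simp add: D_def)
  qed
  have f_bounds: "c \<le> ?f r" "?f r \<le> D" if r: "r \<ge> 0" for r
  proof -
    have "c \<le> ?f r \<and> ?f r \<le> D"
    proof (cases "r \<le> R")
      case True
      then show ?thesis using c(2)[of r] c(3)[of r] r by (auto simp: c_def D_def min_le_iff_disj le_max_iff_disj)
    next
      case False
      then have r1: "r \<ge> R" "r \<ge> 1" using R by auto
      have Wp: "W \<delta> r \<ge> 0" using W_pos[OF \<delta> r] by simp
      have "r powr (2 * \<delta>) \<le> (1 + r) powr (2 * \<delta>)" using r pos by (intro powr_mono2) auto
      from mult_left_mono[OF this Wp] have lo: "h0 \<delta> r \<le> ?f r" unfolding h0_def by (simp only: mult.commute)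
      have "(1 + r) powr (2 * \<delta>) \<le> (2 * r) powr (2 * \<delta>)" using r1 pos by (intro powr_mono2) auto
      then have "?f r \<le> W \<delta> r * (2 * r) powr (2 * \<delta>)" using Wp by (rule mult_left_mono)
      then have up1: "?f r \<le> 2 powr (2 * \<delta>) * h0 \<delta> r" unfolding h0_def using r1 by (simp add: powr_mult mult_ac)
      have up2: "2 powr (2 * \<delta>) * h0 \<delta> r \<le> 2 powr (2 * \<delta>) * (2 * K + C)"
        by (intro mult_left_mono h_upper r1) auto
      have "c \<le> ?f r"
        unfolding c_def by (rule order_trans[OF min.cobounded2 order_trans[OF h_lower[OF r1(1)] lo]])
      moreover have "?f r \<le> D"
        unfolding D_def by (rule order_trans[OF order_trans[OF up1 up2] max.cobounded2])
      ultimately show ?thesis ..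
    qed
    then show "c \<le> ?f r" "?f r \<le> D" by auto
  qed
  have W_eq: "W \<delta> r = ?f r * (1 + r) powr (- 2 * \<delta>)" if "r \<ge> 0" for r
  proof -
    have "(1 + r) powr (2 * \<delta>) * (1 + r) powr (- 2 * \<delta>) = 1" using that by (simp add: powr_add[symmetric])
    then show ?thesis by (simp only: mult.assoc mult_1_right)
  qed
  show ?thesis
    unfolding comparable_on_def
  proof (rule exI[of _ c], rule conjI[OF cpos], rule exI[of _ D], rule conjI[OF Dpos], intro ballI conjI)
    fix r :: real assume "r \<in> {0..}"
    then have r: "r \<ge> 0" by simp
    show "c * (1 + r) powr (- 2 * \<delta>) \<le> W \<delta> r"
      by (subst W_eq[OF r]) (intro mult_right_mono f_bounds r, simp)
    show "W \<delta> r \<le> D * (1 + r) powr (- 2 * \<delta>)"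
      by (subst W_eq[OF r]) (intro mult_right_mono f_bounds r, simp)
  qed
qed

section \<open>Gaussian test functions and Hankel transforms\<close>

text \<open>The variable \<open>y = exp (- t\<^sup>2)\<close> compactifies the half-line to the unit
  interval. Since \<open>F\<close> vanishes for large \<open>t\<close>, also \<open>F / y\<close>
  extends continuously to \<open>y = 0\<close>, and approximating this quotient by a polynomial
  leaves a spare factor \<open>y\<close>. That factor makes the error a small multiple of a
  Gaussian, hence integrable against every polynomial weight.\<close>

lemma gauss_approximation:
  fixes F :: "real \<Rightarrow> real"
  assumes cont: "continuous_on {0..} F" and supp: "\<And>t. t > R \<Longrightarrow> F t = 0" and \<eta>: "\<eta> > 0"
  shows "\<exists>(a :: nat \<Rightarrow> real) N.
    \<forall>t\<ge>0. \<bar>F t - (\<Sum>n\<le>N. a n * exp (- (real (Suc n) * t\<^sup>2)))\<bar> \<le> \<eta> * exp (- t\<^sup>2)"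
proof -
  \<comment> \<open>The added 1 puts the matching point strictly beyond \<open>R\<close>, so both
    branches of \<open>q\<close> are 0 at \<open>y1\<close> and fit together.\<close>
  define y1 where "y1 = exp (- (max R 0 + 1)\<^sup>2)"
  have y1: "0 < y1" "y1 \<le> 1" by (auto simp: y1_def)
  define q where "q y = (if y \<le> y1 then 0 else F (sqrt (- ln y)) / y)" for y
  have zero: "F (sqrt (- ln y)) = 0" if "0 < y" "y \<le> y1" for y
  proof -
    have "ln y \<le> ln y1" using that by simp
    then have "ln y \<le> - (max R 0 + 1)\<^sup>2" by (simp add: y1_def)
    then have "sqrt ((max R 0 + 1)\<^sup>2) \<le> sqrt (- ln y)" by (intro real_sqrt_le_mono) simp
    then have "max R 0 + 1 \<le> sqrt (- ln y)" by simp
    moreover have "R \<le> max R 0" by simp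
    ultimately have "R < sqrt (- ln y)" by linarith
    then show ?thesis by (rule supp)
  qed
  have "continuous_on ({0..y1} \<union> {y1..1}) q"
  proof (rule continuous_on_closed_Un)
    show "continuous_on {0..y1} q"
      by (rule continuous_on_eq[of _ "\<lambda>_. 0"]) (auto simp: q_def)
    have "continuous_on {y1..1} (\<lambda>y. sqrt (- ln y))"
      using y1 by (intro continuous_intros) auto
    then have "continuous_on {y1..1} (\<lambda>y. F (sqrt (- ln y)))"
      by (rule continuous_on_compose2[OF cont]) (use y1 in auto)
    then have "continuous_on {y1..1} (\<lambda>y. F (sqrt (- ln y)) / y)"
      using y1 by (intro continuous_on_divide continuous_on_id) auto
    then show "continuous_on {y1..1} q"
      by (rule continuous_on_eq) (use zero y1 in \<open>auto simp: q_def\<close>)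
  qed auto
  moreover have "{0..y1} \<union> {y1..1} = {0..1}" using y1 by auto
  ultimately have "continuous_on {0..1} q" by simp
  then obtain g where g: "real_polynomial_function g" "\<And>x. x \<in> {0..1} \<Longrightarrow> \<bar>q x - g x\<bar> < \<eta>"
    using Stone_Weierstrass_real_polynomial_function[of "{0..1}" q \<eta>] \<eta> by auto
  from g(1) obtain a N where aN: "g = (\<lambda>x. \<Sum>i\<le>N. a i * x ^ i)"
    by (auto simp: real_polynomial_function_iff_sum)
  show ?thesis
  proof (rule exI[of _ a], rule exI[of _ N], intro allI impI)
    fix t :: real assume t: "t \<ge> 0"
    let ?y = "exp (- t\<^sup>2)"
    have s: "sqrt (- ln ?y) = t" using t by simp
    have F: "F t = ?y * q ?y"
      using zero[of ?y] t unfolding s by (auto simp: q_def s)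
    have "(\<Sum>n\<le>N. a n * exp (- (real (Suc n) * t\<^sup>2))) = ?y * g ?y"
      unfolding aN sum_distrib_left
    proof (rule sum.cong[OF refl])
      fix n
      have "exp (- (real (Suc n) * t\<^sup>2)) = ?y ^ Suc n"
        using exp_of_nat_mult[of "Suc n" "- t\<^sup>2"] by (simp only: mult_minus_right)
      then show "a n * exp (- (real (Suc n) * t\<^sup>2)) = ?y * (a n * ?y ^ n)" by simp
    qed
    then have "\<bar>F t - (\<Sum>n\<le>N. a n * exp (- (real (Suc n) * t\<^sup>2)))\<bar> = \<bar>?y * (q ?y - g ?y)\<bar>"
      unfolding F by (simp only: right_diff_distrib)
    also have "\<dots> = ?y * \<bar>q ?y - g ?y\<bar>" by (simp add: abs_mult)
    also have "\<dots> \<le> ?y * \<eta>" using g(2)[of ?y] by (intro mult_left_mono) auto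
    finally show "\<bar>F t - (\<Sum>n\<le>N. a n * exp (- (real (Suc n) * t\<^sup>2)))\<bar> \<le> \<eta> * exp (- t\<^sup>2)"
      by (simp only: mult.commute)
  qed
qed

lemma AE_zero_continuous_on_open:
  fixes f :: "'a::euclidean_space \<Rightarrow> real"
  assumes S: "open S" and cont: "continuous_on S f" and ae: "AE x in lborel. x \<in> S \<longrightarrow> f x = 0" and x: "x \<in> S"
  shows "f x = 0"
proof (rule ccontr)
  assume nz: "f x \<noteq> 0"
  let ?U = "S \<inter> f -` (- {0})"
  have U: "open ?U" by (rule continuous_open_preimage[OF cont S]) auto
  have "AE x in lborel. x \<notin> ?U" using ae by eventually_elim auto
  moreover have "?U \<in> sets lborel" using U by simp
  ultimately have "?U \<in> null_sets lborel"
    by (rule AE_iff_null_sets[THEN iffD2, rotated])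
  then have "negligible ?U" by (simp add: negligible_iff_null_sets null_sets_completionI)
  then show False using open_not_negligible[OF U] x nz by auto
qed

text \<open>The test function is \<open>D\<close> itself with a tent cutoff. Approximating it by
  Gaussians shows that the integral of \<open>D\<^sup>2 * t ^ m * cut\<close> vanishes; the
  integrand is nonnegative and the cutoff is positive up to \<open>R\<close>, so \<open>D\<close> is
  0 there.\<close>

lemma gaussian_integrals_determine:
  fixes D :: "real \<Rightarrow> real"
  assumes cont: "continuous_on {0..} D"
    and zero: "\<And>\<epsilon>. \<epsilon> > 0 \<Longrightarrow> has_bochner_integral lborel
       (\<lambda>t. indicator {0..} t * (D t * t ^ m) * exp (- (\<epsilon> * t\<^sup>2))) 0"
    and t: "t \<ge> 0"
  shows "D t = 0"
proof -
  have main: "D s = 0" if s: "s > 0" for s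
  proof -
    define R where "R = s + 1"
    define cut where "cut t = max 0 (1 - t / R)" for t
    have R: "R > 0" "s < R" using s by (auto simp: R_def)
    define F where "F t = D t * cut t" for t
    have contF: "continuous_on {0..} F"
      unfolding F_def cut_def by (intro continuous_intros cont) (use R in auto)
    have suppF: "F t = 0" if "t > R" for t
      using that R by (simp add: F_def cut_def)
    let ?w = "\<lambda>t. indicator {0..} t * (D t * t ^ m)"
    have iw: "integrable lborel (\<lambda>t. ?w t * exp (- (\<epsilon> * t\<^sup>2)))" if "\<epsilon> > 0" for \<epsilon>
      using zero[OF that] by (simp add: has_bochner_integral_iff)
    have meas_w: "?w \<in> borel_measurable borel"
    proof -
      have "(\<lambda>t. if t \<in> {0..} then D t * t ^ m else 0) \<in> borel_measurable borel"
        by (rule borel_measurable_continuous_on_if) (auto intro!: continuous_intros cont)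
      moreover have "(\<lambda>t. if t \<in> {0..} then D t * t ^ m else 0) = ?w" by (auto simp: indicator_def)
      ultimately show ?thesis by simp
    qed
    have meas_wF: "(\<lambda>t. ?w t * F t) \<in> borel_measurable borel"
    proof -
      have "(\<lambda>t. if t \<in> {0..} then D t * t ^ m * F t else 0) \<in> borel_measurable borel"
        by (rule borel_measurable_continuous_on_if) (auto intro!: continuous_intros cont contF)
      moreover have "(\<lambda>t. if t \<in> {0..} then D t * t ^ m * F t else 0) = (\<lambda>t. ?w t * F t)" by (auto simp: indicator_def)
      ultimately show ?thesis by simp
    qed
    define I where "I = (\<integral>t. \<bar>?w t * exp (- (1 * t\<^sup>2))\<bar> \<partial>lborel)"
    have I0: "I \<ge> 0" unfolding I_def by simp
    have iabs: "integrable lborel (\<lambda>t. \<eta> * \<bar>?w t * exp (- (1 * t\<^sup>2))\<bar>)" for \<eta>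
      using iw[of 1] by (intro integrable_mult_right Bochner_Integration.integrable_abs) auto
    have small: "integrable lborel (\<lambda>t. ?w t * F t) \<and> \<bar>\<integral>t. ?w t * F t \<partial>lborel\<bar> \<le> \<eta> * I" if \<eta>: "\<eta> > 0" for \<eta>
    proof -
      have "\<exists>(a :: nat \<Rightarrow> real) N. \<forall>t\<ge>0. \<bar>F t - (\<Sum>n\<le>N. a n * exp (- (real (Suc n) * t\<^sup>2)))\<bar> \<le> \<eta> * exp (- t\<^sup>2)"
        by (rule gauss_approximation[OF contF _ \<eta>, of R]) (rule suppF)
      then obtain a :: "nat \<Rightarrow> real" and N :: nat where p:
        "\<forall>t\<ge>0. \<bar>F t - (\<Sum>n\<le>N. a n * exp (- (real (Suc n) * t\<^sup>2)))\<bar> \<le> \<eta> * exp (- t\<^sup>2)"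
        by (elim exE)
      let ?p = "\<lambda>t. \<Sum>n\<le>N. a n * exp (- (real (Suc n) * t\<^sup>2))"
      have hp: "has_bochner_integral lborel (\<lambda>t. ?w t * ?p t) 0"
      proof -
        have "has_bochner_integral lborel (\<lambda>t. \<Sum>n\<le>N. a n * (?w t * exp (- (real (Suc n) * t\<^sup>2)))) (\<Sum>n\<le>N. a n * 0)"
          by (intro has_bochner_integral_sum has_bochner_integral_mult_right zero) auto
        moreover have "(\<lambda>t. \<Sum>n\<le>N. a n * (?w t * exp (- (real (Suc n) * t\<^sup>2)))) = (\<lambda>t. ?w t * ?p t)"
        proof
          fix t
          have "y * (\<Sum>n\<le>N. a n * x n) = (\<Sum>n\<le>N. a n * (y * x n))" for y :: real and x
            unfolding sum_distrib_left by (intro sum.cong refl) simp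
          then show "(\<Sum>n\<le>N. a n * (?w t * exp (- (real (Suc n) * t\<^sup>2)))) = ?w t * ?p t" by (rule sym)
        qed
        ultimately show ?thesis by (simp only: mult_zero_right sum.neutral_const)
      qed
      have bnd: "\<bar>?w t * (F t - ?p t)\<bar> \<le> \<eta> * \<bar>?w t * exp (- (1 * t\<^sup>2))\<bar>" for t
      proof (cases "t \<ge> 0")
        case True
        then have "\<bar>?w t\<bar> * \<bar>F t - ?p t\<bar> \<le> \<bar>?w t\<bar> * (\<eta> * exp (- t\<^sup>2))"
          by (intro mult_left_mono p[rule_format]) auto
        then show ?thesis by (simp add: abs_mult mult_ac)
      qed simp
      have ir: "integrable lborel (\<lambda>t. ?w t * (F t - ?p t))"
      proof (rule Bochner_Integration.integrable_bound[OF iabs[of \<eta>]])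
        have meas_p: "?p \<in> borel_measurable borel" by measurable
        have "(\<lambda>t. ?w t * F t - ?w t * ?p t) \<in> borel_measurable borel"
          by (rule borel_measurable_diff[OF meas_wF borel_measurable_times[OF meas_w meas_p]])
        then show "(\<lambda>t. ?w t * (F t - ?p t)) \<in> borel_measurable lborel"
          by (simp only: right_diff_distrib measurable_lborel2)
        show "AE t in lborel. norm (?w t * (F t - ?p t)) \<le> norm (\<eta> * \<bar>?w t * exp (- (1 * t\<^sup>2))\<bar>)"
          unfolding real_norm_def
          by (intro always_eventually allI order_trans[OF bnd abs_ge_self])
      qed
      have split: "(\<lambda>t. ?w t * F t) = (\<lambda>t. ?w t * (F t - ?p t) + ?w t * ?p t)"
        by (simp add: right_diff_distrib fun_eq_iff)
      have hF: "has_bochner_integral lborel (\<lambda>t. ?w t * F t) ((\<integral>t. ?w t * (F t - ?p t) \<partial>lborel) + 0)"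
        by (subst split) (rule has_bochner_integral_add[OF has_bochner_integral_integrable[OF ir] hp])
      have "(\<integral>t. ?w t * F t \<partial>lborel) = (\<integral>t. ?w t * (F t - ?p t) \<partial>lborel)"
        using has_bochner_integral_integral_eq[OF hF] by (simp only: add_0_right)
      then have "\<bar>\<integral>t. ?w t * F t \<partial>lborel\<bar> = \<bar>\<integral>t. ?w t * (F t - ?p t) \<partial>lborel\<bar>"
        by (rule arg_cong)
      also have "\<dots> \<le> (\<integral>t. \<bar>?w t * (F t - ?p t)\<bar> \<partial>lborel)"
        by (rule integral_abs_bound)
      also have "\<dots> \<le> (\<integral>t. \<eta> * \<bar>?w t * exp (- (1 * t\<^sup>2))\<bar> \<partial>lborel)"
        by (rule integral_mono[OF Bochner_Integration.integrable_abs[OF ir] iabs[of \<eta>] bnd])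
      also have "\<dots> = \<eta> * I" unfolding I_def by (rule integral_mult_right_zero)
      finally have "\<bar>\<integral>t. ?w t * F t \<partial>lborel\<bar> \<le> \<eta> * I" .
      with has_bochner_integral_iff[THEN iffD1, OF hF, THEN conjunct1] show ?thesis by (rule conjI)
    qed
    have "\<bar>\<integral>t. ?w t * F t \<partial>lborel\<bar> \<le> 0"
    proof (rule field_le_epsilon)
      fix e :: real assume e: "e > 0"
      have "\<bar>\<integral>t. ?w t * F t \<partial>lborel\<bar> \<le> e / (I + 1) * I"
        using small[of "e / (I + 1)", THEN conjunct2] e I0 by (simp only: divide_pos_pos add_nonneg_pos zero_less_one)
      also have "\<dots> \<le> e / (I + 1) * (I + 1)" using e I0 by (intro mult_left_mono) auto
      also have "\<dots> = e" using I0 by simp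
      finally show "\<bar>\<integral>t. ?w t * F t \<partial>lborel\<bar> \<le> 0 + e" by simp
    qed
    then have int0: "(\<integral>t. ?w t * F t \<partial>lborel) = 0" by simp
    have sq: "?w t * F t = indicator {0..} t * ((D t)\<^sup>2 * (t ^ m * cut t))" for t
      by (simp add: F_def power2_eq_square)
    have nn: "0 \<le> ?w t * F t" for t
      unfolding sq by (cases "t \<ge> 0") (auto simp: cut_def)
    have "AE t in lborel. ?w t * F t = 0"
      by (rule integral_nonneg_eq_0_iff_AE[THEN iffD1, OF small[OF zero_less_one, THEN conjunct1] always_eventually int0])
        (rule allI, rule nn)
    then have ae: "AE t in lborel. t \<in> {0<..<R} \<longrightarrow> D t = 0"
    proof eventually_elim
      fix t assume z: "?w t * F t = 0"
      show "t \<in> {0<..<R} \<longrightarrow> D t = 0"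
        using z R unfolding sq by (auto simp: cut_def)
    qed
    show ?thesis
    proof (rule AE_zero_continuous_on_open[OF _ _ ae])
      show "continuous_on {0<..<R} D" by (rule continuous_on_subset[OF cont]) auto
    qed (use R s in auto)
  qed
  show ?thesis
  proof (cases "t > 0")
    \<comment> \<open>The argument above covers open intervals to the right of 0; the endpoint
      follows by continuity.\<close>
    case False
    then have t0: "t = 0" using t by simp
    have "(\<lambda>n. 1 / (real n + 1)) \<longlonglongrightarrow> 0" by real_asymp
    then have "(\<lambda>n. D (1 / (real n + 1))) \<longlonglongrightarrow> D 0"
      using cont[unfolded continuous_on_sequentially o_def, rule_format, of 0 "\<lambda>n. 1 / (real n + 1)"] by simp
    moreover have "D (1 / (real n + 1)) = 0" for n
      by (rule main) (simp add: add_nonneg_pos)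
    ultimately show ?thesis using t0 by (simp add: LIMSEQ_const_iff)
  qed (rule main)
qed

text \<open>The Gaussian moment \<open>Gamma (d / 2 + k) / (2 * \<epsilon> powr (d / 2 + k))\<close>
  cancels the \<open>pochhammer (d / 2) k\<close> of \<open>omega_coeff\<close> and leaves an
  exponential series: Gaussians are mapped to Gaussians, with \<open>\<epsilon>\<close> replaced by
  \<open>1 / (4 * \<epsilon>)\<close>.\<close>

lemma Omega_gaussian:
  assumes d: "d > 0" and \<epsilon>: "\<epsilon> > 0"
  shows "has_bochner_integral lborel
    (\<lambda>t. Omega ((real d - 2) / 2) (r * t) * (indicator {0..} t * (exp (- (\<epsilon> * t\<^sup>2)) * t ^ (d - 1))))
    (Gamma (real d / 2) / (2 * \<epsilon> powr (real d / 2)) * exp (- (r\<^sup>2 / (4 * \<epsilon>))))"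
proof -
  let ?l = "(real d - 2) / 2" and ?g = "\<lambda>t. indicator {0..} t * (exp (- (\<epsilon> * t\<^sup>2)) * t ^ (d - 1))"
  let ?K = "Gamma (real d / 2) / (2 * \<epsilon> powr (real d / 2))"
  let ?m = "\<lambda>k. Gamma ((real d + 2 * real k) / 2) / (2 * \<epsilon> powr ((real d + 2 * real k) / 2))"
  have l: "?l > -1" and l1: "?l + 1 = real d / 2" using d by (auto simp: field_simps)
  have g: "0 \<le> ?g t" for t by (auto simp: indicator_def)
  have m: "has_bochner_integral lborel (\<lambda>t. t ^ (2 * k) * ?g t) (?m k)" for k
  proof (rule has_bochner_integral_cong_except_0[THEN iffD1])
    show "has_bochner_integral lborel (\<lambda>t. indicator {0..} t * (t powr (real d + 2 * real k - 1) * exp (- (\<epsilon> * t\<^sup>2)))) (?m k)"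
      using d \<epsilon> by (intro has_bochner_integral_gaussian_moment) auto
    fix t :: real assume t: "t \<noteq> 0"
    show "indicator {0..} t * (t powr (real d + 2 * real k - 1) * exp (- (\<epsilon> * t\<^sup>2))) = t ^ (2 * k) * ?g t"
    proof (cases "t > 0")
      case True
      have e: "real d + 2 * real k - 1 = real (2 * k + (d - 1))" using d by (simp add: of_nat_diff)
      have "t powr (real d + 2 * real k - 1) = t ^ (2 * k) * t ^ (d - 1)"
        unfolding e powr_realpow[OF True] power_add ..
      then show ?thesis using True by simp
    qed (use t in auto)
  qed
  have z: "real d / 2 \<notin> \<int>\<^sub>\<le>\<^sub>0" using d by (auto elim!: nonpos_Ints_cases simp: field_simps)
  have G: "Gamma (real d / 2) > 0" using d by (intro Gamma_real_pos) auto
  have p: "pochhammer (real d / 2) k > 0" for k using d by (intro pochhammer_pos) auto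
  have m_eq: "?m k = ?K * (pochhammer (real d / 2) k / \<epsilon> ^ k)" for k
  proof -
    have "Gamma ((real d + 2 * real k) / 2) = pochhammer (real d / 2) k * Gamma (real d / 2)"
      using pochhammer_Gamma[OF z, of k] G by (simp add: add_divide_distrib)
    moreover have "\<epsilon> powr ((real d + 2 * real k) / 2) = \<epsilon> powr (real d / 2) * \<epsilon> ^ k"
      using \<epsilon> by (simp add: add_divide_distrib powr_add powr_realpow)
    ultimately show ?thesis by (simp add: mult_ac)
  qed
  have K: "?K \<ge> 0" using G by simp
  have coeff: "omega_coeff ?l k * r ^ (2 * k) * ?m k = ?K * ((- (r\<^sup>2 / (4 * \<epsilon>))) ^ k / fact k)" for k
  proof -
    have "(- (r\<^sup>2 / (4 * \<epsilon>))) ^ k = (-1) ^ k * r ^ (2 * k) / (4 ^ k * \<epsilon> ^ k)"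
      by (subst power_minus) (simp add: power_divide power_mult power_mult_distrib)
    moreover have "omega_coeff ?l k * P = (-1) ^ k / (fact k * 4 ^ k)" if "P = pochhammer (real d / 2) k" for P
      using p[of k] that unfolding omega_coeff_def l1 by simp
    ultimately show ?thesis unfolding m_eq using p[of k] by (simp add: omega_coeff_def l1 mult_ac)
  qed
  have mn: "?m k \<ge> 0" for k unfolding m_eq using K p[of k] \<epsilon> by (intro mult_nonneg_nonneg) auto
  have "\<bar>omega_coeff ?l k\<bar> * r ^ (2 * k) * ?m k = ?K * ((r\<^sup>2 / (4 * \<epsilon>)) ^ k / fact k)" for k
  proof -
    have "\<bar>omega_coeff ?l k\<bar> * r ^ (2 * k) * ?m k = \<bar>omega_coeff ?l k * r ^ (2 * k) * ?m k\<bar>"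
      unfolding abs_mult[of "omega_coeff ?l k * r ^ (2 * k)"] abs_of_nonneg[OF mn] by (simp add: abs_mult)
    also have "\<dots> = ?K * \<bar>(- (r\<^sup>2 / (4 * \<epsilon>))) ^ k / fact k\<bar>"
      unfolding coeff abs_mult[of ?K] abs_of_nonneg[OF K] ..
    also have "\<bar>(- (r\<^sup>2 / (4 * \<epsilon>))) ^ k / fact k\<bar> = (r\<^sup>2 / (4 * \<epsilon>)) ^ k / fact k"
      using \<epsilon> by (simp add: power_abs)
    finally show ?thesis .
  qed
  moreover have exp_sums: "(\<lambda>k. x ^ k / fact k) sums exp x" for x :: real
    using exp_converges[of x] by (simp add: divide_inverse mult.commute)
  ultimately have s: "summable (\<lambda>k. \<bar>omega_coeff ?l k\<bar> * r ^ (2 * k) * ?m k)"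
    using sums_summable[OF exp_sums] by (simp only: summable_mult)
  have "(\<lambda>k. omega_coeff ?l k * r ^ (2 * k) * ?m k) sums (?K * exp (- (r\<^sup>2 / (4 * \<epsilon>))))"
    unfolding coeff by (intro sums_mult exp_sums)
  then have "(\<Sum>k. omega_coeff ?l k * r ^ (2 * k) * ?m k) = ?K * exp (- (r\<^sup>2 / (4 * \<epsilon>)))"
    by (rule sums_unique[symmetric])
  with Omega_integral(1)[OF l g m s] show ?thesis by (simp only:)
qed

lemma integrable_Omega_times:
  fixes g :: "real \<Rightarrow> real"
  assumes "l \<ge> -1/2" "integrable lborel g"
  shows "integrable lborel (\<lambda>t. Omega l (r * t) * g t)"
proof (rule Bochner_Integration.integrable_bound[OF assms(2)])
  have [measurable]: "Omega l \<in> borel_measurable borel" "g \<in> borel_measurable borel"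
    using assms borel_measurable_Omega[of l] by auto
  show "(\<lambda>t. Omega l (r * t) * g t) \<in> borel_measurable lborel" by measurable
  show "AE t in lborel. norm (Omega l (r * t) * g t) \<le> norm (g t)"
    using abs_Omega_le_1[OF assms(1)] by (intro always_eventually allI) (simp add: abs_mult mult_left_le_one_le)
qed

lemma continuous_on_Omega_transform:
  fixes g :: "real \<Rightarrow> real"
  assumes "l \<ge> -1/2" "integrable lborel g"
  shows "continuous_on A (\<lambda>r. \<integral>t. Omega l (r * t) * g t \<partial>lborel)"
  unfolding continuous_on_sequentially o_def
proof (intro allI ballI impI, elim conjE)
  fix x :: "nat \<Rightarrow> real" and r
  assume x: "x \<longlonglongrightarrow> r"
  have [measurable]: "Omega l \<in> borel_measurable borel" "g \<in> borel_measurable borel"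
    using assms borel_measurable_Omega[of l] by auto
  show "(\<lambda>n. \<integral>t. Omega l (x n * t) * g t \<partial>lborel) \<longlonglongrightarrow> (\<integral>t. Omega l (r * t) * g t \<partial>lborel)"
  proof (rule integral_dominated_convergence[where w = "\<lambda>t. \<bar>g t\<bar>"])
    show "integrable lborel (\<lambda>t. \<bar>g t\<bar>)" using assms by (intro Bochner_Integration.integrable_abs)
    show "AE t in lborel. (\<lambda>n. Omega l (x n * t) * g t) \<longlonglongrightarrow> Omega l (r * t) * g t"
      using assms(1) by (intro always_eventually allI tendsto_intros isCont_tendsto_compose[OF isCont_Omega] x) auto
    show "AE t in lborel. norm (Omega l (x n * t) * g t) \<le> \<bar>g t\<bar>" for n
      using abs_Omega_le_1[OF assms(1)] by (intro always_eventually allI) (simp add: abs_mult mult_left_le_one_le)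
  qed measurable
qed

text \<open>The kernel depends on the product \<open>r * t\<close> only, so by Fubini the transform
  can be moved from \<open>g\<close> onto the Gaussian, where it is known. The exchange is absolute
  because the kernel is bounded by 1.\<close>

lemma hankel_gauss_swap:
  fixes g :: "real \<Rightarrow> real"
  assumes d: "d > 0" and g: "integrable lborel g" and \<epsilon>: "\<epsilon> > 0"
  shows "has_bochner_integral lborel
    (\<lambda>r. indicator {0..} r * ((\<integral>t. Omega ((real d - 2) / 2) (r * t) * g t \<partial>lborel) * r ^ (d - 1)) * exp (- (\<epsilon> * r\<^sup>2)))
    (Gamma (real d / 2) / (2 * \<epsilon> powr (real d / 2)) * (\<integral>t. g t * exp (- (1 / (4 * \<epsilon>) * t\<^sup>2)) \<partial>lborel))"
proof -
  let ?l = "(real d - 2) / 2" and ?k = "\<lambda>r. indicator {0..} r * (exp (- (\<epsilon> * r\<^sup>2)) * r ^ (d - 1))"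
  let ?K = "Gamma (real d / 2) / (2 * \<epsilon> powr (real d / 2))"
  have l: "?l \<ge> -1/2" using d by simp
  have [measurable]: "Omega ?l \<in> borel_measurable borel" "g \<in> borel_measurable borel"
    using g l by (auto intro!: borel_measurable_Omega)
  have k: "integrable lborel ?k" using Omega_gaussian[OF d \<epsilon>, of 0] d by (simp add: has_bochner_integral_iff)
  let ?f = "\<lambda>t r. Omega ?l (r * t) * ?k r * g t"
  have prod: "integrable (lborel \<Otimes>\<^sub>M lborel) (\<lambda>(t, r). g t * ?k r)"
  proof (rule lborel_pair.Fubini_integrable)
    show "(\<lambda>(t, r). g t * ?k r) \<in> borel_measurable (lborel \<Otimes>\<^sub>M lborel)" by measurable
    have "integrable lborel (\<lambda>t. \<bar>g t\<bar> * (\<integral>r. \<bar>?k r\<bar> \<partial>lborel))"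
      by (intro integrable_mult_left Bochner_Integration.integrable_abs g)
    then show "integrable lborel (\<lambda>t. \<integral>r. norm (case (t, r) of (t, r) \<Rightarrow> g t * ?k r) \<partial>lborel)"
      by (simp add: abs_mult)
    show "AE t in lborel. integrable lborel (\<lambda>r. case (t, r) of (t, r) \<Rightarrow> g t * ?k r)"
      using k by simp
  qed
  have f: "integrable (lborel \<Otimes>\<^sub>M lborel) (case_prod ?f)"
  proof (rule Bochner_Integration.integrable_bound[OF prod])
    show "case_prod ?f \<in> borel_measurable (lborel \<Otimes>\<^sub>M lborel)" by measurable
    have "\<bar>?f t r\<bar> \<le> \<bar>g t * ?k r\<bar>" for t r
      using abs_Omega_le_1[OF l, of "r * t"] mult_right_mono[of "\<bar>Omega ?l (r * t)\<bar>" 1 "\<bar>?k r * g t\<bar>"]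
      by (simp add: abs_mult mult_ac)
    then show "AE x in lborel \<Otimes>\<^sub>M lborel. norm (case x of (t, r) \<Rightarrow> ?f t r) \<le> norm (case x of (t, r) \<Rightarrow> g t * ?k r)"
      by (intro always_eventually allI) (simp add: case_prod_beta)
  qed
  have eq1: "(\<integral>t. ?f t r \<partial>lborel) = indicator {0..} r * ((\<integral>t. Omega ?l (r * t) * g t \<partial>lborel) * r ^ (d - 1)) * exp (- (\<epsilon> * r\<^sup>2))" for r
  proof -
    have "(\<integral>t. ?f t r \<partial>lborel) = (\<integral>t. ?k r * (Omega ?l (r * t) * g t) \<partial>lborel)"
      by (intro Bochner_Integration.integral_cong refl) (simp add: mult_ac)
    also have "\<dots> = ?k r * (\<integral>t. Omega ?l (r * t) * g t \<partial>lborel)" by (rule integral_mult_right_zero)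
    finally show ?thesis by (simp add: mult_ac)
  qed
  have eq2: "(\<integral>r. ?f t r \<partial>lborel) = ?K * (g t * exp (- (1 / (4 * \<epsilon>) * t\<^sup>2)))" for t
  proof -
    have "(\<integral>r. ?f t r \<partial>lborel) = (\<integral>r. Omega ?l (t * r) * ?k r \<partial>lborel) * g t"
      by (subst integral_mult_left_zero[symmetric]) (simp add: mult.commute[of t])
    also have "(\<integral>r. Omega ?l (t * r) * ?k r \<partial>lborel) = ?K * exp (- (t\<^sup>2 / (4 * \<epsilon>)))"
      by (rule has_bochner_integral_integral_eq[OF Omega_gaussian[OF d \<epsilon>]])
    finally show ?thesis by simp
  qed
  have "integrable lborel (\<lambda>r. \<integral>t. ?f t r \<partial>lborel)" by (rule lborel_pair.integrable_snd[OF f])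
  moreover have "(\<integral>r. (\<integral>t. ?f t r \<partial>lborel) \<partial>lborel) = (\<integral>t. (\<integral>r. ?f t r \<partial>lborel) \<partial>lborel)"
    by (rule lborel_pair.Fubini_integral[OF f])
  ultimately show ?thesis
    unfolding eq1 eq2 by (simp only: has_bochner_integral_iff integral_mult_right_zero simp_thms)
qed

section \<open>Radial Fourier transforms and positive definiteness\<close>

text \<open>
  Multiplying by \<open>exp (-i x\<^sub>k \<bullet> y)\<close> and differentiating removes the term with index \<open>k\<close>, so the number of
  exponentials can be reduced by induction.
\<close>
lemma exponentials_independent:
  fixes x :: "'i \<Rightarrow> 'a::euclidean_space" and w :: "'i \<Rightarrow> complex"
  assumes "finite J" "inj_on x J" "open U" "U \<noteq> {}"
    and "\<And>y. y \<in> U \<Longrightarrow> (\<Sum>j\<in>J. w j * exp (\<i> * of_real (x j \<bullet> y))) = 0"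
  shows "\<forall>j\<in>J. w j = 0"
  using assms(1,2,5)
proof (induction J arbitrary: w rule: finite_induct)
  case empty
  then show ?case by simp
next
  case (insert k J)
  have shifted: "w k + (\<Sum>j\<in>J. w j * exp (\<i> * of_real ((x j - x k) \<bullet> y))) = 0" if y: "y \<in> U" for y
  proof -
    have "exp (- (\<i> * of_real (x k \<bullet> y))) * (\<Sum>j\<in>insert k J. w j * exp (\<i> * of_real (x j \<bullet> y))) = 0"
      using insert.prems(2)[OF y] by simp
    moreover have "exp (- (\<i> * of_real (x k \<bullet> y))) * (w j * exp (\<i> * of_real (x j \<bullet> y))) =
        w j * exp (\<i> * of_real ((x j - x k) \<bullet> y))" for j
    proof -
      have "exp (- (\<i> * of_real (x k \<bullet> y))) * exp (\<i> * of_real (x j \<bullet> y)) = exp (\<i> * of_real ((x j - x k) \<bullet> y))"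
        by (simp add: exp_add[symmetric] inner_diff_left algebra_simps)
      then show ?thesis by (simp add: mult.left_commute)
    qed
    ultimately have "(\<Sum>j\<in>insert k J. w j * exp (\<i> * of_real ((x j - x k) \<bullet> y))) = 0"
      by (simp only: sum_distrib_left)
    then show ?thesis using insert.hyps by simp
  qed
  have deriv: "(\<Sum>j\<in>J. (w j * of_real ((x j - x k) \<bullet> v)) * exp (\<i> * of_real (x j \<bullet> y))) = 0" if y: "y \<in> U" for v y
  proof -
    define G where "G z = w k + (\<Sum>j\<in>J. w j * exp (\<i> * (of_real ((x j - x k) \<bullet> y) + z * of_real ((x j - x k) \<bullet> v))))" for z
    let ?D = "\<Sum>j\<in>J. w j * (exp (\<i> * of_real ((x j - x k) \<bullet> y)) * (\<i> * of_real ((x j - x k) \<bullet> v)))"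
    have "(G has_field_derivative 0 + (\<Sum>j\<in>J. w j * (exp (\<i> * (of_real ((x j - x k) \<bullet> y) + of_real 0 * of_real ((x j - x k) \<bullet> v))) *
        (\<i> * of_real ((x j - x k) \<bullet> v))))) (at (of_real 0))"
      unfolding G_def by (intro DERIV_add DERIV_const DERIV_sum DERIV_cmult) (auto intro!: derivative_eq_intros)
    then have d1: "((\<lambda>\<tau>::real. G (of_real \<tau>)) has_vector_derivative ?D) (at 0)"
      using has_vector_derivative_real_field[of G ?D 0 UNIV] by simp
    have "continuous_on UNIV (\<lambda>\<tau>::real. y + \<tau> *\<^sub>R v)" by (intro continuous_intros)
    then have opn: "open ((\<lambda>\<tau>::real. y + \<tau> *\<^sub>R v) -` U)" using assms(3) by (simp add: open_vimage)
    have "G (of_real \<tau>) = 0" if "\<tau> \<in> (\<lambda>\<tau>::real. y + \<tau> *\<^sub>R v) -` U" for \<tau>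
    proof -
      have "complex_of_real ((x j - x k) \<bullet> (y + \<tau> *\<^sub>R v)) = of_real ((x j - x k) \<bullet> y) + of_real \<tau> * of_real ((x j - x k) \<bullet> v)" for j
        by (simp add: inner_add_right)
      then show ?thesis using shifted[of "y + \<tau> *\<^sub>R v"] that by (simp only: G_def vimage_eq)
    qed
    then have "((\<lambda>\<tau>::real. 0) has_vector_derivative ?D) (at 0)"
      by (intro has_vector_derivative_transform_within_open[OF d1 opn]) (use y in auto)
    then have "?D = 0"
      using vector_derivative_unique_at[OF _ has_vector_derivative_const] by blast
    then have "- \<i> * exp (\<i> * of_real (x k \<bullet> y)) * ?D = 0" by simp
    moreover have "- \<i> * exp (\<i> * of_real (x k \<bullet> y)) * (w j * (exp (\<i> * of_real ((x j - x k) \<bullet> y)) * (\<i> * of_real ((x j - x k) \<bullet> v)))) =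
        (w j * of_real ((x j - x k) \<bullet> v)) * exp (\<i> * of_real (x j \<bullet> y))" for j
    proof -
      have e: "exp (\<i> * of_real (x k \<bullet> y)) * exp (\<i> * of_real ((x j - x k) \<bullet> y)) = exp (\<i> * of_real (x j \<bullet> y))"
        by (simp add: exp_add[symmetric] inner_diff_left algebra_simps)
      have "- \<i> * a * (b * (c * (\<i> * g))) = (b * g) * (a * c)" for a b c g :: complex
        by (simp add: algebra_simps)
      then show ?thesis unfolding e[symmetric] .
    qed
    ultimately show ?thesis by (simp only: sum_distrib_left)
  qed
  have J0: "w j = 0" if j: "j \<in> J" for j
  proof -
    \<comment> \<open>The direction of differentiation is \<open>x j - x k\<close>: its inner
      product with itself is nonzero by injectivity, so vanishing of the new \<open>j\<close>-th
      coefficient gives \<open>w j = 0\<close>.\<close>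
    have "\<forall>i\<in>J. w i * of_real ((x i - x k) \<bullet> (x j - x k)) = 0"
      by (rule insert.IH) (use insert.prems(1) deriv in auto)
    moreover have "x j \<noteq> x k" using insert j by (auto simp: inj_on_def)
    ultimately show ?thesis using j by auto
  qed
  obtain y where "y \<in> U" using assms(4) by auto
  from shifted[OF this] J0 have "w k = 0" by simp
  with J0 show ?case by simp
qed

section \<open>Fourier transforms of Gaussians and of radial functions\<close>

text \<open>The index belonging to \<open>d = 1\<close>; through it the one-dimensional Gaussian
  transform is an instance of \<open>Omega_gaussian\<close>.\<close>

lemma Omega_minus_half: "Omega (- 1 / 2) = cos"
proof
  fix t :: real
  have "omega_coeff (- 1 / 2) k = (-1) ^ k / fact (2 * k)" for k
  proof -
    have "(2::real) ^ (2 * k) = 4 ^ k" by (simp add: power_mult)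
    then show ?thesis
      using fact_double[of k, where 'a = real] by (simp only: omega_coeff_def) (simp add: mult_ac)
  qed
  then show "Omega (- 1 / 2) t = cos t"
    using sums_unique[OF cos_paired[of t]] by (simp add: Omega_eq_even_series even_series_def)
qed

text \<open>The cosine part is even and is twice its half-line integral; the sine part is odd and
  integrates to 0.\<close>

lemma fourier_gaussian_1d:
  assumes \<epsilon>: "\<epsilon> > 0"
  shows "has_bochner_integral lborel (\<lambda>t. exp (\<i> * of_real (a * t)) * of_real (exp (- (\<epsilon> * t\<^sup>2))))
    (of_real (sqrt pi / \<epsilon> powr (1/2) * exp (- (a\<^sup>2 / (4 * \<epsilon>)))))"
proof -
  let ?v = "Gamma (1/2) / (2 * \<epsilon> powr (1/2)) * exp (- (a\<^sup>2 / (4 * \<epsilon>)))"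
  have l: "(real 1 - 2) / 2 = - 1 / 2" by simp
  have "has_bochner_integral lborel (\<lambda>t. cos (a * t) * (indicator {0..} t * (exp (- (\<epsilon> * t\<^sup>2)) * t ^ (1 - 1)))) ?v"
    using Omega_gaussian[of 1 \<epsilon> a] \<epsilon> unfolding l Omega_minus_half by simp
  then have "has_bochner_integral lborel (\<lambda>t. indicator {0..} t *\<^sub>R (cos (a * t) * exp (- (\<epsilon> * t\<^sup>2)))) ?v"
    by (simp add: mult_ac)
  from has_bochner_integral_even_function[OF this]
  have c: "has_bochner_integral lborel (\<lambda>t. cos (a * t) * exp (- (\<epsilon> * t\<^sup>2))) (2 * ?v)"
    by simp
  have "has_bochner_integral lborel (\<lambda>t. indicator {0..} t *\<^sub>R (cos (0 * t) * exp (- (\<epsilon> * t\<^sup>2)))) (Gamma (1/2) / (2 * \<epsilon> powr (1/2)))"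
    using Omega_gaussian[of 1 \<epsilon> 0] \<epsilon> unfolding l Omega_minus_half by simp
  from has_bochner_integral_even_function[OF this]
  have g: "has_bochner_integral lborel (\<lambda>t. cos (0 * t) * exp (- (\<epsilon> * t\<^sup>2))) (2 * (Gamma (1/2) / (2 * \<epsilon> powr (1/2))))"
    by simp
  let ?s = "\<lambda>t. sin (a * t) * exp (- (\<epsilon> * t\<^sup>2))"
  have "integrable lborel ?s"
  proof (rule Bochner_Integration.integrable_bound)
    show "integrable lborel (\<lambda>t. cos (0 * t) * exp (- (\<epsilon> * t\<^sup>2)))" using g by (simp add: has_bochner_integral_iff)
    show "AE t in lborel. norm (?s t) \<le> norm (cos (0 * t) * exp (- (\<epsilon> * t\<^sup>2)))"
      by (intro always_eventually allI) (simp add: abs_mult mult_left_le_one_le)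
  qed simp
  moreover have "integral\<^sup>L lborel ?s = - integral\<^sup>L lborel ?s"
    using lborel_integral_real_affine[of "-1" ?s 0] by simp
  ultimately have s: "has_bochner_integral lborel ?s 0"
    by (simp add: has_bochner_integral_iff)
  have "has_bochner_integral lborel (\<lambda>t. of_real (cos (a * t) * exp (- (\<epsilon> * t\<^sup>2))) + \<i> * of_real (?s t))
      (of_real (2 * ?v) + \<i> * of_real 0)"
    by (intro has_bochner_integral_add has_bochner_integral_mult_right has_bochner_integral_of_real c s)
  moreover have "of_real (cos (a * t) * exp (- (\<epsilon> * t\<^sup>2))) + \<i> * of_real (?s t) =
      exp (\<i> * of_real (a * t)) * of_real (exp (- (\<epsilon> * t\<^sup>2)))" for t
    by (simp add: exp_Euler cos_of_real sin_of_real algebra_simps del: of_real_mult)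
       (simp add: algebra_simps)
  moreover have "of_real (2 * ?v) + \<i> * of_real 0 = complex_of_real (sqrt pi / \<epsilon> powr (1/2) * exp (- (a\<^sup>2 / (4 * \<epsilon>))))"
    by (simp add: Gamma_one_half_real)
  ultimately show ?thesis by (simp only:)
qed

interpretation lborel_product: product_sigma_finite "\<lambda>_::'a. lborel :: real measure" ..

text \<open>Both the exponential and the Gaussian factor over the coordinates, and Lebesgue measure
  is the image of a product measure on the coordinates.\<close>

lemma fourier_gaussian:
  fixes x :: "'a::euclidean_space"
  assumes \<epsilon>: "\<epsilon> > 0"
  shows "has_bochner_integral lborel (\<lambda>y. exp (\<i> * of_real (x \<bullet> y)) * of_real (exp (- (\<epsilon> * (norm y)\<^sup>2))))
    (of_real ((sqrt pi / \<epsilon> powr (1/2)) ^ DIM('a) * exp (- ((norm x)\<^sup>2 / (4 * \<epsilon>)))))"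
proof -
  let ?f = "\<lambda>b t. exp (\<i> * of_real ((x \<bullet> b) * t)) * complex_of_real (exp (- (\<epsilon> * t\<^sup>2)))"
  let ?g = "\<lambda>y::'a. exp (\<i> * of_real (x \<bullet> y)) * complex_of_real (exp (- (\<epsilon> * (norm y)\<^sup>2)))"
  let ?K = "sqrt pi / \<epsilon> powr (1/2)"
  let ?P = "\<Pi>\<^sub>M b\<in>Basis. (lborel :: real measure)" and ?h = "\<lambda>u. \<Sum>b\<in>Basis. u b *\<^sub>R (b::'a)"
  have norm2: "(norm y)\<^sup>2 = (\<Sum>b\<in>Basis. (y \<bullet> b)\<^sup>2)" for y :: 'a
    unfolding power2_norm_eq_inner by (subst euclidean_inner) (simp add: power2_eq_square)
  have i1: "integrable lborel (?f b)" and v1: "integral\<^sup>L lborel (?f b) = of_real (?K * exp (- ((x \<bullet> b)\<^sup>2 / (4 * \<epsilon>))))" for b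
    using fourier_gaussian_1d[OF \<epsilon>, of "x \<bullet> b"] by (simp_all only: has_bochner_integral_iff)
  have prod_eq: "?g (?h u) = (\<Prod>b\<in>Basis. ?f b (u b))" for u
  proof -
    have comp: "?h u \<bullet> b = u b" if "b \<in> Basis" for b using that by simp
    have "x \<bullet> ?h u = (\<Sum>b\<in>Basis. (x \<bullet> b) * u b)"
      by (simp add: inner_sum_right mult.commute)
    moreover have "(norm (?h u))\<^sup>2 = (\<Sum>b\<in>Basis. (u b)\<^sup>2)"
      unfolding norm2 by (intro sum.cong refl) (simp add: comp)
    ultimately have "?g (?h u) = exp (\<Sum>b\<in>Basis. \<i> * of_real ((x \<bullet> b) * u b)) * of_real (exp (\<Sum>b\<in>Basis. - (\<epsilon> * (u b)\<^sup>2)))"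
      by (simp only: of_real_sum sum_distrib_left sum_negf)
    also have "\<dots> = (\<Prod>b\<in>Basis. ?f b (u b))"
      by (simp only: exp_sum[OF finite_Basis] of_real_prod prod.distrib)
    finally show ?thesis .
  qed
  have meas_h: "?h \<in> measurable ?P borel" by measurable
  have meas_g: "?g \<in> borel_measurable borel"
    by (intro borel_measurable_continuous_onI continuous_intros)
  have "integrable ?P (\<lambda>u. \<Prod>b\<in>Basis. ?f b (u b))"
    by (rule lborel_product.product_integrable_prod, rule finite_Basis, rule i1)
  moreover have "(\<integral>u. (\<Prod>b\<in>Basis. ?f b (u b)) \<partial>?P) = (\<Prod>b\<in>Basis. integral\<^sup>L lborel (?f b))"
    by (rule lborel_product.product_integral_prod, rule finite_Basis, rule i1)
  ultimately have "has_bochner_integral ?P (\<lambda>u. ?g (?h u)) (\<Prod>b\<in>Basis. integral\<^sup>L lborel (?f b))"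
    unfolding prod_eq by (simp only: has_bochner_integral_iff simp_thms)
  then have "has_bochner_integral (distr ?P borel ?h) ?g (\<Prod>b\<in>Basis. integral\<^sup>L lborel (?f b))"
    by (rule has_bochner_integral_distr[OF meas_g meas_h])
  moreover have "(\<Prod>b\<in>Basis. integral\<^sup>L lborel (?f b)) = of_real (?K ^ DIM('a) * exp (- ((norm x)\<^sup>2 / (4 * \<epsilon>))))"
  proof -
    have "(\<Prod>b\<in>Basis. ?K * exp (- ((x \<bullet> b)\<^sup>2 / (4 * \<epsilon>)))) = ?K ^ DIM('a) * exp (- ((norm x)\<^sup>2 / (4 * \<epsilon>)))"
      unfolding prod.distrib exp_sum[OF finite_Basis, symmetric] norm2
      by (simp add: sum_negf sum_divide_distrib)
    then show ?thesis unfolding v1 of_real_prod[symmetric] by (simp only:)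
  qed
  ultimately show ?thesis unfolding lborel_eq[symmetric] by (simp only:)
qed

text \<open>The surface area of the unit sphere of \<open>\<real>\<^sup>d\<close>.\<close>
definition sphere_constant :: "nat \<Rightarrow> real" where
  "sphere_constant d = 2 * sqrt pi ^ d / Gamma (real d / 2)"

lemma sphere_constant_pos: "d > 0 \<Longrightarrow> sphere_constant d > 0"
  by (simp add: sphere_constant_def Gamma_real_pos)

text \<open>Both sides are linear in \<open>F\<close>. They agree on Gaussians, where
  \<open>sphere_constant d\<close> is by definition the ratio of the prefactors in
  \<open>fourier_gaussian\<close> and \<open>Omega_gaussian\<close>. A Gaussian-weighted
  approximation of \<open>F\<close> perturbs either side by a small multiple of a fixed
  integral.\<close>

lemma radial_fourier_transform:
  fixes F :: "real \<Rightarrow> real" and x :: "'a::euclidean_space"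
  assumes cont: "continuous_on {0..} F" and supp: "\<And>t. t > R \<Longrightarrow> F t = 0"
  shows "has_bochner_integral lborel (\<lambda>y. exp (\<i> * of_real (x \<bullet> y)) * of_real (F (norm y)))
    (of_real (sphere_constant DIM('a) *
      (\<integral>t. Omega ((real DIM('a) - 2) / 2) (norm x * t) * (indicator {0..} t * (F t * t ^ (DIM('a) - 1))) \<partial>lborel)))"
proof -
  let ?d = "DIM('a)" and ?l = "(real DIM('a) - 2) / 2"
  let ?E = "\<lambda>y::'a. exp (\<i> * complex_of_real (x \<bullet> y))"
  let ?O = "\<lambda>t. Omega ?l (norm x * t)"
  let ?w = "\<lambda>t::real. indicator {0..} t * t ^ (?d - 1)"
  let ?\<kappa> = "sphere_constant ?d"
  have d: "?d > 0" by simp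
  have "Gamma (real ?d / 2) > 0" by (intro Gamma_real_pos) simp
  then have G: "Gamma (real ?d / 2) \<noteq> 0" by (rule less_imp_neq[symmetric])
  have l: "?l \<ge> -1/2" using DIM_ge_Suc0[where 'a = 'a] by simp
  have gA: "has_bochner_integral lborel (\<lambda>y. ?E y * of_real (exp (- (\<epsilon> * (norm y)\<^sup>2))))
      (of_real (?\<kappa> * (\<integral>t. ?O t * (?w t * exp (- (\<epsilon> * t\<^sup>2))) \<partial>lborel)))"
    and gB: "integrable lborel (\<lambda>t. ?O t * (?w t * exp (- (\<epsilon> * t\<^sup>2))))" if \<epsilon>: "\<epsilon> > 0" for \<epsilon>
  proof -
    have w: "?w t * exp (- (\<epsilon> * t\<^sup>2)) = indicator {0..} t * (exp (- (\<epsilon> * t\<^sup>2)) * t ^ (?d - 1))" for t by simp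
    have hb: "has_bochner_integral lborel (\<lambda>t. ?O t * (?w t * exp (- (\<epsilon> * t\<^sup>2))))
        (Gamma (real ?d / 2) / (2 * \<epsilon> powr (real ?d / 2)) * exp (- ((norm x)\<^sup>2 / (4 * \<epsilon>))))"
      unfolding w by (rule Omega_gaussian[OF d \<epsilon>])
    then show "integrable lborel (\<lambda>t. ?O t * (?w t * exp (- (\<epsilon> * t\<^sup>2))))" by (simp only: has_bochner_integral_iff)
    have "(\<epsilon> powr (1/2)) ^ ?d = \<epsilon> powr (real ?d / 2)"
      using \<epsilon> by (simp add: powr_powr[symmetric] powr_realpow[symmetric] powr_powr)
    then have "(sqrt pi / \<epsilon> powr (1/2)) ^ ?d * exp (- ((norm x)\<^sup>2 / (4 * \<epsilon>))) =
        ?\<kappa> * (\<integral>t. ?O t * (?w t * exp (- (\<epsilon> * t\<^sup>2))) \<partial>lborel)"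
      unfolding has_bochner_integral_integral_eq[OF hb] sphere_constant_def using G \<epsilon> by (simp add: power_divide)
    with fourier_gaussian[OF \<epsilon>, of x]
    show "has_bochner_integral lborel (\<lambda>y. ?E y * of_real (exp (- (\<epsilon> * (norm y)\<^sup>2))))
      (of_real (?\<kappa> * (\<integral>t. ?O t * (?w t * exp (- (\<epsilon> * t\<^sup>2))) \<partial>lborel)))" by (simp only:)
  qed
  have iG: "integrable lborel (\<lambda>y::'a. exp (- (1 * (norm y)\<^sup>2)))"
  proof -
    have "integrable lborel (\<lambda>y::'a. norm (?E y * of_real (exp (- (1 * (norm y)\<^sup>2)))))"
      using gA[of 1] by (intro integrable_norm) (simp add: has_bochner_integral_iff)
    then show ?thesis by (simp add: norm_mult)
  qed
  have iw: "integrable lborel (\<lambda>t. ?w t * exp (- (1 * t\<^sup>2)))"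
    using Omega_gaussian[OF d, of 1 0] l by (simp add: has_bochner_integral_iff mult_ac)
  \<comment> \<open>\<open>I1\<close> and \<open>I2\<close> are the masses of
    \<open>exp (- t\<^sup>2)\<close> in space and in the radial variable; they turn the pointwise
    approximation error into bounds for the two integrals.\<close>
  define I1 where "I1 = (\<integral>y. exp (- (1 * (norm (y::'a))\<^sup>2)) \<partial>lborel)"
  define I2 where "I2 = (\<integral>t. ?w t * exp (- (1 * t\<^sup>2)) \<partial>lborel)"
  have contF: "continuous_on UNIV (\<lambda>y::'a. F (norm y))"
    by (rule continuous_on_compose2[OF cont continuous_on_norm_id]) auto
  have mF: "(\<lambda>y::'a. F (norm y)) \<in> borel_measurable borel"
    by (rule borel_measurable_continuous_onI[OF contF])
  have mF1: "(\<lambda>t. indicator {0..} t * F t) \<in> borel_measurable borel"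
  proof -
    have "(\<lambda>t. if t \<in> {0..} then F t else 0) \<in> borel_measurable borel"
      by (rule borel_measurable_continuous_on_if) (auto intro: cont)
    moreover have "(\<lambda>t. if t \<in> {0..} then F t else 0) = (\<lambda>t. indicator {0..} t * F t)" by (auto simp: indicator_def)
    ultimately show ?thesis by simp
  qed
  have [measurable]: "Omega ?l \<in> borel_measurable borel" using l by (intro borel_measurable_Omega) auto
  let ?A = "\<integral>y. ?E y * of_real (F (norm y)) \<partial>lborel" and ?B = "\<integral>t. ?O t * (indicator {0..} t * (F t * t ^ (?d - 1))) \<partial>lborel"
  have approx: "integrable lborel (\<lambda>y. ?E y * complex_of_real (F (norm y))) \<and>
      cmod (?A - of_real (?\<kappa> * ?B)) \<le> \<eta> * (I1 + ?\<kappa> * I2)" if \<eta>: "\<eta> > 0" for \<eta>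
  proof -
    have "\<exists>(a :: nat \<Rightarrow> real) N. \<forall>t\<ge>0. \<bar>F t - (\<Sum>n\<le>N. a n * exp (- (real (Suc n) * t\<^sup>2)))\<bar> \<le> \<eta> * exp (- t\<^sup>2)"
      by (rule gauss_approximation[OF cont _ \<eta>, of R]) (rule supp)
    then obtain a :: "nat \<Rightarrow> real" and N :: nat where p:
      "\<forall>t\<ge>0. \<bar>F t - (\<Sum>n\<le>N. a n * exp (- (real (Suc n) * t\<^sup>2)))\<bar> \<le> \<eta> * exp (- t\<^sup>2)"
      by (elim exE)
    let ?p = "\<lambda>t. \<Sum>n\<le>N. a n * exp (- (real (Suc n) * t\<^sup>2))"
    let ?Bn = "\<lambda>n. \<integral>t. ?O t * (?w t * exp (- (real (Suc n) * t\<^sup>2))) \<partial>lborel"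
    have hA: "has_bochner_integral lborel (\<lambda>y. ?E y * of_real (?p (norm y))) (\<Sum>n\<le>N. of_real (a n) * of_real (?\<kappa> * ?Bn n))"
    proof -
      have "has_bochner_integral lborel (\<lambda>y. \<Sum>n\<le>N. of_real (a n) * (?E y * of_real (exp (- (real (Suc n) * (norm y)\<^sup>2)))))
          (\<Sum>n\<le>N. of_real (a n) * of_real (?\<kappa> * ?Bn n))"
        by (intro has_bochner_integral_sum has_bochner_integral_mult_right gA) simp
      moreover have "(\<Sum>n\<le>N. of_real (a n) * (e * of_real (u n))) = e * of_real (\<Sum>n\<le>N. a n * u n)" for e :: complex and u
        unfolding of_real_sum sum_distrib_left by (intro sum.cong refl) simp
      ultimately show ?thesis by (simp only:)
    qed
    have hB: "has_bochner_integral lborel (\<lambda>t. ?O t * (?w t * ?p t)) (\<Sum>n\<le>N. a n * ?Bn n)"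
    proof -
      have "has_bochner_integral lborel (\<lambda>t. \<Sum>n\<le>N. a n * (?O t * (?w t * exp (- (real (Suc n) * t\<^sup>2)))))
          (\<Sum>n\<le>N. a n * ?Bn n)"
        by (intro has_bochner_integral_sum has_bochner_integral_mult_right has_bochner_integral_integrable gB) simp
      moreover have "(\<Sum>n\<le>N. a n * (e * (v * u n))) = e * (v * (\<Sum>n\<le>N. a n * u n))" for e v :: real and u
        unfolding sum_distrib_left by (intro sum.cong refl) simp
      ultimately show ?thesis by (simp only:)
    qed
    have AB: "(\<Sum>n\<le>N. of_real (a n) * of_real (?\<kappa> * ?Bn n)) = complex_of_real (?\<kappa> * (\<Sum>n\<le>N. a n * ?Bn n))"
      unfolding sum_distrib_left of_real_sum by (intro sum.cong refl) simp
    let ?r = "\<lambda>y. ?E y * of_real (F (norm y) - ?p (norm y))"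
    have r_bound: "cmod (?r y) \<le> \<eta> * exp (- (1 * (norm y)\<^sup>2))" for y
      using p[rule_format, of "norm y"] by (simp add: norm_mult del: of_real_diff)
    have ir: "integrable lborel ?r"
    proof (rule Bochner_Integration.integrable_bound)
      show "integrable lborel (\<lambda>y::'a. \<eta> * exp (- (1 * (norm y)\<^sup>2)))" by (intro integrable_mult_right iG)
      have "(\<lambda>y::'a. ?p (norm y)) \<in> borel_measurable borel" by measurable
      with mF have m: "(\<lambda>y::'a. F (norm y) - ?p (norm y)) \<in> borel_measurable borel" by (rule borel_measurable_diff)
      have "complex_of_real \<in> borel_measurable borel" by (intro borel_measurable_continuous_onI continuous_intros)
      from measurable_compose[OF m this]
      have "(\<lambda>y::'a. complex_of_real (F (norm y) - ?p (norm y))) \<in> borel_measurable borel" .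
      moreover have "?E \<in> borel_measurable borel" by (intro borel_measurable_continuous_onI continuous_intros)
      ultimately show "?r \<in> borel_measurable lborel" by (simp only: measurable_lborel2) (intro borel_measurable_times)
      show "AE y in lborel. norm (?r y) \<le> norm (\<eta> * exp (- (1 * (norm y)\<^sup>2)))"
        unfolding real_norm_def by (intro always_eventually allI order_trans[OF r_bound abs_ge_self])
    qed
    have hA': "has_bochner_integral lborel (\<lambda>y. ?r y + ?E y * of_real (?p (norm y)))
        (integral\<^sup>L lborel ?r + of_real (?\<kappa> * (\<Sum>n\<le>N. a n * ?Bn n)))"
      using has_bochner_integral_add[OF has_bochner_integral_integrable[OF ir] hA] unfolding AB .
    have eA: "?r y + ?E y * of_real (?p (norm y)) = ?E y * of_real (F (norm y))" for y
      by (simp only: distrib_left[symmetric] of_real_add[symmetric] diff_add_cancel)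
    have nA: "cmod (integral\<^sup>L lborel ?r) \<le> \<eta> * I1"
    proof -
      have "cmod (integral\<^sup>L lborel ?r) \<le> (\<integral>y. cmod (?r y) \<partial>lborel)" by (rule integral_norm_bound)
      also have "\<dots> \<le> (\<integral>y. \<eta> * exp (- (1 * (norm (y::'a))\<^sup>2)) \<partial>lborel)"
        by (rule integral_mono[OF integrable_norm[OF ir] integrable_mult_right[OF iG] r_bound])
      also have "\<dots> = \<eta> * I1" unfolding I1_def by (rule integral_mult_right_zero)
      finally show ?thesis .
    qed
    let ?s = "\<lambda>t. ?O t * (?w t * (F t - ?p t))"
    have s_bound: "\<bar>?s t\<bar> \<le> \<eta> * (?w t * exp (- (1 * t\<^sup>2)))" for t
    proof (cases "t \<ge> 0")
      case True
      have "\<bar>?O t\<bar> * (t ^ (?d - 1) * \<bar>F t - ?p t\<bar>) \<le> 1 * (t ^ (?d - 1) * (\<eta> * exp (- t\<^sup>2)))"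
        using True p by (intro mult_mono abs_Omega_le_1[OF l] mult_left_mono) auto
      then show ?thesis using True by (simp add: abs_mult mult_ac)
    qed simp
    have iS: "integrable lborel ?s"
    proof (rule Bochner_Integration.integrable_bound)
      show "integrable lborel (\<lambda>t. \<eta> * (?w t * exp (- (1 * t\<^sup>2))))" by (intro integrable_mult_right iw)
      have "(\<lambda>t. ?O t * (t ^ (?d - 1) * (indicator {0..} t * F t - indicator {0..} t * ?p t))) \<in> borel_measurable borel"
        using mF1 by measurable
      moreover have "(\<lambda>t. ?O t * (t ^ (?d - 1) * (indicator {0..} t * F t - indicator {0..} t * ?p t))) = ?s"
      proof
        have "o' * (m * (i * f - i * q)) = o' * (i * m * (f - q))" for o' m i f q :: real
          by (simp add: algebra_simps)
        then show "?O t * (t ^ (?d - 1) * (indicator {0..} t * F t - indicator {0..} t * ?p t)) = ?s t" for t .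
      qed
      ultimately show "?s \<in> borel_measurable lborel" by (simp only: measurable_lborel2)
      show "AE t in lborel. norm (?s t) \<le> norm (\<eta> * (?w t * exp (- (1 * t\<^sup>2))))"
        unfolding real_norm_def by (intro always_eventually allI order_trans[OF s_bound abs_ge_self])
    qed
    have hB': "has_bochner_integral lborel (\<lambda>t. ?s t + ?O t * (?w t * ?p t)) (integral\<^sup>L lborel ?s + (\<Sum>n\<le>N. a n * ?Bn n))"
      by (rule has_bochner_integral_add[OF has_bochner_integral_integrable[OF iS] hB])
    have eB: "?s t + ?O t * (?w t * ?p t) = ?O t * (indicator {0..} t * (F t * t ^ (?d - 1)))" for t
    proof -
      have "o' * (i * m * (f - q)) + o' * (i * m * q) = o' * (i * (f * m))" for o' i m f q :: real
        by (simp add: algebra_simps)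
      then show ?thesis .
    qed
    have nB: "\<bar>integral\<^sup>L lborel ?s\<bar> \<le> \<eta> * I2"
    proof -
      have "\<bar>integral\<^sup>L lborel ?s\<bar> \<le> (\<integral>t. \<bar>?s t\<bar> \<partial>lborel)" by (rule integral_abs_bound)
      also have "\<dots> \<le> (\<integral>t. \<eta> * (?w t * exp (- (1 * t\<^sup>2))) \<partial>lborel)"
        by (rule integral_mono[OF Bochner_Integration.integrable_abs[OF iS] integrable_mult_right[OF iw] s_bound])
      also have "\<dots> = \<eta> * I2" unfolding I2_def by (rule integral_mult_right_zero)
      finally show ?thesis .
    qed
    have A_eq: "?A = integral\<^sup>L lborel ?r + of_real (?\<kappa> * (\<Sum>n\<le>N. a n * ?Bn n))"
      using has_bochner_integral_integral_eq[OF hA'] unfolding eA .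
    have B_eq: "?B = integral\<^sup>L lborel ?s + (\<Sum>n\<le>N. a n * ?Bn n)"
      using has_bochner_integral_integral_eq[OF hB'] unfolding eB .
    have "?A - of_real (?\<kappa> * ?B) = integral\<^sup>L lborel ?r - of_real (?\<kappa> * integral\<^sup>L lborel ?s)"
      unfolding A_eq B_eq by (simp add: algebra_simps)
    then have "cmod (?A - of_real (?\<kappa> * ?B)) \<le> cmod (integral\<^sup>L lborel ?r) + cmod (of_real (?\<kappa> * integral\<^sup>L lborel ?s))"
      by (simp only: norm_triangle_ineq4)
    moreover have "cmod (of_real (?\<kappa> * integral\<^sup>L lborel ?s)) \<le> ?\<kappa> * (\<eta> * I2)"
      unfolding norm_of_real abs_mult using sphere_constant_pos[OF d] nB by (simp add: mult_left_mono)
    moreover have "\<eta> * (I1 + ?\<kappa> * I2) = \<eta> * I1 + ?\<kappa> * (\<eta> * I2)" by (simp add: algebra_simps)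
    moreover have "integrable lborel (\<lambda>y. ?E y * complex_of_real (F (norm y)))"
      using hA' unfolding eA by (simp only: has_bochner_integral_iff)
    ultimately show ?thesis using nA by linarith
  qed
  define L where "L = I1 + ?\<kappa> * I2"
  have L0: "L \<ge> 0"
  proof -
    have "I1 \<ge> 0" "I2 \<ge> 0" unfolding I1_def I2_def by (auto intro!: Bochner_Integration.integral_nonneg simp: indicator_def)
    then show ?thesis using sphere_constant_pos[OF d] by (simp add: L_def)
  qed
  have "cmod (?A - of_real (?\<kappa> * ?B)) \<le> 0"
  proof (rule field_le_epsilon)
    fix e :: real assume e: "e > 0"
    have "e / (L + 1) > 0" using e L0 by simp
    then have "cmod (?A - of_real (?\<kappa> * ?B)) \<le> e / (L + 1) * L"
      using approx unfolding L_def by blast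
    also have "\<dots> \<le> e / (L + 1) * (L + 1)" using e L0 by (intro mult_left_mono) auto
    also have "\<dots> = 0 + e" using L0 by simp
    finally show "cmod (?A - of_real (?\<kappa> * ?B)) \<le> 0 + e" .
  qed
  then have "?A = of_real (?\<kappa> * ?B)" by simp
  then show ?thesis
    unfolding has_bochner_integral_iff using approx[OF zero_less_one, THEN conjunct1] by (intro conjI)
qed

section \<open>Positive definiteness from a nonnegative density\<close>

text \<open>A limit of nonnegative forms is in general only nonnegative. Monotonicity bounds every
  \<open>T n\<close> by the limit, so a vanishing limit forces each \<open>T n\<close> to vanish,
  and strictness survives.\<close>

lemma positive_quadratic_form_limit:
  fixes S :: complex and T :: "nat \<Rightarrow> real"
  assumes lim: "(\<lambda>n. complex_of_real (T n)) \<longlonglongrightarrow> S" and mono: "\<And>n. T n \<le> T (Suc n)" and pos: "\<And>n. 0 \<le> T n"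
  shows "S \<in> \<real>\<^sub>\<ge>\<^sub>0" and "S = 0 \<Longrightarrow> T n = 0"
proof -
  have re: "T \<longlonglongrightarrow> Re S" using tendsto_Re[OF lim] by simp
  have "(\<lambda>n. 0) \<longlonglongrightarrow> Im S" using tendsto_Im[OF lim] by simp
  then have im: "Im S = 0" by (simp add: LIMSEQ_const_iff)
  have le: "T n \<le> Re S" for n using mono by (intro incseq_le[OF _ re] incseq_SucI)
  show "S \<in> \<real>\<^sub>\<ge>\<^sub>0" using im le[of 0] pos[of 0] by (simp add: complex_nonneg_Reals_iff)
  show "T n = 0" if "S = 0" using le[of n] pos[of n] that by simp
qed

text \<open>The quadratic form is, up to a positive factor, the integral of
  \<open>\<bar>Z y\<bar>\<^sup>2\<close> against the radial density \<open>F\<close>, where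
  \<open>Z\<close> is the exponential sum. Since the radial transform formula is for compact
  support, \<open>F\<close> is cut off and the cutoff removed by dominated convergence.\<close>

lemma radial_positive_definiteI:
  fixes F \<phi> :: "real \<Rightarrow> real"
  assumes d: "d = CARD('n::finite)"
    and cont: "continuous_on {0..} F" and nonneg: "\<And>t. t \<ge> 0 \<Longrightarrow> F t \<ge> 0"
    and int: "integrable lborel (\<lambda>t. indicator {0..} t * (F t * t ^ (d - 1)))"
    and t0: "t0 \<ge> 0" "F t0 > 0" and c: "c > 0"
    and \<phi>: "\<And>r. r \<ge> 0 \<Longrightarrow> \<phi> r = c * (\<integral>t. Omega ((real d - 2) / 2) (r * t) * (indicator {0..} t * (F t * t ^ (d - 1))) \<partial>lborel)"
  shows "radial_positive_definite TYPE('n) \<phi>"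
  unfolding radial_positive_definite_def positive_definite_def Let_def
proof (intro allI impI)
  fix N :: nat and x :: "nat \<Rightarrow> real ^ 'n" and z :: "nat \<Rightarrow> complex"
  assume inj: "inj_on x {..<N}"
  let ?l = "(real d - 2) / 2"
  have dim: "DIM(real ^ 'n) = d" using d by simp
  have dpos: "d > 0" using d by simp
  have l: "?l \<ge> -1/2" using dpos by simp
  \<comment> \<open>Tents that increase to 1 with \<open>n\<close>; the slope starts from
    \<open>t0 + 1\<close>, so already the first one is positive at \<open>t0\<close>.\<close>
  define cut where "cut n t = max 0 (1 - t / (t0 + 1 + real n))" for n :: nat and t
  define Fn where "Fn n t = F t * cut n t" for n t
  have cut01: "0 \<le> cut n t" "t \<ge> 0 \<Longrightarrow> cut n t \<le> 1" for n t
    using t0 by (auto simp: cut_def)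
  have cut_mono: "cut n t \<le> cut (Suc n) t" if "t \<ge> 0" for n t
  proof -
    have "t / (t0 + 1 + real (Suc n)) \<le> t / (t0 + 1 + real n)"
      using that t0 by (intro divide_left_mono mult_pos_pos) auto
    then show ?thesis unfolding cut_def by (intro max.mono) auto
  qed
  have contFn: "continuous_on {0..} (Fn n)" for n
  proof -
    have "t0 + 1 + real n \<noteq> 0" using t0 by simp
    then show ?thesis unfolding Fn_def cut_def by (intro continuous_intros cont) auto
  qed
  have suppFn: "Fn n t = 0" if "t > t0 + 1 + real n" for n t
  proof -
    have "t / (t0 + 1 + real n) \<ge> 1" using that t0 by simp
    then show ?thesis by (simp add: Fn_def cut_def)
  qed
  have Fn_nonneg: "0 \<le> Fn n t" and Fn_mono: "Fn n t \<le> Fn (Suc n) t" if "t \<ge> 0" for n t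
    unfolding Fn_def using nonneg[OF that] cut01(1) cut_mono[OF that] by (auto intro: mult_nonneg_nonneg mult_left_mono)
  define H where "H n r = (\<integral>t. Omega ?l (r * t) * (indicator {0..} t * (Fn n t * t ^ (d - 1))) \<partial>lborel)" for n r
  define Hi where "Hi r = (\<integral>t. Omega ?l (r * t) * (indicator {0..} t * (F t * t ^ (d - 1))) \<partial>lborel)" for r
  have Hlim: "(\<lambda>n. H n r) \<longlonglongrightarrow> Hi r" for r
    unfolding H_def Hi_def
  proof (rule integral_dominated_convergence[where w = "\<lambda>t. \<bar>indicator {0..} t * (F t * t ^ (d - 1))\<bar>"])
    have [measurable]: "Omega ?l \<in> borel_measurable borel" using l by (intro borel_measurable_Omega) auto
    have mg: "(\<lambda>t. indicator {0..} t * (F t * t ^ (d - 1))) \<in> borel_measurable borel"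
      using borel_measurable_integrable[OF int] by simp
    show "(\<lambda>t. Omega ?l (r * t) * (indicator {0..} t * (F t * t ^ (d - 1)))) \<in> borel_measurable lborel"
      using mg by measurable
    have "(\<lambda>t. Omega ?l (r * t) * (indicator {0..} t * (F t * t ^ (d - 1))) * cut n t) \<in> borel_measurable borel" for n
      using mg unfolding cut_def by measurable
    then show "(\<lambda>t. Omega ?l (r * t) * (indicator {0..} t * (Fn n t * t ^ (d - 1)))) \<in> borel_measurable lborel" for n
      by (simp add: Fn_def mult_ac)
    show "integrable lborel (\<lambda>t. \<bar>indicator {0..} t * (F t * t ^ (d - 1))\<bar>)"
      by (rule Bochner_Integration.integrable_abs[OF int])
    have "(\<lambda>n. cut n t) \<longlonglongrightarrow> 1" for t
    proof -
      have "(\<lambda>n. 1 - t / (t0 + 1 + real n)) \<longlonglongrightarrow> 1" by real_asymp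
      then have "(\<lambda>n. max 0 (1 - t / (t0 + 1 + real n))) \<longlonglongrightarrow> max 0 1" by (intro tendsto_max tendsto_const)
      then show ?thesis by (simp add: cut_def)
    qed
    then have "(\<lambda>n. Omega ?l (r * t) * (indicator {0..} t * (F t * cut n t * t ^ (d - 1)))) \<longlonglongrightarrow>
        Omega ?l (r * t) * (indicator {0..} t * (F t * 1 * t ^ (d - 1)))" for t
      by (intro tendsto_mult tendsto_const)
    then show "AE t in lborel. (\<lambda>n. Omega ?l (r * t) * (indicator {0..} t * (Fn n t * t ^ (d - 1)))) \<longlonglongrightarrow>
        Omega ?l (r * t) * (indicator {0..} t * (F t * t ^ (d - 1)))"
      by (simp add: Fn_def)
    fix n
    have "\<bar>Omega ?l (r * t) * (indicator {0..} t * (Fn n t * t ^ (d - 1)))\<bar> \<le> \<bar>indicator {0..} t * (F t * t ^ (d - 1))\<bar>" for t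
    proof (cases "t \<ge> 0")
      case True
      have "\<bar>Omega ?l (r * t)\<bar> * (\<bar>cut n t\<bar> * \<bar>F t * t ^ (d - 1)\<bar>) \<le> 1 * (1 * \<bar>F t * t ^ (d - 1)\<bar>)"
        using cut01(1)[of n t] cut01(2)[of t n] True by (intro mult_mono abs_Omega_le_1[OF l] mult_right_mono) auto
      then show ?thesis using True by (simp add: Fn_def abs_mult mult_ac)
    qed simp
    then show "AE t in lborel. norm (Omega ?l (r * t) * (indicator {0..} t * (Fn n t * t ^ (d - 1)))) \<le> \<bar>indicator {0..} t * (F t * t ^ (d - 1))\<bar>"
      unfolding real_norm_def by (intro always_eventually allI)
  qed
  define Z where "Z y = (\<Sum>j<N. z j * exp (\<i> * of_real (x j \<bullet> y)))" for y
  define T where "T n = (\<integral>y. (cmod (Z y))\<^sup>2 * Fn n (norm y) \<partial>lborel)" for n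
  let ?\<kappa> = "sphere_constant d"
  have \<kappa>: "?\<kappa> > 0" by (rule sphere_constant_pos[OF dpos])
  have ft: "has_bochner_integral lborel (\<lambda>y. exp (\<i> * of_real (v \<bullet> y)) * of_real (Fn n (norm y))) (of_real (?\<kappa> * H n (norm v)))"
    for v :: "real ^ 'n" and n
  proof -
    have "has_bochner_integral lborel (\<lambda>y. exp (\<i> * of_real (v \<bullet> y)) * of_real (Fn n (norm y)))
      (of_real (sphere_constant DIM(real ^ 'n) * (\<integral>t. Omega ((real DIM(real ^ 'n) - 2) / 2) (norm v * t) *
        (indicator {0..} t * (Fn n t * t ^ (DIM(real ^ 'n) - 1))) \<partial>lborel)))"
      by (rule radial_fourier_transform[OF contFn]) (rule suppFn)
    then show ?thesis unfolding dim H_def .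
  qed
  \<comment> \<open>The exponential of a difference splits into a conjugate pair, so the double sum
    is \<open>Z y\<close> times its conjugate.\<close>
  have ZZ: "(\<Sum>j<N. \<Sum>k<N. z j * cnj (z k) * (exp (\<i> * of_real ((x j - x k) \<bullet> y)) * of_real f)) = of_real ((cmod (Z y))\<^sup>2 * f)" for y f
  proof -
    have "exp (\<i> * complex_of_real ((x j - x k) \<bullet> y)) = exp (\<i> * of_real (x j \<bullet> y)) * cnj (exp (\<i> * of_real (x k \<bullet> y)))" for j k
      by (simp add: exp_cnj exp_add[symmetric] inner_diff_left algebra_simps)
    then have "(\<Sum>j<N. \<Sum>k<N. z j * cnj (z k) * (exp (\<i> * of_real ((x j - x k) \<bullet> y)) * of_real f)) =
        (\<Sum>j<N. \<Sum>k<N. (z j * exp (\<i> * of_real (x j \<bullet> y))) * cnj (z k * exp (\<i> * of_real (x k \<bullet> y)))) * of_real f"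
      unfolding sum_distrib_right by (intro sum.cong refl) (simp add: mult_ac)
    also have "\<dots> = Z y * cnj (Z y) * of_real f"
      unfolding Z_def cnj_sum sum_product ..
    finally show ?thesis by (simp add: complex_norm_square[symmetric])
  qed
  have hT: "has_bochner_integral lborel (\<lambda>y. complex_of_real ((cmod (Z y))\<^sup>2 * Fn n (norm y)))
      (\<Sum>j<N. \<Sum>k<N. z j * cnj (z k) * of_real (?\<kappa> * H n (norm (x j - x k))))" for n
    unfolding ZZ[symmetric] by (intro has_bochner_integral_sum has_bochner_integral_mult_right ft)
  have iT: "integrable lborel (\<lambda>y. (cmod (Z y))\<^sup>2 * Fn n (norm y))" for n
  proof -
    have "integrable lborel (\<lambda>y. complex_of_real ((cmod (Z y))\<^sup>2 * Fn n (norm y)))"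
      using hT[of n] by (simp only: has_bochner_integral_iff)
    then have "integrable lborel (\<lambda>y. Re (complex_of_real ((cmod (Z y))\<^sup>2 * Fn n (norm y))))"
      by (rule integrable_Re)
    then show ?thesis by (simp only: Re_complex_of_real)
  qed
  have T_eq: "complex_of_real (T n) = (\<Sum>j<N. \<Sum>k<N. z j * cnj (z k) * of_real (?\<kappa> * H n (norm (x j - x k))))" for n
    unfolding T_def
    by (rule has_bochner_integral_eq[OF has_bochner_integral_of_real[OF has_bochner_integral_integrable[OF iT]] hT])
  let ?S = "\<Sum>j<N. \<Sum>k<N. complex_of_real (\<phi> (norm (x j - x k))) * z j * cnj (z k)"
  have lim: "(\<lambda>n. complex_of_real (T n)) \<longlonglongrightarrow> of_real (?\<kappa> / c) * ?S"
  proof -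
    have "(\<lambda>n. complex_of_real (T n)) \<longlonglongrightarrow> (\<Sum>j<N. \<Sum>k<N. z j * cnj (z k) * of_real (?\<kappa> * Hi (norm (x j - x k))))"
      unfolding T_eq by (intro tendsto_sum tendsto_mult tendsto_const tendsto_of_real Hlim)
    also have "(\<Sum>j<N. \<Sum>k<N. z j * cnj (z k) * of_real (?\<kappa> * Hi (norm (x j - x k)))) = of_real (?\<kappa> / c) * ?S"
      unfolding sum_distrib_left
    proof (intro sum.cong refl)
      fix j k
      have "\<phi> (norm (x j - x k)) = c * Hi (norm (x j - x k))" unfolding Hi_def by (intro \<phi>) simp
      then show "z j * cnj (z k) * of_real (?\<kappa> * Hi (norm (x j - x k))) =
          of_real (?\<kappa> / c) * (complex_of_real (\<phi> (norm (x j - x k))) * z j * cnj (z k))"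
        using c by simp
    qed
    finally show ?thesis .
  qed
  have Tnn: "0 \<le> T n" for n
    unfolding T_def by (intro Bochner_Integration.integral_nonneg mult_nonneg_nonneg Fn_nonneg) auto
  have Tmono: "T n \<le> T (Suc n)" for n
    unfolding T_def by (intro integral_mono iT mult_left_mono Fn_mono) auto
  note PL = positive_quadratic_form_limit[OF lim Tmono Tnn]
  have S_eq: "?S = of_real (c / ?\<kappa>) * (of_real (?\<kappa> / c) * ?S)" using c \<kappa> by simp
  have "of_real (c / ?\<kappa>) \<in> \<real>\<^sub>\<ge>\<^sub>0" using c \<kappa> by simp
  then have "of_real (c / ?\<kappa>) * (of_real (?\<kappa> / c) * ?S) \<in> \<real>\<^sub>\<ge>\<^sub>0"
    using PL(1) by (rule nonneg_Reals_mult_I)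
  then have S_nonneg: "?S \<in> \<real>\<^sub>\<ge>\<^sub>0" unfolding S_eq[symmetric] .
  \<comment> \<open>A zero form forces the first truncated integral to vanish. Hence
    \<open>Z\<close> is 0 on the open set where its density is nonzero, a set that contains a point
    of norm \<open>t0\<close>, and the exponentials are independent there.\<close>
  have strict: "\<forall>j<N. z j = 0" if S0: "?S = 0"
  proof -
    have "T 0 = 0" by (rule PL(2)) (simp only: S0 mult_zero_right)
    then have "AE y in lborel. (cmod (Z y))\<^sup>2 * Fn 0 (norm y) = 0"
      unfolding T_def
      by (rule integral_nonneg_eq_0_iff_AE[THEN iffD1, OF iT[of 0] always_eventually, rotated])
        (intro allI mult_nonneg_nonneg Fn_nonneg zero_le_power2 norm_ge_zero)
    then have ae: "AE y in lborel. y \<in> {y. Fn 0 (norm y) \<noteq> 0} \<longrightarrow> (cmod (Z y))\<^sup>2 = 0"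
      by eventually_elim auto
    have "continuous_on UNIV (\<lambda>y::real ^ 'n. Fn 0 (norm y))"
      by (rule continuous_on_compose2[OF contFn continuous_on_norm_id]) auto
    then have "open ((\<lambda>y::real ^ 'n. Fn 0 (norm y)) -` (- {0}))"
      by (intro open_vimage) auto
    then have U: "open {y::real ^ 'n. Fn 0 (norm y) \<noteq> 0}" by (simp add: vimage_def)
    obtain y0 :: "real ^ 'n" where y0: "norm y0 = t0" using vector_choose_size[OF t0(1)] by blast
    have "cut 0 t0 > 0" using t0 by (simp add: cut_def)
    then have "y0 \<in> {y. Fn 0 (norm y) \<noteq> 0}" using t0 y0 by (simp add: Fn_def)
    then have Une: "{y::real ^ 'n. Fn 0 (norm y) \<noteq> 0} \<noteq> {}" by blast
    have contZ: "continuous_on {y. Fn 0 (norm y) \<noteq> 0} (\<lambda>y. (cmod (Z y))\<^sup>2)"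
      unfolding Z_def by (intro continuous_intros)
    have "(cmod (Z y))\<^sup>2 = 0" if "y \<in> {y. Fn 0 (norm y) \<noteq> 0}" for y
      by (rule AE_zero_continuous_on_open[OF U contZ ae that])
    then have Z0: "(\<Sum>j<N. z j * exp (\<i> * of_real (x j \<bullet> y))) = 0" if "y \<in> {y. Fn 0 (norm y) \<noteq> 0}" for y
      using that unfolding Z_def by simp
    show ?thesis
      using exponentials_independent[OF finite_lessThan inj U Une Z0] by simp
  qed
  show "?S \<in> \<real>\<^sub>\<ge>\<^sub>0 \<and> (?S = 0 \<longrightarrow> (\<forall>j<N. z j = 0))"
    using S_nonneg strict by (intro conjI impI)
qed

section \<open>Integrability of \<open>W\<close> and the inversion formula\<close>

lemma integrable_shifted_power:
  assumes "p > 1"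
  shows "integrable lborel (\<lambda>r::real. indicator {0..} r * (1 + r) powr (- p))"
proof -
  have hi: "((\<lambda>x::real. x powr (- p)) has_integral - (1 powr (- p + 1)) / (- p + 1)) {1..}"
    using assms by (intro has_integral_powr_to_inf) auto
  have "(\<integral>\<^sup>+x. ennreal (indicator {1..} x * x powr (- p)) \<partial>lborel) = ennreal (- (1 powr (- p + 1)) / (- p + 1))"
    by (rule nn_integral_has_integral_lebesgue[OF _ hi]) simp
  then have "integrable lborel (\<lambda>x::real. indicator {1..} x * x powr (- p))"
    by (intro integrableI_nonneg) (auto intro!: always_eventually simp: indicator_def)
  then have "integrable lborel (\<lambda>r::real. indicator {1..} (1 + 1 * r) * (1 + 1 * r) powr (- p))"
    by (subst lborel_integrable_real_affine_iff) auto
  moreover have "indicator {1..} (1 + 1 * r) = (indicator {0..} r :: real)" for r :: real by (simp add: indicator_def)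
  ultimately show ?thesis by simp
qed

text \<open>The decay of \<open>W\<close> against \<open>r ^ (d - 1)\<close> leaves the exponent
  \<open>- (2 * \<delta> - d + 1)\<close>, below -1 precisely because
  \<open>\<delta> > d / 2\<close>.\<close>

lemma integrable_W:
  assumes \<delta>: "\<delta> > 1" "\<delta> > real d / 2" and d: "d > 0"
  shows "integrable lborel (\<lambda>r. indicator {0..} r * (W \<delta> r * r ^ (d - 1)))"
proof -
  obtain c where c: "\<And>r. r \<ge> 0 \<Longrightarrow> W \<delta> r \<le> c * (1 + r) powr (- 2 * \<delta>)"
    using W_comparable[OF \<delta>(1)] unfolding comparable_on_def by auto
  show ?thesis
  proof (rule Bochner_Integration.integrable_bound)
    show "integrable lborel (\<lambda>r::real. c * (indicator {0..} r * (1 + r) powr (- (2 * \<delta> - real d + 1))))"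
      using \<delta> by (intro integrable_mult_right integrable_shifted_power) auto
    have [measurable]: "W \<delta> \<in> borel_measurable borel" using \<delta> by (intro borel_measurable_W) auto
    show "(\<lambda>r. indicator {0..} r * (W \<delta> r * r ^ (d - 1))) \<in> borel_measurable lborel" by measurable
    have "\<bar>indicator {0..} r * (W \<delta> r * r ^ (d - 1))\<bar> \<le> c * (indicator {0..} r * (1 + r) powr (- (2 * \<delta> - real d + 1)))" for r
    proof (cases "r \<ge> 0")
      case True
      have "r ^ (d - 1) \<le> (1 + r) ^ (d - 1)" using True by (intro power_mono) auto
      also have "\<dots> = (1 + r) powr (real d - 1)" using True d by (simp add: powr_realpow[symmetric] of_nat_diff)
      finally have "W \<delta> r * r ^ (d - 1) \<le> (c * (1 + r) powr (- 2 * \<delta>)) * (1 + r) powr (real d - 1)"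
        using c[OF True] W_pos[OF \<delta>(1) True] True by (intro mult_mono) auto
      also have "\<dots> = c * ((1 + r) powr (- 2 * \<delta>) * (1 + r) powr (real d - 1))" by simp
      also have "(1 + r) powr (- 2 * \<delta>) * (1 + r) powr (real d - 1) = (1 + r) powr (- (2 * \<delta> - real d + 1))"
        unfolding powr_add[symmetric] by (rule arg_cong[where f = "\<lambda>p. (1 + r) powr p"]) simp
      finally show ?thesis using W_pos[OF \<delta>(1) True] True by simp
    qed simp
    then show "AE r in lborel. norm (indicator {0..} r * (W \<delta> r * r ^ (d - 1))) \<le>
        norm (c * (indicator {0..} r * (1 + r) powr (- (2 * \<delta> - real d + 1))))"
      unfolding real_norm_def by (intro always_eventually allI order_trans[OF _ abs_ge_self])
  qed
qed

text \<open>The difference of the two sides integrates to 0 against every Gaussian. Two applications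
  of \<open>hankel_gauss_swap\<close> take the Gaussian parameter from \<open>\<epsilon>\<close> to
  \<open>1 / (4 * \<epsilon>)\<close> and back, which reproduces the Gaussian integral of
  \<open>Phi\<close> up to a constant; continuity then gives pointwise equality.\<close>

lemma Phi_inversion:
  assumes \<delta>: "\<delta> > 1" "\<delta> > real d / 2" and d: "d > 0" and t: "t \<ge> 0"
  shows "Phi d \<delta> t = 1 / (2 powr (real d - 2) * (Gamma (real d / 2))\<^sup>2 * omega d \<delta>) *
    (\<integral>r. Omega ((real d - 2) / 2) (t * r) * (indicator {0..} r * (W \<delta> r * r ^ (d - 1))) \<partial>lborel)"
proof -
  let ?l = "(real d - 2) / 2"
  let ?gW = "\<lambda>r. indicator {0..} r * (W \<delta> r * r ^ (d - 1))" and ?gP = "\<lambda>t. indicator {0..} t * (Phi d \<delta> t * t ^ (d - 1))"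
  let ?\<omega> = "omega d \<delta>" and ?G = "Gamma (real d / 2)"
  have om: "?\<omega> > 0" by (rule omega_pos[OF d \<delta>(2)])
  have G: "?G > 0" using d by (intro Gamma_real_pos) auto
  have l: "?l \<ge> -1/2" "?l > -1" using d by auto
  have iW: "integrable lborel ?gW" by (rule integrable_W[OF \<delta> d])
  have iP: "integrable lborel ?gP"
    using W_eq_Phi_average[OF d \<delta>, of 0] l by (simp add: has_bochner_integral_iff)
  define K where "K = 1 / (2 powr (real d - 2) * ?G\<^sup>2 * ?\<omega>)"
  define \<Psi> where "\<Psi> t = (\<integral>r. Omega ?l (t * r) * ?gW r \<partial>lborel)" for t
  define D where "D t = Phi d \<delta> t - K * \<Psi> t" for t
  have "D t = 0"
  proof (rule gaussian_integrals_determine[OF _ _ t])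
    show "continuous_on {0..} D"
      unfolding D_def \<Psi>_def by (intro continuous_intros continuous_on_Phi \<delta> continuous_on_Omega_transform l iW)
    fix \<epsilon> :: real assume \<epsilon>: "\<epsilon> > 0"
    let ?\<epsilon>' = "1 / (4 * \<epsilon>)"
    have \<epsilon>': "?\<epsilon>' > 0" using \<epsilon> by simp
    have inv: "1 / (4 * ?\<epsilon>') = \<epsilon>" using \<epsilon> by simp
    define IP where "IP = (\<integral>t. ?gP t * exp (- (\<epsilon> * t\<^sup>2)) \<partial>lborel)"
    have hP: "has_bochner_integral lborel (\<lambda>t. ?gP t * exp (- (\<epsilon> * t\<^sup>2))) IP"
      unfolding IP_def
    proof (rule has_bochner_integral_integrable, rule Bochner_Integration.integrable_bound[OF iP])
      have "?gP \<in> borel_measurable borel" using borel_measurable_integrable[OF iP] by simp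
      then show "(\<lambda>t. ?gP t * exp (- (\<epsilon> * t\<^sup>2))) \<in> borel_measurable lborel" by measurable
      show "AE t in lborel. norm (?gP t * exp (- (\<epsilon> * t\<^sup>2))) \<le> norm (?gP t)"
        using \<epsilon> by (intro always_eventually allI) (simp add: abs_mult mult_left_le)
    qed
    have avg: "(\<integral>t. Omega ?l (r * t) * ?gP t \<partial>lborel) = W \<delta> r / ?\<omega>" for r
      by (rule has_bochner_integral_integral_eq[OF W_eq_Phi_average[OF d \<delta>]])
    have h1: "has_bochner_integral lborel (\<lambda>r. indicator {0..} r * (W \<delta> r / ?\<omega> * r ^ (d - 1)) * exp (- (?\<epsilon>' * r\<^sup>2)))
        (?G / (2 * ?\<epsilon>' powr (real d / 2)) * IP)"
      using hankel_gauss_swap[OF d iP \<epsilon>'] unfolding avg inv IP_def .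
    have IW: "(\<integral>r. ?gW r * exp (- (1 / (4 * \<epsilon>) * r\<^sup>2)) \<partial>lborel) = ?\<omega> * (?G / (2 * ?\<epsilon>' powr (real d / 2)) * IP)"
    proof -
      have "has_bochner_integral lborel (\<lambda>r. ?\<omega> * (indicator {0..} r * (W \<delta> r / ?\<omega> * r ^ (d - 1)) * exp (- (?\<epsilon>' * r\<^sup>2))))
          (?\<omega> * (?G / (2 * ?\<epsilon>' powr (real d / 2)) * IP))"
        by (rule has_bochner_integral_mult_right) (rule h1)
      moreover have "?\<omega> * (i * (w / ?\<omega> * q) * e) = i * (w * q) * e" for i w q e :: real using om by simp
      ultimately show ?thesis by (simp only: has_bochner_integral_integral_eq)
    qed
    have h2: "has_bochner_integral lborel (\<lambda>t. indicator {0..} t * (\<Psi> t * t ^ (d - 1)) * exp (- (\<epsilon> * t\<^sup>2)))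
        (?G / (2 * \<epsilon> powr (real d / 2)) * (?\<omega> * (?G / (2 * ?\<epsilon>' powr (real d / 2)) * IP)))"
      using hankel_gauss_swap[OF d iW \<epsilon>] unfolding IW \<Psi>_def .
    \<comment> \<open>The product of the parameters \<open>\<epsilon>\<close> and
      \<open>1 / (4 * \<epsilon>)\<close> is \<open>1 / 4\<close>, so the two prefactors multiply to
      \<open>2 powr (d - 2)\<close> times the square of \<open>Gamma (d / 2)\<close>, independently
      of \<open>\<epsilon>\<close>.\<close>
    have const: "K * (?G / (2 * \<epsilon> powr (real d / 2)) * (?\<omega> * (?G / (2 * ?\<epsilon>' powr (real d / 2)) * IP))) = IP"
    proof -
      have "\<epsilon> powr (real d / 2) * ?\<epsilon>' powr (real d / 2) = (1 / 4) powr (real d / 2)"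
        using \<epsilon> by (simp add: powr_mult[symmetric])
      also have "(1 / 4 :: real) = 2 powr (- 2)" by (simp add: powr_minus powr_numeral)
      also have "(2 powr (- 2)) powr (real d / 2) = 2 powr (- real d)" by (simp add: powr_powr)
      finally have e: "\<epsilon> powr (real d / 2) * ?\<epsilon>' powr (real d / 2) = 2 powr (- real d)" .
      have "4 * 2 powr (- real d) * 2 powr (real d - 2) = (1::real)"
        by (simp add: powr_diff powr_minus powr_numeral)
      then have p: "4 * (\<epsilon> powr (real d / 2) * ?\<epsilon>' powr (real d / 2)) * 2 powr (real d - 2) = 1" unfolding e .
      have "1 / (P * G\<^sup>2 * w) * (G / (2 * a) * (w * (G / (2 * b) * i))) = i / (4 * (a * b) * P)"
        if "G > 0" "w > 0" for P G w a b i :: real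
        using that by (simp add: power2_eq_square)
      from this[OF G om] show ?thesis unfolding K_def by (simp only: p div_by_1)
    qed
    have hK: "has_bochner_integral lborel (\<lambda>t. K * (indicator {0..} t * (\<Psi> t * t ^ (d - 1)) * exp (- (\<epsilon> * t\<^sup>2)))) IP"
      using has_bochner_integral_mult_right[OF h2, of K] unfolding const by simp
    have "has_bochner_integral lborel (\<lambda>t. ?gP t * exp (- (\<epsilon> * t\<^sup>2)) - K * (indicator {0..} t * (\<Psi> t * t ^ (d - 1)) * exp (- (\<epsilon> * t\<^sup>2)))) (IP - IP)"
      by (rule has_bochner_integral_diff[OF hP hK])
    moreover have "i * (p * q) * e - K * (i * (s * q) * e) = i * ((p - K * s) * q) * e" for i p q e s :: real
      by (simp add: algebra_simps)
    ultimately show "has_bochner_integral lborel (\<lambda>t. indicator {0..} t * (D t * t ^ (d - 1)) * exp (- (\<epsilon> * t\<^sup>2))) 0"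
      unfolding D_def by (simp only: diff_self)
  qed
  then show ?thesis by (simp add: D_def K_def \<Psi>_def)
qed

lemma set_integral_from_has_bochner:
  fixes f g :: "real \<Rightarrow> real"
  assumes "has_bochner_integral lborel g v" "\<And>t. indicator A t * f t = g t"
  shows "set_integrable lborel A f" and "(LINT t:A|lborel. f t) = v"
  using assms by (simp_all add: set_integrable_def set_lebesgue_integral_def has_bochner_integral_iff)

theorem theorem6p1:
  fixes d :: nat and \<delta> :: real
  assumes "d = CARD('n::finite)"
    and "\<delta> > max 1 (real d / 2)"
  shows
    "(radial_positive_definite TYPE('n) (W \<delta>) \<and>
      (\<forall>r\<ge>0.
        set_integrable lborel {0..}
          (\<lambda>t. Omega (\<delta> - 1/2) (r * t) * max 0 (1 - t) powr (\<delta> - 1) * t powr (2 * \<delta> - 1)) \<and>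
        W \<delta> r = 1 / Beta \<delta> (2 * \<delta>) *
          (LINT t:{0..}|lborel.
             Omega (\<delta> - 1/2) (r * t) * max 0 (1 - t) powr (\<delta> - 1) * t powr (2 * \<delta> - 1)) \<and>
        set_integrable lborel {0..}
          (\<lambda>t. Omega ((real d - 2) / 2) (r * t) * Phi d \<delta> t * t ^ (d - 1)) \<and>
        W \<delta> r = omega d \<delta> *
          (LINT t:{0..}|lborel. Omega ((real d - 2) / 2) (r * t) * Phi d \<delta> t * t ^ (d - 1))))
     \<and>
     ((\<forall>r\<ge>0. 0 < W \<delta> r \<and> W \<delta> r \<le> 1) \<and>
      (\<lambda>r. W \<delta> r - Gamma (3 * \<delta>) / Gamma \<delta> * r powr (- 2 * \<delta>) *
                    (1 + cos (r - \<delta> * pi) / 2 powr (\<delta> - 1)))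
        \<in> O[at_top](\<lambda>r. r powr (- 2 * \<delta> - 1)) \<and>
      comparable_on {0..} (W \<delta>) (\<lambda>r. (1 + r) powr (- 2 * \<delta>)))
     \<and>
     (continuous_on {0..} (W \<delta>) \<and>
      integrable (density (restrict_space lborel {0..}) (\<lambda>r. ennreal (r ^ (d - 1)))) (W \<delta>) \<and>
      (\<forall>t\<ge>0.
        set_integrable lborel {0..}
          (\<lambda>r. Omega ((real d - 2) / 2) (r * t) * W \<delta> r * r ^ (d - 1)) \<and>
        Phi d \<delta> t = 1 / (2 powr (real d - 2) * (Gamma (real d / 2))\<^sup>2 * omega d \<delta>) *
          (LINT r:{0..}|lborel. Omega ((real d - 2) / 2) (r * t) * W \<delta> r * r ^ (d - 1))) \<and>
      radial_positive_definite TYPE('n) (Phi d \<delta>))"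
proof -
  have \<delta>: "\<delta> > 1" "\<delta> > real d / 2" and pos: "\<delta> > 0" using assms(2) by auto
  have d: "d > 0" using assms(1) by simp
  let ?l = "(real d - 2) / 2"
  let ?gW = "\<lambda>r. indicator {0..} r * (W \<delta> r * r ^ (d - 1))" and ?gP = "\<lambda>t. indicator {0..} t * (Phi d \<delta> t * t ^ (d - 1))"
  have l: "?l \<ge> -1/2" "?l > -1" using d by auto
  have om: "omega d \<delta> > 0" by (rule omega_pos[OF d \<delta>(2)])
  have G: "Gamma (real d / 2) > 0" using d by (intro Gamma_real_pos) auto
  have B: "Beta \<delta> (2 * \<delta>) > 0" using pos by (simp add: Beta_def Gamma_real_pos)
  have iW: "integrable lborel ?gW" by (rule integrable_W[OF \<delta> d])
  have iP: "integrable lborel ?gP"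
    using W_eq_Phi_average[OF d \<delta>, of 0] l by (simp add: has_bochner_integral_iff)
  have avg: "W \<delta> r = omega d \<delta> * (\<integral>t. Omega ?l (r * t) * ?gP t \<partial>lborel)" for r
    unfolding has_bochner_integral_integral_eq[OF W_eq_Phi_average[OF d \<delta>]] using om by simp
  note r1 = set_integral_from_has_bochner[OF W_eq_Beta_average[OF pos], of "{0..}"
      "\<lambda>t. Omega (\<delta> - 1/2) (r * t) * max 0 (1 - t) powr (\<delta> - 1) * t powr (2 * \<delta> - 1)" r for r]
  note r2 = set_integral_from_has_bochner[OF W_eq_Phi_average[OF d \<delta>], of "{0..}"
      "\<lambda>t. Omega ?l (r * t) * Phi d \<delta> t * t ^ (d - 1)" r for r]
  \<comment> \<open>Strictness needs a point of positive density; if \<open>Phi\<close> vanished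
    identically, so would its transform \<open>W\<close>, against
    \<open>W \<delta> 0 = 1\<close>.\<close>
  have "\<exists>t0\<ge>0. Phi d \<delta> t0 > 0"
  proof (rule ccontr)
    assume "\<not> (\<exists>t0\<ge>0. Phi d \<delta> t0 > 0)"
    then have "Phi d \<delta> t = 0" if "t \<ge> 0" for t using Phi_nonneg[OF \<delta>, of t] that by force
    then have "?gP t = 0" for t by (simp add: indicator_def)
    then have "W \<delta> 0 = 0" unfolding avg by (simp only: mult_zero_right Bochner_Integration.integral_zero)
    then show False using pos by simp
  qed
  then obtain t0 where t0: "t0 \<ge> 0" "Phi d \<delta> t0 > 0" by blast
  have pdW: "radial_positive_definite TYPE('n) (W \<delta>)"
    by (rule radial_positive_definiteI[OF assms(1) continuous_on_Phi[OF \<delta>] Phi_nonneg[OF \<delta>] iP t0 om avg])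
  have inversion: "Phi d \<delta> t = 1 / (2 powr (real d - 2) * (Gamma (real d / 2))\<^sup>2 * omega d \<delta>) *
      (\<integral>r. Omega ?l (t * r) * ?gW r \<partial>lborel)" if "t \<ge> 0" for t
    by (rule Phi_inversion[OF \<delta> d that])
  \<comment> \<open>The roles are exchanged: by inversion \<open>W\<close> is now the density,
    positive already at 0.\<close>
  have pdP: "radial_positive_definite TYPE('n) (Phi d \<delta>)"
  proof (rule radial_positive_definiteI[OF assms(1) _ _ iW _ _ _ inversion])
    show "continuous_on {0..} (W \<delta>)" by (rule continuous_on_W[OF pos])
    show "0 \<le> W \<delta> t" if "t \<ge> 0" for t using W_pos[OF \<delta>(1) that] by simp
    show "(0::real) \<le> 0" "W \<delta> 0 > 0" using pos by simp_all
    show "1 / (2 powr (real d - 2) * (Gamma (real d / 2))\<^sup>2 * omega d \<delta>) > 0" using G om by simp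
  qed
  have hW: "has_bochner_integral lborel (\<lambda>r. Omega ?l (t * r) * ?gW r) (\<integral>r. Omega ?l (t * r) * ?gW r \<partial>lborel)" for t
    by (rule has_bochner_integral_integrable[OF integrable_Omega_times[OF l(1) iW]])
  note r3 = set_integral_from_has_bochner[OF hW, of "{0..}" "\<lambda>r. Omega ?l (r * t) * W \<delta> r * r ^ (d - 1)" t for t]
  have L1: "integrable (density (restrict_space lborel {0..}) (\<lambda>r. ennreal (r ^ (d - 1)))) (W \<delta>)"
  proof (subst integrable_density)
    show "W \<delta> \<in> borel_measurable (restrict_space lborel {0..})"
      by (intro measurable_restrict_space1) (simp add: borel_measurable_W[OF pos])
    have "(\<lambda>r::real. r ^ (d - 1)) \<in> borel_measurable lborel" by measurable
    then show "(\<lambda>r::real. r ^ (d - 1)) \<in> borel_measurable (restrict_space lborel {0..})"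
      by (rule measurable_restrict_space1)
    show "AE r in restrict_space lborel {0..}. 0 \<le> (r::real) ^ (d - 1)"
      by (intro AE_I2) (simp add: space_restrict_space)
    show "integrable (restrict_space lborel {0..}) (\<lambda>r. r ^ (d - 1) *\<^sub>R W \<delta> r)"
      using iW by (subst integrable_restrict_space) (simp_all add: mult_ac)
  qed
  have e1: "indicator {0..} t * (Omega (\<delta> - 1/2) (r * t) * max 0 (1 - t) powr (\<delta> - 1) * t powr (2 * \<delta> - 1)) =
      Omega (\<delta> - 1/2) (r * t) * (indicator {0..} t * (max 0 (1 - t) powr (\<delta> - 1) * t powr (2 * \<delta> - 1)))" for r t
    by (simp only: mult_ac)
  have e2: "indicator {0..} t * (Omega ?l (r * t) * Phi d \<delta> t * t ^ (d - 1)) = Omega ?l (r * t) * ?gP t" for r t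
    by (simp only: mult_ac)
  have e3: "indicator {0..} r * (Omega ?l (r * t) * W \<delta> r * r ^ (d - 1)) = Omega ?l (t * r) * ?gW r" for r t
    by (simp only: mult_ac)
  show ?thesis
  proof (intro conjI allI impI)
    fix r :: real assume r: "r \<ge> 0"
    show "set_integrable lborel {0..} (\<lambda>t. Omega (\<delta> - 1/2) (r * t) * max 0 (1 - t) powr (\<delta> - 1) * t powr (2 * \<delta> - 1))"
      by (rule r1(1)[OF e1])
    show "W \<delta> r = 1 / Beta \<delta> (2 * \<delta>) *
          (LINT t:{0..}|lborel. Omega (\<delta> - 1/2) (r * t) * max 0 (1 - t) powr (\<delta> - 1) * t powr (2 * \<delta> - 1))"
      unfolding r1(2)[OF e1] using B by simp
    show "set_integrable lborel {0..} (\<lambda>t. Omega ?l (r * t) * Phi d \<delta> t * t ^ (d - 1))"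
      by (rule r2(1)[OF e2])
    show "W \<delta> r = omega d \<delta> * (LINT t:{0..}|lborel. Omega ?l (r * t) * Phi d \<delta> t * t ^ (d - 1))"
      unfolding r2(2)[OF e2] using om by simp
    show "0 < W \<delta> r" by (rule W_pos[OF \<delta>(1) r])
    show "W \<delta> r \<le> 1" by (rule W_le_1[OF pos])
  next
    fix t :: real assume t: "t \<ge> 0"
    show "set_integrable lborel {0..} (\<lambda>r. Omega ?l (r * t) * W \<delta> r * r ^ (d - 1))"
      by (rule r3(1)[OF e3])
    show "Phi d \<delta> t = 1 / (2 powr (real d - 2) * (Gamma (real d / 2))\<^sup>2 * omega d \<delta>) *
          (LINT r:{0..}|lborel. Omega ?l (r * t) * W \<delta> r * r ^ (d - 1))"
      unfolding r3(2)[OF e3] by (rule inversion[OF t])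
  qed (rule pdW W_asymptotics[OF \<delta>(1)] W_comparable[OF \<delta>(1)] continuous_on_W[OF pos] L1 pdP)+
qed

end
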